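(* Suppose that $K^{\frac12}(x)$ are complex-linear operators on $V^{\frac12}$ depending meromorphically on $x\in\mathbb{C}$ and satisfying the reflection equation $$R^{\frac12\frac12}_{21}(x-y)K_1^{\frac12}(x)R^{\frac12\frac12}(x+y)K_2^{\frac12}(y)=K_2^{\frac12}(y)R^{\frac12\frac12}_{21}(x+y)K_1^{\frac12}(x)R^{\frac12\frac12}(x-y)$$ as linear operators on $V^{\frac12}\otimes V^{\frac12}$. Then there exist unique complex-linear operators $K^k(x)$ on $V^k$ for $k\in\{1,\frac32,2,\ldots\}$ (depending meromorphically on $x$) satisfying $$j^kK^{k+\frac12}(x)=P^{\frac12k}K^{\frac12}_1(x-k\eta)\,R^{\frac12k}\bigl(2x-(k-\tfrac12)\eta\bigr)\,K_2^k(x+\tfrac{\eta}{2})\,\iota^k$$ for all $k\in\{\frac12,1,\frac32,\ldots\}$. Furthermore, $$R^{\ell k}_{21}(x-y)K_1^k(x)R^{k\ell}(x+y)K_2^\ell(y)=K_2^\ell(y)R_{21}^{\ell k}(x+y)K_1^k(x)R^{k\ell}(x-y)$$ as linear operators on $V^k\otimes V^\ell$ for all $k,\ell\in\{\frac12,1,\frac32,\ldots\}$.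
   Context: Quantum affine $\mathfrak{sl}_2$. Fix $\eta\in\mathbb{C}$ generic, in particular such that $p:=e^\eta$ is not a root of unity; $p^x:=e^{\eta x}$. Let $\mathfrak{h}=\mathbb{C}h_0\oplus\mathbb{C}h_1$. $\widehat{\mathcal{U}}_\eta$ is the Hopf algebra generated by $e_i,f_i$ ($i=0,1$), $p^h$ ($h\in\mathfrak{h}$) with relations $p^0=1$, $p^{h+h'}=p^hp^{h'}$, $p^he_ip^{-h}=p^{\alpha_i(h)}e_i$, $p^hf_ip^{-h}=p^{-\alpha_i(h)}f_i$, $[e_i,f_j]=\delta_{i,j}\frac{p^{h_i}-p^{-h_i}}{p-p^{-1}}$ and, for $i\neq j$, $e_i^3e_j-(p^2+1+p^{-2})e_i^2e_je_i+(p^2+1+p^{-2})e_ie_je_i^2-e_je_i^3=0$ and the same with $f$'s; here $\alpha_j(h_i)=2$ if $i=j$ and $-2$ if $i\ne j$. Comultiplication: $\Delta(p^h)=p^h\otimes p^h$, $\Delta(e_i)=e_i\otimes1+p^{-h_i}\otimes e_i$, $\Delta(f_i)=f_i\otimes p^{h_i}+1\otimes f_i$; $\Delta^{\mathrm{op}}$ is the opposite comultiplication. $\mathcal{U}_\eta$ is the subalgebra generated by $e_1,f_1,p^{\lambda h_1}$ ($\lambda\in\mathbb{C}$). Modules. For $\ell\in\mathbb{C}$, $M^\ell=\bigoplus_{n\ge1}\mathbb{C}m_n^\ell$ is the $\mathcal{U}_\eta$-module with $\pi^\ell(p^{\lambda h_1})m_n^\ell=p^{2\lambda(\ell+1-n)}m_n^\ell$,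 $\pi^\ell(e_1)m_n^\ell=\frac{\sinh((n-1)\eta)\sinh((2\ell+2-n)\eta)}{\sinh(\eta)^2}m_{n-1}^\ell$, $\pi^\ell(f_1)m_n^\ell=m_{n+1}^\ell$ ($m_0^\ell:=0$). For $k\in\frac12\mathbb{Z}_{\ge0}$, $V^k$ is the quotient of $M^k$ by the submodule $\bigoplus_{n\ge2k+2}\mathbb{C}m_n^k$, $\mathrm{pr}^k:M^k\to V^k$ is the projection, and $v_n^k=\mathrm{pr}^k(m_n^k)$ ($1\le n\le2k+1$) is the weight basis of $V^k$. For $x\in\mathbb{C}$, $\phi_x:\widehat{\mathcal{U}}_\eta\to\mathcal{U}_\eta$ is the algebra homomorphism with $p^{\lambda h_0}\mapsto p^{-\lambda h_1}$, $p^{\lambda h_1}\mapsto p^{\lambda h_1}$, $e_0\mapsto e^{-x}f_1$, $e_1\mapsto e^{-x}e_1$, $f_0\mapsto e^xe_1$, $f_1\mapsto e^xf_1$; $\pi^\ell_x:=\pi^\ell\circ\phi_x$. $R$-operators. For $k,\ell\in\mathbb{C}$, $\mathcal{R}^{k\ell}(x)$ is the linear operator on $M^k\otimes M^\ell$, with matrix coefficients rational in $e^x$, uniquely determined by $\mathcal{R}^{k\ell}(x)(m_1^k\otimes m_1^\ell)=m_1^k\otimes m_1^\ell$ and, for generic $x,y$, $\mathcal{R}^{k\ell}(x-y)(\pi^k_x\otimes\pi^\ell_y)(\Delta(X))=(\pi_x^k\otimes\pi_y^\ell)(\Delta^{\mathrm{op}}(X))\mathcal{R}^{k\ell}(x-y)$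 for all $X\in\widehat{\mathcal{U}}_\eta$. For $k,\ell\in\frac12\mathbb{Z}_{\ge0}$, $R^{k\ell}(x)$ is the unique operator on $V^k\otimes V^\ell$ with $(\mathrm{pr}^k\otimes\mathrm{pr}^\ell)\mathcal{R}^{k\ell}(x)=R^{k\ell}(x)(\mathrm{pr}^k\otimes\mathrm{pr}^\ell)$. Notation. $P^{k\ell}:V^k\otimes V^\ell\to V^\ell\otimes V^k$ is the permutation operator and $R_{21}^{\ell k}(x):=P^{\ell k}R^{\ell k}(x)P^{k\ell}$, an operator on $V^k\otimes V^\ell$. On a two-fold tensor product, $K_1(x)=K(x)\otimes\mathrm{Id}$ and $K_2(y)=\mathrm{Id}\otimes K(y)$. Set $v_0^k:=0$, $v_{2k+2}^k:=0$. The injective linear map $\iota^k:V^{k+\frac12}\to V^{\frac12}\otimes V^k$ is $$\iota^k(v_n^{k+\frac12})=e^{\frac{\eta}{2}(n-1)}v_1^{\frac12}\otimes v_n^k+e^{-\frac{\eta}{2}(n-2-2k)}\frac{\sinh((n-1)\eta)}{\sinh(\eta)}v_2^{\frac12}\otimes v_{n-1}^k,$$ and $j^k:=P^{\frac12k}\iota^k:V^{k+\frac12}\to V^k\otimes V^{\frac12}$. Equations are identities of meromorphic operator-valued functions of $x$ and $y$. *)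

theory Defs
  imports
    "HOL-Complex_Analysis.Complex_Analysis"
    "HOL-Computational_Algebra.Polynomial"
    "HOL-Library.Poly_Mapping"
begin

section \<open>Complex vector spaces with a distinguished basis\<close>

text \<open>
  \<open>'b \<Rightarrow>\<^sub>0 complex\<close> is the complex vector space with basis \<open>'b\<close>, and the tensor product of the
  spaces with bases \<open>'a\<close> and \<open>'b\<close> is the space with basis \<open>'a \<times> 'b\<close>.
\<close>

type_synonym 'b vec = "'b \<Rightarrow>\<^sub>0 complex"

definition bas :: "'b \<Rightarrow> 'b vec" where
  "bas b = Poly_Mapping.single b 1"

definition smul :: "complex \<Rightarrow> 'b vec \<Rightarrow> 'b vec" where
  "smul c u = Poly_Mapping.map ((*) c) u"

definition lin_ext :: "('a \<Rightarrow> 'b vec) \<Rightarrow> 'a vec \<Rightarrow> 'b vec" where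
  "lin_ext g u = (\<Sum>a\<in>Poly_Mapping.keys u. smul (Poly_Mapping.lookup u a) (g a))"

definition tens :: "'a vec \<Rightarrow> 'b vec \<Rightarrow> ('a \<times> 'b) vec" where
  "tens u v = lin_ext (\<lambda>a. lin_ext (\<lambda>b. bas (a, b)) v) u"

definition tens_op ::
    "('a vec \<Rightarrow> 'c vec) \<Rightarrow> ('b vec \<Rightarrow> 'd vec) \<Rightarrow> ('a \<times> 'b) vec \<Rightarrow> ('c \<times> 'd) vec" where
  "tens_op A B = lin_ext (\<lambda>(a, b). tens (A (bas a)) (B (bas b)))"

text \<open>The permutation operators \<open>P\<close>.\<close>

definition perm :: "('a \<times> 'b) vec \<Rightarrow> ('b \<times> 'a) vec" where
  "perm = lin_ext (\<lambda>(a, b). bas (b, a))"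

definition coord_space :: "'b set \<Rightarrow> 'b vec set" where
  "coord_space B = {u. Poly_Mapping.keys u \<subseteq> B}"

definition linear_map :: "'a vec set \<Rightarrow> 'b vec set \<Rightarrow> ('a vec \<Rightarrow> 'b vec) \<Rightarrow> bool" where
  "linear_map U W T \<longleftrightarrow>
     (\<forall>u\<in>U. T u \<in> W) \<and>
     (\<forall>u\<in>U. \<forall>v\<in>U. T (u + v) = T u + T v) \<and>
     (\<forall>c. \<forall>u\<in>U. T (smul c u) = smul c (T u))"

text \<open>The coefficient of \<open>bas b\<close> in \<open>T (bas a)\<close>.\<close>

definition mcoeff :: "('a vec \<Rightarrow> 'b vec) \<Rightarrow> 'a \<Rightarrow> 'b \<Rightarrow> complex" where
  "mcoeff T a b = Poly_Mapping.lookup (T (bas a)) b"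

definition meromorphic_operator :: "'b set \<Rightarrow> (complex \<Rightarrow> 'b vec \<Rightarrow> 'b vec) \<Rightarrow> bool" where
  "meromorphic_operator B T \<longleftrightarrow>
     (\<forall>x. linear_map (coord_space B) (coord_space B) (T x)) \<and>
     (\<forall>a\<in>B. \<forall>b\<in>B. (\<lambda>x. mcoeff (T x) a b) meromorphic_on UNIV)"

text \<open>
  A meromorphic family \<open>T\<close> is a total function, whose values at poles (and on any discrete set)
  are irrelevant. An identity of meromorphic functions is therefore required at those arguments
  at which all its constituents are regular; these form a dense open set.
\<close>

definition regular_at :: "'b set \<Rightarrow> (complex \<Rightarrow> 'b vec \<Rightarrow> 'b vec) \<Rightarrow> complex \<Rightarrow> bool" where
  "regular_at B T x \<longleftrightarrow> (\<forall>a\<in>B. \<forall>b\<in>B. (\<lambda>z. mcoeff (T z) a b) analytic_on {x})"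

text \<open>
  Since the fraction is reduced and \<open>c / 0 = 0\<close>, a function that is rational in \<open>exp x\<close> in the
  following sense takes the value 0 at its poles and has no removable singularities. Hence it is
  determined, at every point, by its values on any dense set.
\<close>

definition rational_in_exp :: "(complex \<Rightarrow> complex) \<Rightarrow> bool" where
  "rational_in_exp f \<longleftrightarrow>
     (\<exists>p q :: complex poly. q \<noteq> 0 \<and> coprime p q \<and> (\<forall>x. f x = poly p (exp x) / poly q (exp x)))"


section \<open>Unital algebras given by generators and relations\<close>

text \<open>
  Terms over a set of generators; \<open>Const c\<close> stands for \<open>c\<close> times the unit. The arithmetic
  operations on terms are purely syntactic; the algebra laws are imposed by \<open>alg_eq\<close> below.
\<close>

datatype 'g alg = Gen 'g | Const complex | Add "'g alg" "'g alg" | Mul "'g alg" "'g alg"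

instantiation alg :: (type) "{zero, one, plus, times, uminus, minus}"
begin
definition zero_alg :: "'a alg" where "zero_alg = Const 0"
definition one_alg :: "'a alg" where "one_alg = Const 1"
definition plus_alg :: "'a alg \<Rightarrow> 'a alg \<Rightarrow> 'a alg" where "plus_alg = Add"
definition times_alg :: "'a alg \<Rightarrow> 'a alg \<Rightarrow> 'a alg" where "times_alg = Mul"
definition uminus_alg :: "'a alg \<Rightarrow> 'a alg" where "uminus_alg s = Mul (Const (-1)) s"
definition minus_alg :: "'a alg \<Rightarrow> 'a alg \<Rightarrow> 'a alg" where "minus_alg s t = Add s (Mul (Const (-1)) t)"
instance ..
end

instance alg :: (type) power ..

text \<open>
  The least congruence containing the relations \<open>\<rho>\<close> and the laws of associative unital complex
  algebras; its classes are the elements of the algebra presented by \<open>\<rho>\<close>.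
\<close>

inductive alg_eq :: "('g alg \<times> 'g alg) set \<Rightarrow> 'g alg \<Rightarrow> 'g alg \<Rightarrow> bool" for \<rho> where
  rel: "(s, t) \<in> \<rho> \<Longrightarrow> alg_eq \<rho> s t"
| refl: "alg_eq \<rho> s s"
| sym: "alg_eq \<rho> s t \<Longrightarrow> alg_eq \<rho> t s"
| trans: "alg_eq \<rho> s t \<Longrightarrow> alg_eq \<rho> t u \<Longrightarrow> alg_eq \<rho> s u"
| add_cong: "alg_eq \<rho> s s' \<Longrightarrow> alg_eq \<rho> t t' \<Longrightarrow> alg_eq \<rho> (s + t) (s' + t')"
| mult_cong: "alg_eq \<rho> s s' \<Longrightarrow> alg_eq \<rho> t t' \<Longrightarrow> alg_eq \<rho> (s * t) (s' * t')"
| add_assoc: "alg_eq \<rho> ((s + t) + u) (s + (t + u))"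
| add_commute: "alg_eq \<rho> (s + t) (t + s)"
| add_zero: "alg_eq \<rho> (s + 0) s"
| add_minus: "alg_eq \<rho> (s + (- s)) 0"
| mult_assoc: "alg_eq \<rho> ((s * t) * u) (s * (t * u))"
| mult_one: "alg_eq \<rho> (s * 1) s"
| one_mult: "alg_eq \<rho> (1 * s) s"
| distrib_left: "alg_eq \<rho> (s * (t + u)) (s * t + s * u)"
| distrib_right: "alg_eq \<rho> ((s + t) * u) (s * u + t * u)"
| const_add: "alg_eq \<rho> (Const (c + d)) (Const c + Const d)"
| const_mult: "alg_eq \<rho> (Const (c * d)) (Const c * Const d)"
| const_central: "alg_eq \<rho> (Const c * s) (s * Const c)"

definition presented :: "('g alg \<times> 'g alg) set \<Rightarrow> 'g alg set set" where
  "presented \<rho> = UNIV // {(s, t). alg_eq \<rho> s t}"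

text \<open>The homomorphism of term algebras given by its values on the generators.\<close>

primrec alg_hom :: "('g \<Rightarrow> 'h alg) \<Rightarrow> 'g alg \<Rightarrow> 'h alg" where
  "alg_hom \<theta> (Gen g) = \<theta> g"
| "alg_hom \<theta> (Const c) = Const c"
| "alg_hom \<theta> (Add s t) = alg_hom \<theta> s + alg_hom \<theta> t"
| "alg_hom \<theta> (Mul s t) = alg_hom \<theta> s * alg_hom \<theta> t"

text \<open>The representation given by the action of the generators.\<close>

primrec alg_rep :: "('g \<Rightarrow> 'b vec \<Rightarrow> 'b vec) \<Rightarrow> 'g alg \<Rightarrow> 'b vec \<Rightarrow> 'b vec" where
  "alg_rep \<theta> (Gen g) = \<theta> g"
| "alg_rep \<theta> (Const c) = smul c"
| "alg_rep \<theta> (Add s t) = (\<lambda>u. alg_rep \<theta> s u + alg_rep \<theta> t u)"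
| "alg_rep \<theta> (Mul s t) = alg_rep \<theta> s \<circ> alg_rep \<theta> t"

text \<open>
  The tensor product of two presented algebras is generated by two commuting copies of the
  generators, \<open>Gen (Inl g)\<close> for \<open>g \<otimes> 1\<close> and \<open>Gen (Inr h)\<close> for \<open>1 \<otimes> h\<close>.
\<close>

definition left_copy :: "'g alg \<Rightarrow> ('g + 'h) alg" where
  "left_copy = alg_hom (Gen \<circ> Inl)"

definition right_copy :: "'h alg \<Rightarrow> ('g + 'h) alg" where
  "right_copy = alg_hom (Gen \<circ> Inr)"

definition tens_alg :: "'g alg \<Rightarrow> 'h alg \<Rightarrow> ('g + 'h) alg" where
  "tens_alg s t = left_copy s * right_copy t"

definition flip :: "('g + 'h) alg \<Rightarrow> ('h + 'g) alg" where
  "flip = alg_hom (case_sum (Gen \<circ> Inr) (Gen \<circ> Inl))"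

definition tens_rep ::
    "('g alg \<Rightarrow> 'a vec \<Rightarrow> 'a vec) \<Rightarrow> ('h alg \<Rightarrow> 'b vec \<Rightarrow> 'b vec) \<Rightarrow>
     ('g + 'h) alg \<Rightarrow> ('a \<times> 'b) vec \<Rightarrow> ('a \<times> 'b) vec" where
  "tens_rep \<pi> \<pi>' = alg_rep (case_sum (\<lambda>g. tens_op (\<pi> (Gen g)) id) (\<lambda>h. tens_op id (\<pi>' (Gen h))))"


section \<open>Quantum affine sl2\<close>

definition ppow :: "complex \<Rightarrow> complex \<Rightarrow> complex" where
  "ppow \<eta> x = exp (\<eta> * x)"

datatype node = N0 | N1

text \<open>The pair \<open>(a, b)\<close> represents \<open>a h\<^sub>0 + b h\<^sub>1\<close>.\<close>

type_synonym cartan = "complex \<times> complex"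

fun hh :: "node \<Rightarrow> cartan" where
  "hh N0 = (1, 0)"
| "hh N1 = (0, 1)"

fun aroot :: "node \<Rightarrow> cartan \<Rightarrow> complex" where
  "aroot N0 (a, b) = 2 * a - 2 * b"
| "aroot N1 (a, b) = 2 * b - 2 * a"

datatype affine_gen = Egen node | Fgen node | Pgen cartan

abbreviation gE where "gE i \<equiv> Gen (Egen i)"
abbreviation gF where "gF i \<equiv> Gen (Fgen i)"
abbreviation gP where "gP h \<equiv> Gen (Pgen h)"

definition serre :: "complex \<Rightarrow> 'g alg \<Rightarrow> 'g alg \<Rightarrow> 'g alg" where
  "serre \<eta> s t =
     (let c = Const (ppow \<eta> 2 + 1 + ppow \<eta> (-2))
      in s ^ 3 * t - c * s ^ 2 * t * s + c * s * t * s ^ 2 - t * s ^ 3)"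

definition affine_rels :: "complex \<Rightarrow> (affine_gen alg \<times> affine_gen alg) set" where
  "affine_rels \<eta> =
     {(gP 0, 1)} \<union>
     {(gP (h + h'), gP h * gP h') | h h'. True} \<union>
     {(gP h * gE i * gP (- h), Const (ppow \<eta> (aroot i h)) * gE i) | h i. True} \<union>
     {(gP h * gF i * gP (- h), Const (ppow \<eta> (- aroot i h)) * gF i) | h i. True} \<union>
     {(gE i * gF j - gF j * gE i,
       if i = j then Const (1 / (ppow \<eta> 1 - ppow \<eta> (-1))) * (gP (hh i) - gP (- hh i)) else 0)
      | i j. True} \<union>
     {(serre \<eta> (gE i) (gE j), 0) | i j. i \<noteq> j} \<union>
     {(serre \<eta> (gF i) (gF j), 0) | i j. i \<noteq> j}"

definition Uhat :: "complex \<Rightarrow> affine_gen alg set set" where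
  "Uhat \<eta> = presented (affine_rels \<eta>)"

primrec comult_gen :: "affine_gen \<Rightarrow> (affine_gen + affine_gen) alg" where
  "comult_gen (Egen i) = tens_alg (gE i) 1 + tens_alg (gP (- hh i)) (gE i)"
| "comult_gen (Fgen i) = tens_alg (gF i) (gP (hh i)) + tens_alg 1 (gF i)"
| "comult_gen (Pgen h) = tens_alg (gP h) (gP h)"

definition comult :: "affine_gen alg \<Rightarrow> (affine_gen + affine_gen) alg" where
  "comult = alg_hom comult_gen"

definition comult_op :: "affine_gen alg \<Rightarrow> (affine_gen + affine_gen) alg" where
  "comult_op t = flip (comult t)"

text \<open>
  The generators \<open>e\<^sub>1\<close>, \<open>f\<^sub>1\<close> and \<open>p\<close> to the power \<open>\<lambda> h\<^sub>1\<close> of the subalgebra \<open>U\<close>.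
\<close>

datatype sl2_gen = SE | SF | SP complex

primrec phi_gen :: "complex \<Rightarrow> affine_gen \<Rightarrow> sl2_gen alg" where
  "phi_gen x (Egen i) =
     (case i of N0 \<Rightarrow> Const (exp (- x)) * Gen SF | N1 \<Rightarrow> Const (exp (- x)) * Gen SE)"
| "phi_gen x (Fgen i) =
     (case i of N0 \<Rightarrow> Const (exp x) * Gen SE | N1 \<Rightarrow> Const (exp x) * Gen SF)"
| "phi_gen x (Pgen h) = Gen (SP (snd h - fst h))"

definition phi :: "complex \<Rightarrow> affine_gen alg \<Rightarrow> sl2_gen alg" where
  "phi x = alg_hom (phi_gen x)"


section \<open>Modules\<close>

text \<open>
  The underlying space of every \<open>M\<^sup>\<ell>\<close> is \<open>nat vec\<close>, with \<open>m\<^sub>n = bas (n - 1)\<close> for \<open>n \<ge> 1\<close>.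
\<close>

definition mvec :: "nat \<Rightarrow> nat vec" where
  "mvec n = (if n = 0 then 0 else bas (n - 1))"

primrec verma_gen :: "complex \<Rightarrow> complex \<Rightarrow> sl2_gen \<Rightarrow> nat vec \<Rightarrow> nat vec" where
  "verma_gen \<eta> l SE = lin_ext (\<lambda>i. let n = i + 1 in
     smul (sinh ((of_nat n - 1) * \<eta>) * sinh ((2 * l + 2 - of_nat n) * \<eta>) / (sinh \<eta>)\<^sup>2) (mvec (n - 1)))"
| "verma_gen \<eta> l SF = lin_ext (\<lambda>i. let n = i + 1 in mvec (n + 1))"
| "verma_gen \<eta> l (SP a) = lin_ext (\<lambda>i. let n = i + 1 in
     smul (ppow \<eta> (2 * a * (l + 1 - of_nat n))) (mvec n))"

definition verma :: "complex \<Rightarrow> complex \<Rightarrow> sl2_gen alg \<Rightarrow> nat vec \<Rightarrow> nat vec" where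
  "verma \<eta> l = alg_rep (verma_gen \<eta> l)"

definition eval_verma :: "complex \<Rightarrow> complex \<Rightarrow> complex \<Rightarrow> affine_gen alg \<Rightarrow> nat vec \<Rightarrow> nat vec" where
  "eval_verma \<eta> l x = verma \<eta> l \<circ> phi x"

text \<open>
  From here on a natural number \<open>d\<close> encodes the half-integer \<open>d / 2\<close>. The quotient \<open>V\<^sup>k\<close> of \<open>M\<^sup>k\<close>,
  \<open>k = d / 2\<close>, is modelled by the span of \<open>m\<^sub>1, \<dots>, m\<^sub>d\<^sub>+\<^sub>1\<close>, with \<open>pr_V d\<close>, whose kernel is the span
  of the \<open>m\<^sub>n\<close> with \<open>n \<ge> d + 2\<close>, as the quotient map.
\<close>

definition half :: "nat \<Rightarrow> complex" where
  "half d = of_nat d / 2"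

definition V_space :: "nat \<Rightarrow> nat vec set" where
  "V_space d = coord_space {..d}"

definition VV_space :: "nat \<Rightarrow> nat \<Rightarrow> (nat \<times> nat) vec set" where
  "VV_space d l = coord_space ({..d} \<times> {..l})"

definition pr_V :: "nat \<Rightarrow> nat vec \<Rightarrow> nat vec" where
  "pr_V d = lin_ext (\<lambda>i. if i \<le> d then bas i else 0)"

text \<open>This gives \<open>vvec d 0 = 0\<close> and \<open>vvec d (d + 2) = 0\<close>.\<close>

definition vvec :: "nat \<Rightarrow> nat \<Rightarrow> nat vec" where
  "vvec d n = pr_V d (mvec n)"


section \<open>R-operators\<close>

text \<open>
  Infinitely many matrix coefficients are involved, so the generic arguments are those outside
  a countable set. Elements \<open>X\<close> of \<open>Uhat \<eta>\<close> are classes of terms \<open>t\<close>; both sides of the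
  intertwining relation depend on the class only.
\<close>

definition is_verma_R ::
    "complex \<Rightarrow> complex \<Rightarrow> complex \<Rightarrow> (complex \<Rightarrow> (nat \<times> nat) vec \<Rightarrow> (nat \<times> nat) vec) \<Rightarrow> bool" where
  "is_verma_R \<eta> k l R \<longleftrightarrow>
     (\<forall>x. linear_map UNIV UNIV (R x)) \<and>
     (\<forall>a b. rational_in_exp (\<lambda>x. mcoeff (R x) a b)) \<and>
     (\<forall>x. R x (tens (mvec 1) (mvec 1)) = tens (mvec 1) (mvec 1)) \<and>
     (\<exists>Z. countable Z \<and>
        (\<forall>x y. x - y \<notin> Z \<longrightarrow>
           (\<forall>X\<in>Uhat \<eta>. \<forall>t\<in>X.
              R (x - y) \<circ> tens_rep (eval_verma \<eta> k x) (eval_verma \<eta> l y) (comult t) =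
              tens_rep (eval_verma \<eta> k x) (eval_verma \<eta> l y) (comult_op t) \<circ> R (x - y))))"

definition verma_R ::
    "complex \<Rightarrow> complex \<Rightarrow> complex \<Rightarrow> complex \<Rightarrow> (nat \<times> nat) vec \<Rightarrow> (nat \<times> nat) vec" where
  "verma_R \<eta> k l = (THE R. is_verma_R \<eta> k l R)"

text \<open>
  Operators on \<open>V\<^sup>k \<otimes> V\<^sup>\<ell>\<close> are extended to the ambient space through the projection, to make the
  definite description below unambiguous.
\<close>

definition is_fin_R ::
    "complex \<Rightarrow> nat \<Rightarrow> nat \<Rightarrow> (complex \<Rightarrow> (nat \<times> nat) vec \<Rightarrow> (nat \<times> nat) vec) \<Rightarrow> bool" where
  "is_fin_R \<eta> d l S \<longleftrightarrow>
     (\<forall>x. linear_map UNIV (VV_space d l) (S x)) \<and>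
     (\<forall>x. S x = S x \<circ> tens_op (pr_V d) (pr_V l)) \<and>
     (\<forall>a b. rational_in_exp (\<lambda>x. mcoeff (S x) a b)) \<and>
     (\<exists>Z. countable Z \<and>
        (\<forall>x. x \<notin> Z \<longrightarrow>
           tens_op (pr_V d) (pr_V l) \<circ> verma_R \<eta> (half d) (half l) x = S x \<circ> tens_op (pr_V d) (pr_V l)))"

definition fin_R :: "complex \<Rightarrow> nat \<Rightarrow> nat \<Rightarrow> complex \<Rightarrow> (nat \<times> nat) vec \<Rightarrow> (nat \<times> nat) vec" where
  "fin_R \<eta> d l = (THE S. is_fin_R \<eta> d l S)"

text \<open>With \<open>\<ell> = l / 2\<close> and \<open>k = d / 2\<close>, this acts on \<open>V\<^sup>k \<otimes> V\<^sup>\<ell>\<close>.\<close>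

definition fin_R21 :: "complex \<Rightarrow> nat \<Rightarrow> nat \<Rightarrow> complex \<Rightarrow> (nat \<times> nat) vec \<Rightarrow> (nat \<times> nat) vec" where
  "fin_R21 \<eta> l d x = perm \<circ> fin_R \<eta> l d x \<circ> perm"

definition R_regular_at :: "complex \<Rightarrow> nat \<Rightarrow> nat \<Rightarrow> complex \<Rightarrow> bool" where
  "R_regular_at \<eta> d l = regular_at ({..d} \<times> {..l}) (fin_R \<eta> d l)"


section \<open>K-operators\<close>

definition op1 :: "(nat vec \<Rightarrow> nat vec) \<Rightarrow> (nat \<times> nat) vec \<Rightarrow> (nat \<times> nat) vec" where
  "op1 T = tens_op T id"

definition op2 :: "(nat vec \<Rightarrow> nat vec) \<Rightarrow> (nat \<times> nat) vec \<Rightarrow> (nat \<times> nat) vec" where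
  "op2 T = tens_op id T"

definition meromorphic_K :: "nat \<Rightarrow> (complex \<Rightarrow> nat vec \<Rightarrow> nat vec) \<Rightarrow> bool" where
  "meromorphic_K d K = meromorphic_operator {..d} K"

definition K_regular_at :: "nat \<Rightarrow> (complex \<Rightarrow> nat vec \<Rightarrow> nat vec) \<Rightarrow> complex \<Rightarrow> bool" where
  "K_regular_at d K = regular_at {..d} K"

text \<open>Equality as meromorphic functions with values in the operators on \<open>V_space d\<close>.\<close>

definition same_K ::
    "nat \<Rightarrow> (complex \<Rightarrow> nat vec \<Rightarrow> nat vec) \<Rightarrow> (complex \<Rightarrow> nat vec \<Rightarrow> nat vec) \<Rightarrow> bool" where
  "same_K d K K' \<longleftrightarrow>
     (\<forall>x. K_regular_at d K x \<longrightarrow> K_regular_at d K' x \<longrightarrow> (\<forall>u\<in>V_space d. K x u = K' x u))"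

definition reflection_equation ::
    "complex \<Rightarrow> nat \<Rightarrow> nat \<Rightarrow> (complex \<Rightarrow> nat vec \<Rightarrow> nat vec) \<Rightarrow> (complex \<Rightarrow> nat vec \<Rightarrow> nat vec) \<Rightarrow> bool" where
  "reflection_equation \<eta> d l K L \<longleftrightarrow>
     (\<forall>x y. K_regular_at d K x \<longrightarrow> K_regular_at l L y \<longrightarrow>
        R_regular_at \<eta> d l (x - y) \<longrightarrow> R_regular_at \<eta> d l (x + y) \<longrightarrow>
        R_regular_at \<eta> l d (x - y) \<longrightarrow> R_regular_at \<eta> l d (x + y) \<longrightarrow>
        (\<forall>u\<in>VV_space d l.
           (fin_R21 \<eta> l d (x - y) \<circ> op1 (K x) \<circ> fin_R \<eta> d l (x + y) \<circ> op2 (L y)) u =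
           (op2 (L y) \<circ> fin_R21 \<eta> l d (x + y) \<circ> op1 (K x) \<circ> fin_R \<eta> d l (x - y)) u))"

text \<open>
  The maps \<open>\<iota>\<^sup>k\<close> and \<open>j\<^sup>k\<close> for \<open>k = d / 2\<close>, defined on \<open>V_space (d + 1)\<close>; here \<open>2 k = d\<close>.
\<close>

definition iota :: "complex \<Rightarrow> nat \<Rightarrow> nat vec \<Rightarrow> (nat \<times> nat) vec" where
  "iota \<eta> d = lin_ext (\<lambda>i. let n = i + 1 in
     smul (exp (\<eta> / 2 * (of_nat n - 1))) (tens (vvec 1 1) (vvec d n)) +
     smul (exp (- (\<eta> / 2) * (of_nat n - 2 - of_nat d)) * (sinh ((of_nat n - 1) * \<eta>) / sinh \<eta>))
       (tens (vvec 1 2) (vvec d (n - 1))))"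

definition jmap :: "complex \<Rightarrow> nat \<Rightarrow> nat vec \<Rightarrow> (nat \<times> nat) vec" where
  "jmap \<eta> d = perm \<circ> iota \<eta> d"

text \<open>
  The fusion relation for \<open>k = d / 2\<close>, where \<open>Kh\<close>, \<open>K\<close> and \<open>K'\<close> are the K-operators of spins \<open>1/2\<close>,
  \<open>k\<close> and \<open>k + 1/2\<close>.
\<close>

definition fusion_relation ::
    "complex \<Rightarrow> nat \<Rightarrow> (complex \<Rightarrow> nat vec \<Rightarrow> nat vec) \<Rightarrow> (complex \<Rightarrow> nat vec \<Rightarrow> nat vec) \<Rightarrow>
     (complex \<Rightarrow> nat vec \<Rightarrow> nat vec) \<Rightarrow> bool" where
  "fusion_relation \<eta> d Kh K K' \<longleftrightarrow>
     (\<forall>x. K_regular_at (d + 1) K' x \<longrightarrow>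
        K_regular_at 1 Kh (x - half d * \<eta>) \<longrightarrow>
        R_regular_at \<eta> 1 d (2 * x - (half d - 1 / 2) * \<eta>) \<longrightarrow>
        K_regular_at d K (x + \<eta> / 2) \<longrightarrow>
        (\<forall>u\<in>V_space (d + 1).
           (jmap \<eta> d \<circ> K' x) u =
           (perm \<circ> op1 (Kh (x - half d * \<eta>)) \<circ> fin_R \<eta> 1 d (2 * x - (half d - 1 / 2) * \<eta>)
             \<circ> op2 (K (x + \<eta> / 2)) \<circ> iota \<eta> d) u))"

definition fused_family ::
    "complex \<Rightarrow> (complex \<Rightarrow> nat vec \<Rightarrow> nat vec) \<Rightarrow> (nat \<Rightarrow> complex \<Rightarrow> nat vec \<Rightarrow> nat vec) \<Rightarrow> bool" where
  "fused_family \<eta> Kh K \<longleftrightarrow>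
     K 1 = Kh \<and>
     (\<forall>d\<ge>2. meromorphic_K d (K d)) \<and>
     (\<forall>d\<ge>1. fusion_relation \<eta> d Kh (K d) (K (d + 1)))"

end

theory Submission
  imports Defs "HOL-Computational_Algebra.Field_as_Ring"
    "HOL-Computational_Algebra.Polynomial_Factorial"
begin

text \<open>
  With \<open>z = exp (x - y)\<close>, the coproducts of \<open>e\<^sub>0\<close> and \<open>f\<^sub>1\<close> act on a tensor product of two evaluation
  modules, up to scalars, as two operators \<open>A\<close> and \<open>B\<close> that raise the total weight by one. Certain
  combinations of \<open>A\<close> and \<open>B\<close> raise one factor only, with a scalar \<open>Dn\<close> that depends on the weight.
  Where these scalars do not vanish, the top state generates the whole space under \<open>A\<close> and \<open>B\<close>
  (\<open>cyclic\<close>). Hence an operator that intertwines \<open>A\<close>, \<open>B\<close> with the opposite coproducts \<open>A'\<close>, \<open>B'\<close> is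
  determined by its value at the top state. This proves that the \<open>R\<close>-operator is unique, and it
  gives a recursion, \<open>Rm\<close>, for its existence. The recursive operator intertwines \<open>A\<close> and \<open>B\<close>
  because \<open>A'\<close> and \<open>B'\<close> commute. For the lowering generators, consider the defect
  \<open>R E - E' R\<close>: it intertwines \<open>B\<close> with \<open>B'\<close> as well, so that only states of the first factor have to be
  checked, and there the recursion has a closed form (\<open>lookup_xi\<close>). The same closed form shows that \<open>R\<close>
  descends to the finite-dimensional quotients (\<open>Rm_top\<close>).

  Cyclicity then yields all properties of the \<open>R\<close>-operators that are used. Exchanging the factors
  exchanges \<open>A\<close> and \<open>B\<close>, hence \<open>R\<^sub>2\<^sub>1 = R\<close> (\<open>perm_Rop\<close>). Inverting \<open>z\<close> exchanges the coproduct
  of \<open>e\<^sub>0\<close> with the opposite coproduct of \<open>f\<^sub>1\<close>, hence unitarity (\<open>fRop_inverse\<close>). The map \<open>\<iota>\<close> intertwines raising operators, hence it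
  carries the \<open>R\<close>-operator of spin \<open>k + 1/2\<close> to a product of those of spins \<open>1/2\<close> and \<open>k\<close> (\<open>fusion_R\<close>).
  For the Yang-Baxter equation the \<open>R\<close>-operator with a two-dimensional factor is computed explicitly
  (\<open>fRop_Lop\<close>): the entries of a product of two such operators are combinations of generators and of
  their \<open>q\<close>-commutators, all of which the third \<open>R\<close>-operator intertwines (\<open>yang_baxter\<close>).

  The \<open>K\<close>-operators exist because the \<open>R\<close>-operator on \<open>V\<^sup>1\<^sup>/\<^sup>2 \<otimes> V\<^sup>k\<close> degenerates at the argument
  \<open>(k + 1/2) \<eta>\<close>, where its image is the image of \<open>\<iota>\<close> (\<open>fRop_z0_range\<close>, \<open>iota_in_z0_range\<close>). At
  arguments with this difference the reflection equation for spins \<open>k\<close> and \<open>1/2\<close> says that the operator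
  in the fusion relation preserves this image (\<open>Xop_preserves\<close>). It therefore restricts to an operator
  of spin \<open>k + 1/2\<close>, which is unique since \<open>\<iota>\<close> is injective. The reflection equation for spins \<open>k + 1/2\<close>
  and \<open>\<ell>\<close> follows from those for \<open>1/2\<close>, \<open>\<ell>\<close> and for \<open>k\<close>, \<open>\<ell>\<close> by fusion of \<open>R\<close> and two applications of
  the Yang-Baxter equation (\<open>RE_fused\<close>). Since the reflection equation is symmetric in the two spins
  (\<open>reflection_flip\<close>), induction on the first spin, with second spin \<open>1/2\<close>, and then again with an
  arbitrary second spin gives all cases.

  All identities are first proved where no denominator vanishes. They extend to all regular arguments
  by continuity (\<open>entries_eq_limit\<close>, \<open>reflection_from_RE\<close>).
\<close>


section \<open>Linear maps given on a basis\<close>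

notation smul (infixr "\<cdot>" 75)

lemma lookup_smul [simp]: "Poly_Mapping.lookup (c \<cdot> u) b = c * Poly_Mapping.lookup u b"
  unfolding smul_def by (simp add: Poly_Mapping.map.rep_eq when_def)

lemma lookup_bas: "Poly_Mapping.lookup (bas a) b = (if a = b then 1 else 0)"
  by (simp add: bas_def lookup_single when_def)

lemma keys_bas [simp]: "Poly_Mapping.keys (bas a) = {a}"
  by (simp add: bas_def)

lemma smul_add: "c \<cdot> (u + v) = c \<cdot> u + c \<cdot> v"
  by (rule poly_mapping_eqI) (simp add: lookup_add algebra_simps)

lemma add_smul: "(c + d) \<cdot> u = c \<cdot> u + d \<cdot> u"
  by (rule poly_mapping_eqI) (simp add: lookup_add algebra_simps)

lemma smul_diff: "c \<cdot> (u - v) = c \<cdot> u - c \<cdot> v"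
  by (rule poly_mapping_eqI) (simp add: lookup_minus algebra_simps)

lemma diff_smul: "(c - d) \<cdot> u = c \<cdot> u - d \<cdot> u"
  by (rule poly_mapping_eqI) (simp add: lookup_minus algebra_simps)

lemma smul_smul [simp]: "c \<cdot> d \<cdot> u = (c * d) \<cdot> u"
  by (rule poly_mapping_eqI) simp

lemma smul_one [simp]: "1 \<cdot> u = u"
  by (rule poly_mapping_eqI) simp

lemma smul_minus_one: "(- 1) \<cdot> u = - u"
  by (rule poly_mapping_eqI) simp

lemma smul_zero_left [simp]: "0 \<cdot> u = 0"
  by (rule poly_mapping_eqI) simp

lemma smul_zero_right [simp]: "c \<cdot> 0 = 0"
  by (rule poly_mapping_eqI) simp

lemma smul_sum: "c \<cdot> sum f S = (\<Sum>i\<in>S. c \<cdot> f i)"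
  by (induction S rule: infinite_finite_induct) (auto simp: smul_add)

lemma smul_left_cancel: "c \<noteq> 0 \<Longrightarrow> c \<cdot> u = c \<cdot> v \<longleftrightarrow> u = v"
  by (metis smul_smul smul_one field_class.field_inverse)

lemma lin_ext_superset:
  assumes "finite S" "Poly_Mapping.keys u \<subseteq> S"
  shows "lin_ext g u = (\<Sum>a\<in>S. Poly_Mapping.lookup u a \<cdot> g a)"
  unfolding lin_ext_def
  by (rule sum.mono_neutral_left) (use assms in \<open>auto simp: in_keys_iff\<close>)

lemma lin_ext_bas [simp]: "lin_ext g (bas a) = g a"
  unfolding lin_ext_def by (simp add: lookup_bas)

lemma lin_ext_zero [simp]: "lin_ext g 0 = 0"
  unfolding lin_ext_def by simp

lemma lin_ext_add [simp]: "lin_ext g (u + v) = lin_ext g u + lin_ext g v"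
proof -
  let ?S = "Poly_Mapping.keys u \<union> Poly_Mapping.keys v"
  have "Poly_Mapping.keys (u + v) \<subseteq> ?S" by (rule Poly_Mapping.keys_add)
  then show ?thesis
    by (simp add: lin_ext_superset[of ?S] lookup_add add_smul sum.distrib)
qed

lemma lin_ext_smul [simp]: "lin_ext g (c \<cdot> u) = c \<cdot> lin_ext g u"
proof -
  have "Poly_Mapping.keys (c \<cdot> u) \<subseteq> Poly_Mapping.keys u"
    by (auto simp: in_keys_iff)
  then show ?thesis
    by (simp add: lin_ext_superset[of "Poly_Mapping.keys u"] smul_sum)
qed

lemma vec_expand: "u = (\<Sum>a\<in>Poly_Mapping.keys u. Poly_Mapping.lookup u a \<cdot> bas a)"
  by (rule poly_mapping_eqI) (simp add: lookup_sum lookup_bas if_distrib sum.delta in_keys_iff cong: if_cong)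

definition lin :: "('a vec \<Rightarrow> 'b vec) \<Rightarrow> bool" where
  "lin T \<longleftrightarrow> linear_map UNIV UNIV T"

lemma linI: "(\<And>u v. T (u + v) = T u + T v) \<Longrightarrow> (\<And>c u. T (c \<cdot> u) = c \<cdot> T u) \<Longrightarrow> lin T"
  by (auto simp: lin_def linear_map_def)

lemma lin_add: "lin T \<Longrightarrow> T (u + v) = T u + T v"
  and lin_smul: "lin T \<Longrightarrow> T (c \<cdot> u) = c \<cdot> T u"
  by (auto simp: lin_def linear_map_def)

lemma lin_zero: "lin T \<Longrightarrow> T 0 = 0"
  using lin_smul[of T 0 0] by simp

lemma lin_minus: "lin T \<Longrightarrow> T (- u) = - T u"
  using lin_smul[of T "-1" u] by (simp add: smul_minus_one)

lemma lin_diff: "lin T \<Longrightarrow> T (u - v) = T u - T v"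
  using lin_add[of T u "-v"] lin_minus[of T v] by simp

lemma lin_sum: "lin T \<Longrightarrow> T (sum f S) = (\<Sum>i\<in>S. T (f i))"
  by (induction S rule: infinite_finite_induct) (auto simp: lin_zero lin_add)

lemmas lin_simps = lin_add lin_smul lin_zero lin_minus lin_diff

lemma lin_lin_ext [simp, intro]: "lin (lin_ext g)"
  by (rule linI) auto

lemma lin_comp [intro]: "lin T \<Longrightarrow> lin U \<Longrightarrow> lin (T \<circ> U)"
  by (rule linI) (auto simp: lin_simps)

lemma lin_id [simp, intro]: "lin id"
  by (rule linI) auto

lemma lin_ident [simp, intro]: "lin (\<lambda>u. u)" and lin_const_zero [simp, intro]: "lin (\<lambda>_. 0)"
  by (rule linI; simp)+

lemma lin_compose [intro]: "lin T \<Longrightarrow> lin U \<Longrightarrow> lin (\<lambda>u. T (U u))"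
  by (rule linI) (auto simp: lin_simps)

lemma lin_plus [intro]: "lin T \<Longrightarrow> lin U \<Longrightarrow> lin (\<lambda>u. T u + U u)"
  by (rule linI) (auto simp: lin_simps smul_add)

lemma lin_scale [intro]: "lin T \<Longrightarrow> lin (\<lambda>u. c \<cdot> T u)"
  by (rule linI) (auto simp: lin_simps smul_add mult.commute)

lemma lin_smul_id [simp, intro]: "lin (smul c)"
  by (rule linI) (auto simp: smul_add mult.commute)

lemma coord_space_add: "u \<in> coord_space C \<Longrightarrow> v \<in> coord_space C \<Longrightarrow> u + v \<in> coord_space C"
  unfolding coord_space_def using Poly_Mapping.keys_add[of u v] by blast

lemma coord_space_smul: "u \<in> coord_space C \<Longrightarrow> c \<cdot> u \<in> coord_space C"
  unfolding coord_space_def by (auto simp: in_keys_iff)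

lemma coord_space_zero [simp]: "0 \<in> coord_space C"
  unfolding coord_space_def by simp

lemma coord_space_bas [simp]: "bas a \<in> coord_space C \<longleftrightarrow> a \<in> C"
  unfolding coord_space_def by simp

lemma coord_space_sum: "(\<And>i. i \<in> S \<Longrightarrow> f i \<in> coord_space C) \<Longrightarrow> sum f S \<in> coord_space C"
  by (induction S rule: infinite_finite_induct) (auto simp: coord_space_add)

lemma coord_space_UNIV [simp]: "coord_space UNIV = UNIV"
  unfolding coord_space_def by auto

text \<open>Stated for maps that are linear on a coordinate subspace only, as the \<open>K\<close>-operators are.\<close>

lemma linear_map_expand:
  assumes "linear_map (coord_space C) W T" and "u \<in> coord_space C"
  shows "T u = (\<Sum>a\<in>Poly_Mapping.keys u. Poly_Mapping.lookup u a \<cdot> T (bas a))"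
proof -
  have T0: "T 0 = 0"
  proof -
    have "T (0 \<cdot> 0) = 0 \<cdot> T 0"
      using assms(1) unfolding linear_map_def by (metis coord_space_zero)
    then show ?thesis by simp
  qed
  have "T (\<Sum>a\<in>S. c a \<cdot> bas a) = (\<Sum>a\<in>S. c a \<cdot> T (bas a))"
    if "S \<subseteq> C" for S c
    using that
  proof (induction S rule: infinite_finite_induct)
    case (insert a S)
    have 1: "(\<Sum>a\<in>S. c a \<cdot> bas a) \<in> coord_space C"
      by (rule coord_space_sum, rule coord_space_smul) (use insert in auto)
    have 2: "bas a \<in> coord_space C" using insert by simp
    have "T (c a \<cdot> bas a + (\<Sum>a\<in>S. c a \<cdot> bas a)) = T (c a \<cdot> bas a) + T (\<Sum>a\<in>S. c a \<cdot> bas a)"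
      using assms(1) 1 coord_space_smul[OF 2] unfolding linear_map_def by blast
    moreover have "T (c a \<cdot> bas a) = c a \<cdot> T (bas a)"
      using assms(1) 2 unfolding linear_map_def by blast
    ultimately show ?case using insert by simp
  qed (auto simp: T0)
  from this[of "Poly_Mapping.keys u" "Poly_Mapping.lookup u"] show ?thesis
    using assms(2) vec_expand[of u] unfolding coord_space_def by simp
qed

lemma lin_imp_linear_map: "lin T \<Longrightarrow> (\<And>u. u \<in> U \<Longrightarrow> T u \<in> W) \<Longrightarrow> linear_map U W T"
  by (auto simp: lin_def linear_map_def)

lemma linear_map_eq_on:
  assumes "linear_map (coord_space C) W T" "linear_map (coord_space C) W' U"
    and "\<And>a. a \<in> C \<Longrightarrow> T (bas a) = U (bas a)" and "u \<in> coord_space C"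
  shows "T u = U u"
  unfolding linear_map_expand[OF assms(1,4)] linear_map_expand[OF assms(2,4)]
  by (rule sum.cong) (use assms(3,4) in \<open>auto simp: coord_space_def\<close>)

lemma lin_eq_on:
  assumes "lin T" "lin U" "\<And>a. a \<in> C \<Longrightarrow> T (bas a) = U (bas a)" "u \<in> coord_space C"
  shows "T u = U u"
  using linear_map_eq_on[of C UNIV T UNIV U u] assms lin_imp_linear_map by blast

lemma lin_eqI:
  assumes "lin T" "lin U" "\<And>a. T (bas a) = U (bas a)"
  shows "T = U"
  using lin_eq_on[of T U UNIV] assms by (auto intro!: ext)

lemma lin_in_coord_space:
  assumes "lin T" "\<And>a. a \<in> C \<Longrightarrow> T (bas a) \<in> coord_space D" "u \<in> coord_space C"
  shows "T u \<in> coord_space D"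
  unfolding linear_map_expand[OF lin_imp_linear_map[OF assms(1), of "coord_space C" UNIV, simplified] assms(3)]
  by (rule coord_space_sum, rule coord_space_smul) (use assms(2,3) in \<open>auto simp: coord_space_def\<close>)

lemma lin_ext_swap:
  "lin_ext (\<lambda>a. lin_ext (\<lambda>b. G a b) v) u = lin_ext (\<lambda>b. lin_ext (\<lambda>a. G a b) u) v"
  unfolding lin_ext_def by (simp add: smul_sum, subst sum.swap, simp add: mult.commute)

lemma lin_ext_lin: "lin T \<Longrightarrow> T (lin_ext g u) = lin_ext (\<lambda>a. T (g a)) u"
  unfolding lin_ext_def by (simp add: lin_sum lin_smul)

lemma lin_ext_compose: "lin_ext h (lin_ext g u) = lin_ext (\<lambda>a. lin_ext h (g a)) u"
  by (rule lin_ext_lin) auto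

lemma lin_as_lin_ext: "lin T \<Longrightarrow> T = lin_ext (\<lambda>a. T (bas a))"
  by (rule lin_eqI) auto


section \<open>Operators acting on some factors of a tensor product\<close>

text \<open>
  A basis state \<open>s\<close> of a tensor product is a tuple; \<open>rd s\<close> reads the entries that belong to the
  factors on which \<open>T\<close> acts, and \<open>wr y s\<close> overwrites them by \<open>y\<close>. Since source and target of \<open>wr\<close> may
  differ, this covers maps that split one factor into two as well as operators on chosen factors.
\<close>

definition act :: "('s \<Rightarrow> 'x) \<Rightarrow> ('y \<Rightarrow> 's \<Rightarrow> 't) \<Rightarrow> ('x vec \<Rightarrow> 'y vec) \<Rightarrow> 's vec \<Rightarrow> 't vec" where
  "act rd wr T = lin_ext (\<lambda>s. lin_ext (\<lambda>y. bas (wr y s)) (T (bas (rd s))))"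

lemma act_bas: "act rd wr T (bas s) = lin_ext (\<lambda>y. bas (wr y s)) (T (bas (rd s)))"
  by (simp add: act_def)

lemma lin_act [simp, intro]: "lin (act rd wr T)"
  by (simp add: act_def)

lemma act_comp:
  assumes "lin U" and "\<And>y s. rd' (wr y s) = y" and "\<And>y' y s. wr' y' (wr y s) = wr'' y' s"
  shows "act rd' wr' U \<circ> act rd wr T = act rd wr'' (U \<circ> T)"
proof (rule lin_eqI)
  fix s
  have "U (T (bas (rd s))) = lin_ext (\<lambda>a. U (bas a)) (T (bas (rd s)))"
    using lin_as_lin_ext[OF assms(1)] by metis
  then show "(act rd' wr' U \<circ> act rd wr T) (bas s) = act rd wr'' (U \<circ> T) (bas s)"
    by (simp add: act_bas lin_ext_lin[where T = "act rd' wr' U"] assms lin_ext_compose)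
qed auto

lemma act_commute:
  assumes "\<And>y s. rd1' (wr2 y s) = rd1 s" "\<And>y s. rd2' (wr1 y s) = rd2 s"
    and "\<And>y y' s. wr1' y (wr2 y' s) = wr2' y' (wr1 y s)"
  shows "act rd1' wr1' T \<circ> act rd2 wr2 U = act rd2' wr2' U \<circ> act rd1 wr1 T"
proof (rule lin_eqI)
  fix s
  show "(act rd1' wr1' T \<circ> act rd2 wr2 U) (bas s) = (act rd2' wr2' U \<circ> act rd1 wr1 T) (bas s)"
    by (simp add: act_bas lin_ext_lin[where T = "act rd1' wr1' T"]
        lin_ext_lin[where T = "act rd2' wr2' U"] assms) (rule lin_ext_swap)
qed auto

lemma act_scale:
  "act rd wr (\<lambda>u. c \<cdot> T u) = (\<lambda>u. c \<cdot> act rd wr T u)"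
  by (rule lin_eqI) (auto simp: act_bas)

lemma tens_bas [simp]: "tens (bas a) (bas b) = bas (a, b)"
  by (simp add: tens_def)

lemma tens_op_bas [simp]: "tens_op S T (bas (a, b)) = tens (S (bas a)) (T (bas b))"
  by (simp add: tens_op_def)

lemma tens_add_left [simp]: "tens (u + u') v = tens u v + tens u' v"
  and tens_smul_left [simp]: "tens (c \<cdot> u) v = c \<cdot> tens u v"
  and tens_zero_left [simp]: "tens 0 v = 0"
  by (simp_all add: tens_def)

lemma tens_swap: "tens u v = lin_ext (\<lambda>b. lin_ext (\<lambda>a. bas (a, b)) u) v"
  unfolding tens_def by (rule lin_ext_swap)

lemma tens_add_right [simp]: "tens u (v + v') = tens u v + tens u v'"
  and tens_smul_right [simp]: "tens u (c \<cdot> v) = c \<cdot> tens u v"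
  and tens_zero_right [simp]: "tens u 0 = 0"
  by (simp_all add: tens_swap)

lemma lin_tens_op [simp, intro]: "lin (tens_op S T)"
  by (simp add: tens_op_def)

lemma lin_perm [simp, intro]: "lin perm"
  by (simp add: perm_def)

lemma perm_bas [simp]: "perm (bas (a, b)) = bas (b, a)"
  by (simp add: perm_def)

lemma perm_perm [simp]: "perm (perm u) = u"
proof -
  have "perm \<circ> perm = (id :: ('a \<times> 'b) vec \<Rightarrow> _)" by (rule lin_eqI) auto
  then show ?thesis by (metis comp_apply id_apply)
qed

lemma perm_add [simp]: "perm (u + v) = perm u + perm v"
  and perm_smul [simp]: "perm (c \<cdot> u) = c \<cdot> perm u"
  and perm_zero [simp]: "perm 0 = 0"
  by (simp_all add: perm_def)

lemma lin_op1 [simp, intro]: "lin (op1 T)" and lin_op2 [simp, intro]: "lin (op2 T)"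
  by (simp_all add: op1_def op2_def)

lemma op1_act: "op1 T = act fst (\<lambda>i s. (i, snd s)) T"
  by (rule lin_eqI) (auto simp: act_bas tens_def op1_def)

lemma op2_act: "op2 T = act snd (\<lambda>j s. (fst s, j)) T"
  by (rule lin_eqI) (auto simp: act_bas tens_swap op2_def)

lemma perm_tens [simp]: "perm (tens u v) = tens v u"
  by (subst tens_swap) (simp add: tens_def lin_ext_lin[of perm])


section \<open>Raising and lowering operators on a tensor product of two modules\<close>

locale nonroot =
  fixes \<eta> :: complex
  assumes nonroot: "\<forall>n::nat. n > 0 \<longrightarrow> exp \<eta> ^ n \<noteq> 1"
begin

definition p :: complex where "p = exp \<eta>"

lemma p_nz [simp]: "p \<noteq> 0"
  by (simp add: p_def)

lemma p_pow_neq_1: "n > 0 \<Longrightarrow> p ^ n \<noteq> 1"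
  using nonroot by (simp add: p_def)

lemma pp_neq_1: "p * p \<noteq> 1"
  using p_pow_neq_1[of 2] by (simp add: power2_eq_square)

lemma p_diff_nz [simp]: "p - 1 / p \<noteq> 0"
  using pp_neq_1 by (simp add: field_simps)

lemma p_neq_inverse [simp]: "p \<noteq> 1 / p"
  using p_diff_nz by simp

text \<open>
  \<open>Kc d a\<close> is the eigenvalue of \<open>p\<close> to the power \<open>h\<^sub>1\<close> on the state \<open>bas a\<close> of the module of spin \<open>d / 2\<close>,
  and \<open>ec d a\<close> is the factor with which \<open>e\<^sub>1\<close> lowers this state; the zero at \<open>a = d + 1\<close> accounts for the
  finite-dimensional quotient.
\<close>

definition Kc :: "nat \<Rightarrow> nat \<Rightarrow> complex" where
  "Kc d a = p ^ d / (p ^ a * p ^ a)"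

definition ec :: "nat \<Rightarrow> nat \<Rightarrow> complex" where
  "ec d a = (p ^ a - 1 / p ^ a) * (p ^ Suc d / p ^ a - p ^ a / p ^ Suc d) / (p - 1 / p)\<^sup>2"

lemma Kc_nz [simp]: "Kc d a \<noteq> 0"
  by (simp add: Kc_def)

lemma Kc_Suc: "Kc d (Suc a) = Kc d a / (p * p)"
  by (simp add: Kc_def)

lemma Kc_0 [simp]: "Kc d 0 = p ^ d"
  by (simp add: Kc_def)

lemma Kc_mult: "Kc d a * Kc l b = Kc (d + l) (a + b)"
  by (simp add: Kc_def power_add)

lemma ec_0 [simp]: "ec d 0 = 0"
  by (simp add: ec_def)

lemma ec_top [simp]: "ec d (Suc d) = 0"
  by (simp add: ec_def)

text \<open>
  The relation for the commutator of \<open>e\<^sub>1\<close> and \<open>f\<^sub>1\<close> on a basis state. It is a rational identity in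
  \<open>p\<close>, \<open>x = p\<^sup>d\<close> and \<open>y = p\<^sup>a\<close>.
\<close>

lemma ec_diff: "ec d (Suc a) - ec d a = (Kc d a - 1 / Kc d a) / (p - 1 / p)"
proof -
  have "x \<noteq> 0 \<Longrightarrow> y \<noteq> 0 \<Longrightarrow> q \<noteq> 0 \<Longrightarrow> q - 1 / q \<noteq> 0 \<Longrightarrow>
     (q * y - 1 / (q * y)) * (q * x / (q * y) - q * y / (q * x)) / (q - 1 / q)\<^sup>2 -
     (y - 1 / y) * (q * x / y - y / (q * x)) / (q - 1 / q)\<^sup>2 =
     (x / (y * y) - 1 / (x / (y * y))) / (q - 1 / q)" for x y q :: complex
  proof -
    assume nz: "x \<noteq> 0" "y \<noteq> 0" "q \<noteq> 0" and "q - 1 / q \<noteq> 0"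
    have "(q * y - 1 / (q * y)) * (q * x / (q * y) - q * y / (q * x)) -
       (y - 1 / y) * (q * x / y - y / (q * x)) = (x / (y * y) - 1 / (x / (y * y))) * (q - 1 / q)"
      using nz by (simp add: field_simps)
    then show ?thesis
      using \<open>q - 1 / q \<noteq> 0\<close> by (simp add: diff_divide_distrib[symmetric] power2_eq_square)
  qed
  from this[of "p ^ d" "p ^ a" p] show ?thesis
    by (simp add: ec_def Kc_def)
qed

text \<open>
  The cutoffs \<open>c\<close> and \<open>c'\<close> let one definition serve both modules: \<open>\<infinity>\<close> gives the Verma modules, and
  finite values give their finite-dimensional quotients, in which raising the lowest state gives 0.
\<close>

definition up1 :: "enat \<Rightarrow> nat \<Rightarrow> nat \<Rightarrow> (nat \<times> nat) vec" where
  "up1 c a b = (if enat a < c then bas (Suc a, b) else 0)"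

definition up2 :: "enat \<Rightarrow> nat \<Rightarrow> nat \<Rightarrow> (nat \<times> nat) vec" where
  "up2 c a b = (if enat b < c then bas (a, Suc b) else 0)"

definition raise :: "enat \<Rightarrow> enat \<Rightarrow> (nat \<Rightarrow> nat \<Rightarrow> complex) \<Rightarrow> (nat \<Rightarrow> nat \<Rightarrow> complex) \<Rightarrow>
    (nat \<times> nat) vec \<Rightarrow> (nat \<times> nat) vec" where
  "raise c c' f g = lin_ext (\<lambda>(a, b). f a b \<cdot> up1 c a b + g a b \<cdot> up2 c' a b)"

definition lower :: "nat \<Rightarrow> nat \<Rightarrow> (nat \<Rightarrow> nat \<Rightarrow> complex) \<Rightarrow> (nat \<Rightarrow> nat \<Rightarrow> complex) \<Rightarrow>
    (nat \<times> nat) vec \<Rightarrow> (nat \<times> nat) vec" where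
  "lower d l f g = lin_ext (\<lambda>(a, b). (f a b * ec d a) \<cdot> bas (a - 1, b) + (g a b * ec l b) \<cdot> bas (a, b - 1))"

lemma lin_raise [simp, intro]: "lin (raise c c' f g)"
  and lin_lower [simp, intro]: "lin (lower d l f g)"
  by (simp_all add: raise_def lower_def)

lemma raise_bas: "raise c c' f g (bas (a, b)) = f a b \<cdot> up1 c a b + g a b \<cdot> up2 c' a b"
  by (simp add: raise_def)

lemma lower_bas:
  "lower d l f g (bas (a, b)) = (f a b * ec d a) \<cdot> bas (a - 1, b) + (g a b * ec l b) \<cdot> bas (a, b - 1)"
  by (simp add: lower_def)

text \<open>
  With \<open>z = exp (x - y)\<close>, and up to scalar factors, \<open>opA\<close>, \<open>opB\<close>, \<open>opE\<close>, \<open>opG\<close> are the coproducts of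
  \<open>e\<^sub>0\<close>, \<open>f\<^sub>1\<close>, \<open>e\<^sub>1\<close>, \<open>f\<^sub>0\<close>, and the primed versions are the opposite coproducts.
\<close>

definition opA where "opA c c' d z = raise c c' (\<lambda>a b. 1) (\<lambda>a b. z * Kc d a)"
definition opB where "opB c c' l z = raise c c' (\<lambda>a b. z * Kc l b) (\<lambda>a b. 1)"
definition opA' where "opA' c c' l z = raise c c' (\<lambda>a b. Kc l b) (\<lambda>a b. z)"
definition opB' where "opB' c c' d z = raise c c' (\<lambda>a b. z) (\<lambda>a b. Kc d a)"
definition opE where "opE d l z = lower d l (\<lambda>a b. 1) (\<lambda>a b. z / Kc d a)"
definition opG where "opG d l z = lower d l (\<lambda>a b. z / Kc l b) (\<lambda>a b. 1)"
definition opE' where "opE' d l z = lower d l (\<lambda>a b. 1 / Kc l b) (\<lambda>a b. z)"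
definition opG' where "opG' d l z = lower d l (\<lambda>a b. z) (\<lambda>a b. 1 / Kc d a)"

lemmas op_defs = opA_def opB_def opA'_def opB'_def opE_def opG_def opE'_def opG'_def

lemma lin_ops [simp, intro]:
  "lin (opA c c' d z)" "lin (opB c c' l z)" "lin (opA' c c' l z)" "lin (opB' c c' d z)"
  "lin (opE d l z)" "lin (opG d l z)" "lin (opE' d l z)" "lin (opG' d l z)"
  by (simp_all add: op_defs)

lemma raise_commute:
  assumes "\<And>a b. f a b * f' (Suc a) b = f' a b * f (Suc a) b"
    and "\<And>a b. g a b * g' a (Suc b) = g' a b * g a (Suc b)"
    and "\<And>a b. f a b * g' (Suc a) b + g a b * f' a (Suc b) = f' a b * g (Suc a) b + g' a b * f a (Suc b)"
  shows "raise c c' f g (raise c c' f' g' u) = raise c c' f' g' (raise c c' f g u)"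
proof -
  have "raise c c' f g \<circ> raise c c' f' g' = raise c c' f' g' \<circ> raise c c' f g"
  proof (rule lin_eqI)
    fix s :: "nat \<times> nat"
    obtain a b where s: "s = (a, b)" by (cases s)
    have *: "(raise c c' h k \<circ> raise c c' h' k') (bas s) =
       (h' a b * h (Suc a) b) \<cdot> (if enat a < c then up1 c (Suc a) b else 0) +
       (h' a b * k (Suc a) b + k' a b * h a (Suc b)) \<cdot> (if enat a < c \<and> enat b < c' then bas (Suc a, Suc b) else 0) +
       (k' a b * k a (Suc b)) \<cdot> (if enat b < c' then up2 c' a (Suc b) else 0)" for h k h' k'
      unfolding s by (auto simp: raise_bas up1_def up2_def lin_simps add_smul smul_add)
    show "(raise c c' f g \<circ> raise c c' f' g') (bas s) = (raise c c' f' g' \<circ> raise c c' f g) (bas s)"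
      unfolding * using assms[of a b] by simp
  qed auto
  then show ?thesis by (metis comp_apply)
qed

lemma opA'_opB': "opA' c c' l z (opB' c c' d z u) = opB' c c' d z (opA' c c' l z u)"
  unfolding op_defs by (rule raise_commute) (simp_all add: Kc_Suc)

definition Dn :: "nat \<Rightarrow> nat \<Rightarrow> complex \<Rightarrow> nat \<Rightarrow> complex" where
  "Dn d l z n = 1 - z\<^sup>2 * Kc (d + l) n"

text \<open>
  These two combinations raise a single factor. Since the opposite operators commute as well, they
  dictate the \<open>R\<close>-operator.
\<close>

lemma raise_left:
  "opA c c' d z (bas (a, b)) - (z * Kc d a) \<cdot> opB c c' l z (bas (a, b)) = Dn d l z (a + b) \<cdot> up1 c a b"
  unfolding op_defs
  by (simp add: raise_bas smul_add Dn_def Kc_mult[symmetric] diff_smul power2_eq_square mult_ac)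

lemma raise_right:
  "opB c c' l z (bas (a, b)) - (z * Kc l b) \<cdot> opA c c' d z (bas (a, b)) = Dn d l z (a + b) \<cdot> up2 c' a b"
  unfolding op_defs
  by (simp add: raise_bas smul_add Dn_def Kc_mult[symmetric] diff_smul power2_eq_square mult_ac)


section \<open>The R-operator, defined by recursion\<close>

fun Rm :: "enat \<Rightarrow> enat \<Rightarrow> nat \<Rightarrow> nat \<Rightarrow> complex \<Rightarrow> nat \<Rightarrow> nat \<Rightarrow> (nat \<times> nat) vec" where
  "Rm c c' d l z 0 0 = bas (0, 0)"
| "Rm c c' d l z (Suc a) 0 = (1 / Dn d l z a) \<cdot>
     (opA' c c' l z (Rm c c' d l z a 0) - (z * Kc d a) \<cdot> opB' c c' d z (Rm c c' d l z a 0))"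
| "Rm c c' d l z a (Suc b) = (1 / Dn d l z (a + b)) \<cdot>
     (opB' c c' d z (Rm c c' d l z a b) - (z * Kc l b) \<cdot> opA' c c' l z (Rm c c' d l z a b))"

text \<open>
  The recursion in the first index holds at every \<open>b\<close>, since \<open>opA'\<close> and \<open>opB'\<close> commute: the order in which
  the two factors are raised is immaterial.
\<close>

lemma Rm_Suc_left:
  "Rm c c' d l z (Suc a) b = (1 / Dn d l z (a + b)) \<cdot>
     (opA' c c' l z (Rm c c' d l z a b) - (z * Kc d a) \<cdot> opB' c c' d z (Rm c c' d l z a b))"
proof (induction b)
  case (Suc b)
  then show ?case
    by (simp add: lin_simps smul_diff opA'_opB' mult_ac)
qed simp

definition Rop :: "enat \<Rightarrow> enat \<Rightarrow> nat \<Rightarrow> nat \<Rightarrow> complex \<Rightarrow> (nat \<times> nat) vec \<Rightarrow> (nat \<times> nat) vec" where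
  "Rop c c' d l z = lin_ext (\<lambda>(a, b). Rm c c' d l z a b)"

lemma lin_Rop [simp, intro]: "lin (Rop c c' d l z)"
  by (simp add: Rop_def)

lemma Rop_bas [simp]: "Rop c c' d l z (bas (a, b)) = Rm c c' d l z a b"
  by (simp add: Rop_def)

text \<open>The hypotheses on the cutoffs say that \<open>Rm\<close> respects the quotient.\<close>

lemma Rop_opA_opB_bas:
  assumes D: "Dn d l z (a + b) \<noteq> 0"
    and "\<not> enat a < c \<Longrightarrow> Rm c c' d l z (Suc a) b = 0"
    and "\<not> enat b < c' \<Longrightarrow> Rm c c' d l z a (Suc b) = 0"
  shows "Rop c c' d l z (opA c c' d z (bas (a, b))) = opA' c c' l z (Rm c c' d l z a b)"
    and "Rop c c' d l z (opB c c' l z (bas (a, b))) = opB' c c' d z (Rm c c' d l z a b)"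
proof -
  let ?w = "Rm c c' d l z a b"
  let ?A = "opA' c c' l z ?w" and ?B = "opB' c c' d z ?w"
  let ?D = "Dn d l z (a + b)"
  have 1: "Rop c c' d l z (up1 c a b) = (1 / ?D) \<cdot> (?A - (z * Kc d a) \<cdot> ?B)"
    using assms(2) by (auto simp: up1_def Rm_Suc_left lin_zero)
  have 2: "Rop c c' d l z (up2 c' a b) = (1 / ?D) \<cdot> (?B - (z * Kc l b) \<cdot> ?A)"
    using assms(3) by (auto simp: up2_def lin_zero)
  have D': "?D = 1 - z * Kc d a * (z * Kc l b)"
    by (simp add: Dn_def Kc_mult[symmetric] power2_eq_square mult_ac)
  have 3: "(1 / D) \<cdot> (x - s \<cdot> y) + s \<cdot> (1 / D) \<cdot> (y - t \<cdot> x) = x"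
    if "D = 1 - s * t" "D \<noteq> 0" for D s t and x y :: "(nat \<times> nat) vec"
  proof -
    have "(1 / D) \<cdot> (x - s \<cdot> y) + s \<cdot> (1 / D) \<cdot> (y - t \<cdot> x) = (1 / D) \<cdot> ((1 - s * t) \<cdot> x)"
      by (simp add: smul_diff diff_smul)
    then show ?thesis using that by simp
  qed
  show "Rop c c' d l z (opA c c' d z (bas (a, b))) = ?A"
    unfolding opA_def raise_bas lin_add[OF lin_Rop] lin_smul[OF lin_Rop] 1 2
    using 3[OF D' D] by simp
  have D'': "?D = 1 - z * Kc l b * (z * Kc d a)"
    by (simp add: D' mult_ac)
  show "Rop c c' d l z (opB c c' l z (bas (a, b))) = ?B"
    unfolding opB_def raise_bas lin_add[OF lin_Rop] lin_smul[OF lin_Rop] 1 2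
    using 3[OF D'' D] by (simp add: add.commute)
qed

text \<open>The weight spaces of the tensor product.\<close>

definition level :: "nat \<Rightarrow> (nat \<times> nat) vec set" where
  "level n = coord_space {(a, b). a + b = n}"

lemma raise_level: "u \<in> level n \<Longrightarrow> raise c c' f g u \<in> level (Suc n)"
  unfolding level_def
  by (rule lin_in_coord_space[of "raise c c' f g"])
    (auto simp: raise_bas up1_def up2_def intro!: coord_space_add coord_space_smul)

lemma level_diff: "u \<in> level n \<Longrightarrow> v \<in> level n \<Longrightarrow> u - v \<in> level n"
  unfolding level_def using coord_space_add[of u _ "- v"] coord_space_smul[of v _ "- 1"]
  by (simp add: smul_minus_one)

lemma level_smul: "u \<in> level n \<Longrightarrow> s \<cdot> u \<in> level n"
  unfolding level_def by (rule coord_space_smul)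

lemma Rm_level: "Rm c c' d l z a b \<in> level (a + b)"
proof (induction c c' d l z a b rule: Rm.induct)
  case (1 c c' d l z)
  then show ?case by (simp add: level_def)
next
  case (2 c c' d l z a)
  then show ?case
    using raise_level by (auto simp: op_defs intro!: level_smul level_diff)
next
  case (3 c c' d l z a b)
  then show ?case
    using raise_level by (auto simp: op_defs intro!: level_smul level_diff)
qed


section \<open>The flip symmetry\<close>

lemma perm_raise: "perm (raise c c' f g u) = raise c' c (\<lambda>a b. g b a) (\<lambda>a b. f b a) (perm u)"
proof -
  have "perm \<circ> raise c c' f g = raise c' c (\<lambda>a b. g b a) (\<lambda>a b. f b a) \<circ> perm"
    by (rule lin_eqI) (auto simp: raise_bas up1_def up2_def add.commute)
  then show ?thesis by (metis comp_apply)
qed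

lemma perm_lower: "perm (lower d l f g u) = lower l d (\<lambda>a b. g b a) (\<lambda>a b. f b a) (perm u)"
proof -
  have "perm \<circ> lower d l f g = lower l d (\<lambda>a b. g b a) (\<lambda>a b. f b a) \<circ> perm"
    by (rule lin_eqI) (auto simp: lower_bas add.commute)
  then show ?thesis by (metis comp_apply)
qed

text \<open>
  Exchanging the factors turns \<open>e\<^sub>0\<close> into \<open>f\<^sub>1\<close> and \<open>e\<^sub>1\<close> into \<open>f\<^sub>0\<close>, so that it turns the recursion for
  one order of the factors into that for the other order.
\<close>

lemma perm_ops:
  "perm (opA c c' d z u) = opB c' c d z (perm u)"
  "perm (opB c c' l z u) = opA c' c l z (perm u)"
  "perm (opA' c c' l z u) = opB' c' c l z (perm u)"
  "perm (opB' c c' d z u) = opA' c' c d z (perm u)"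
  "perm (opE d l z u) = opG l d z (perm u)"
  "perm (opG d l z u) = opE l d z (perm u)"
  "perm (opE' d l z u) = opG' l d z (perm u)"
  "perm (opG' d l z u) = opE' l d z (perm u)"
  by (simp_all add: op_defs perm_raise perm_lower)

lemma Dn_commute: "Dn d l z n = Dn l d z n"
  by (simp add: Dn_def add.commute)

lemma perm_minus: "perm (u - v) = perm u - perm v"
  by (rule lin_diff) auto

lemma perm_Rm: "perm (Rm c c' d l z a b) = Rm c' c l d z b a"
proof (induction c c' d l z a b rule: Rm.induct)
  case (2 c c' d l z a)
  then show ?case by (simp add: perm_minus perm_ops Dn_commute[of d])
next
  case (3 c c' d l z a b)
  then show ?case
    by (simp add: perm_minus perm_ops Dn_commute[of d] Rm_Suc_left add.commute)
qed simp

lemma perm_Rop: "perm (Rop c c' d l z u) = Rop c' c l d z (perm u)"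
proof -
  have "perm \<circ> Rop c c' d l z = Rop c' c l d z \<circ> perm"
    by (rule lin_eqI) (auto simp: perm_Rm)
  then show ?thesis by (metis comp_apply)
qed


section \<open>The image of the states of the first factor\<close>

definition qf :: "nat \<Rightarrow> complex" where
  "qf n = (\<Prod>i<n. 1 - (p ^ Suc i)\<^sup>2)"

lemma one_minus_pow_nz: "1 - (p ^ Suc i)\<^sup>2 \<noteq> 0"
  using p_pow_neq_1[of "Suc i * 2"] by (simp add: power_mult[symmetric] del: power_Suc)

lemma qf_nz [simp]: "qf n \<noteq> 0"
  unfolding qf_def using one_minus_pow_nz by (simp del: power_Suc)

lemma qf_Suc: "qf (Suc n) = qf n * (1 - (p * p ^ n)\<^sup>2)"
  by (simp add: qf_def)

definition w1 :: "nat \<Rightarrow> nat \<Rightarrow> complex" where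
  "w1 d i = 1 - (p ^ d / p ^ i)\<^sup>2"

definition Pw :: "nat \<Rightarrow> nat \<Rightarrow> nat \<Rightarrow> complex" where
  "Pw d a b = (\<Prod>i<b. w1 d (a + i))"

definition W3 :: "nat \<Rightarrow> nat \<Rightarrow> complex \<Rightarrow> nat \<Rightarrow> complex" where
  "W3 d l z a = (\<Prod>i<a. p ^ l - z\<^sup>2 * Kc d i)"

text \<open>
  The coefficient of \<open>bas (a, b)\<close> in the numerator of \<open>Rm (a + b) 0\<close>, see \<open>lookup_xi\<close> below. The quotient
  of the \<open>qf\<close> is a Gaussian binomial coefficient in \<open>p\<^sup>2\<close>, and \<open>W3\<close>, \<open>Pw\<close> collect the factors that raising the
  first and the second factor contributes.
\<close>

definition Yc :: "nat \<Rightarrow> nat \<Rightarrow> complex \<Rightarrow> nat \<Rightarrow> nat \<Rightarrow> complex" where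
  "Yc d l z a b = z ^ b * (qf (a + b) / (qf a * qf b)) * Pw d a b * W3 d l z a / (p ^ (a * b))\<^sup>2"

lemma Pw_Suc: "Pw d a (Suc b) = Pw d a b * w1 d (a + b)"
  by (simp add: Pw_def)

lemma Pw_Suc_shift: "Pw d a (Suc b) = w1 d a * Pw d (Suc a) b"
  by (simp add: Pw_def prod.lessThan_Suc_shift del: prod.lessThan_Suc)

lemma W3_Suc: "W3 d l z (Suc a) = W3 d l z a * (p ^ l - z\<^sup>2 * Kc d a)"
  by (simp add: W3_def)

text \<open>
  The Pascal rule of the Gaussian binomial coefficients, with weights. All three values of \<open>Yc\<close> are
  multiples of a common \<open>C\<close>; what remains is a rational identity in \<open>x = p\<^sup>a\<close>, \<open>y = p\<^sup>b\<close>, \<open>P = p\<^sup>d\<close> and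
  \<open>L = p\<^sup>l\<close>.
\<close>

lemma Yc_rec_inner:
  "Yc d l z (Suc a) (Suc b) =
     (Kc l (Suc b) - z * Kc d (Suc (a + b)) * z) * Yc d l z a (Suc b) +
     (z - z * Kc d (Suc (a + b)) * Kc d (Suc a)) * Yc d l z (Suc a) b"
proof -
  define x y P L where "x = p ^ a" and "y = p ^ b" and "P = p ^ d" and "L = p ^ l"
  note nz = x_def y_def P_def L_def
  have [simp]: "x \<noteq> 0" "y \<noteq> 0" "P \<noteq> 0" "L \<noteq> 0" by (simp_all add: nz)
  define \<alpha> where "\<alpha> = 1 - (p * x)\<^sup>2"
  define \<beta> where "\<beta> = 1 - (p * y)\<^sup>2"
  have [simp]: "\<alpha> \<noteq> 0" "\<beta> \<noteq> 0"
    using one_minus_pow_nz[of a] one_minus_pow_nz[of b] by (simp_all add: \<alpha>_def \<beta>_def nz)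
  define Q X W R where "Q = qf (Suc (a + b))" and "X = Pw d (Suc a) b" and "W = W3 d l z a"
    and "R = (p ^ (a * b))\<^sup>2"
  have [simp]: "R \<noteq> 0" by (simp add: R_def)
  define w where "w = L - z\<^sup>2 * (P / (x * x))"
  define C where "C = z ^ Suc b * Q / (qf a * qf b) * X * W / R"
  have Y1: "Yc d l z (Suc a) (Suc b) =
     C / (\<alpha> * \<beta>) * (1 - (p * p * x * y)\<^sup>2) * (1 - (P / (p * x * y))\<^sup>2) * w / (p * x * y)\<^sup>2"
  proof -
    have "Yc d l z (Suc a) (Suc b) = z ^ Suc b * (Q * (1 - (p * p * x * y)\<^sup>2) / (qf a * \<alpha> * (qf b * \<beta>)))
        * (X * (1 - (P / (p * x * y))\<^sup>2)) * (W * w) / (R * (p * x * y)\<^sup>2)"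
      by (simp add: Yc_def Pw_Suc W3_Suc qf_Suc Q_def X_def W_def R_def \<alpha>_def \<beta>_def w_def
          w1_def Kc_def power_add nz power_mult_distrib mult_ac)
    then show ?thesis by (simp add: C_def mult_ac)
  qed
  have Y2: "Yc d l z a (Suc b) = C / \<beta> * (1 - (P / x)\<^sup>2) / x\<^sup>2"
  proof -
    have "Yc d l z a (Suc b) = z ^ Suc b * (Q / (qf a * (qf b * \<beta>)))
        * ((1 - (P / x)\<^sup>2) * X) * W / (R * x\<^sup>2)"
      unfolding Yc_def Pw_Suc_shift
      by (simp add: qf_Suc Q_def X_def W_def R_def \<beta>_def
          w1_def power_add nz power_mult_distrib mult_ac)
    then show ?thesis by (simp add: C_def mult_ac)
  qed
  have Y3: "z * Yc d l z (Suc a) b = C / \<alpha> * w / y\<^sup>2"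
  proof -
    have "z * Yc d l z (Suc a) b = z ^ Suc b * (Q / (qf a * \<alpha> * qf b)) * X * (W * w) / (R * y\<^sup>2)"
      by (simp add: Yc_def W3_Suc qf_Suc Q_def X_def W_def R_def \<alpha>_def w_def
          w1_def Kc_def power_add nz power_mult_distrib mult_ac)
    then show ?thesis by (simp add: C_def mult_ac)
  qed
  have k1: "Kc l (Suc b) - z * Kc d (Suc (a + b)) * z = w / (p * y)\<^sup>2"
    by (simp add: Kc_def w_def nz power_add power2_eq_square diff_divide_distrib mult_ac)
  have k2: "Kc d (Suc (a + b)) * Kc d (Suc a) = P\<^sup>2 / ((p * x * y)\<^sup>2 * (p * x)\<^sup>2)"
    by (simp add: Kc_def nz power_add power2_eq_square mult_ac)
  have Y3': "(z - z * Kc d (Suc (a + b)) * Kc d (Suc a)) * Yc d l z (Suc a) b =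
      (1 - P\<^sup>2 / ((p * x * y)\<^sup>2 * (p * x)\<^sup>2)) * (C / \<alpha> * w / y\<^sup>2)"
    unfolding Y3[symmetric] k2[symmetric] by (simp add: algebra_simps)
  have gen: "N / (\<alpha> * \<beta> * T) = U / \<beta> + V / \<alpha>" if "N = (U * \<alpha> + V * \<beta>) * T" "T \<noteq> 0" for N U V T
  proof -
    have "N / (\<alpha> * \<beta> * T) = (U * \<alpha> + V * \<beta>) / (\<alpha> * \<beta>)"
      using that(2) unfolding that(1) by simp
    also have "\<dots> = U / \<beta> + V / \<alpha>"
      by (simp add: add_divide_distrib)
    finally show ?thesis .
  qed
  have "(1 - (p * p * x * y)\<^sup>2) * (1 - (P / (p * x * y))\<^sup>2) =
     ((1 - (P / x)\<^sup>2) / (x\<^sup>2 * (p * y)\<^sup>2) * \<alpha> + (1 - P\<^sup>2 / ((p * x * y)\<^sup>2 * (p * x)\<^sup>2)) / y\<^sup>2 * \<beta>) * (p * x * y)\<^sup>2"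
    unfolding \<alpha>_def \<beta>_def by (simp add: field_simps power2_eq_square)
  then have "(1 - (p * p * x * y)\<^sup>2) * (1 - (P / (p * x * y))\<^sup>2) / (\<alpha> * \<beta> * (p * x * y)\<^sup>2) =
     (1 - (P / x)\<^sup>2) / (\<beta> * x\<^sup>2 * (p * y)\<^sup>2) + (1 - P\<^sup>2 / ((p * x * y)\<^sup>2 * (p * x)\<^sup>2)) / (\<alpha> * y\<^sup>2)"
    using gen[of _ "(1 - (P / x)\<^sup>2) / (x\<^sup>2 * (p * y)\<^sup>2)" "(1 - P\<^sup>2 / ((p * x * y)\<^sup>2 * (p * x)\<^sup>2)) / y\<^sup>2" "(p * x * y)\<^sup>2"]
    by (simp add: mult_ac)
  then have key: "C * w * ((1 - (p * p * x * y)\<^sup>2) * (1 - (P / (p * x * y))\<^sup>2) / (\<alpha> * \<beta> * (p * x * y)\<^sup>2)) =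
     C * w * ((1 - (P / x)\<^sup>2) / (\<beta> * x\<^sup>2 * (p * y)\<^sup>2) + (1 - P\<^sup>2 / ((p * x * y)\<^sup>2 * (p * x)\<^sup>2)) / (\<alpha> * y\<^sup>2))"
    by simp
  have "Yc d l z (Suc a) (Suc b) =
      C * w * ((1 - (p * p * x * y)\<^sup>2) * (1 - (P / (p * x * y))\<^sup>2) / (\<alpha> * \<beta> * (p * x * y)\<^sup>2))"
    unfolding Y1 by (simp add: mult_ac)
  also note key
  also have "C * w * (D / (\<beta> * x\<^sup>2 * (p * y)\<^sup>2) + F / (\<alpha> * y\<^sup>2)) =
      w / (p * y)\<^sup>2 * (C / \<beta> * D / x\<^sup>2) + F * (C / \<alpha> * w / y\<^sup>2)" for D F
    unfolding semiring_class.distrib_left by (simp add: mult_ac)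
  finally show ?thesis unfolding Y2 Y3' k1 .
qed

lemma Yc_rec_left: "Yc d l z (Suc a) 0 = (Kc l 0 - z * Kc d a * z) * Yc d l z a 0"
  by (simp add: Yc_def W3_Suc Pw_def power2_eq_square mult_ac)

lemma Yc_rec_right: "Yc d l z 0 (Suc b) = (z - z * Kc d b * Kc d 0) * Yc d l z 0 b"
  by (simp add: Yc_def W3_def Pw_Suc w1_def Kc_def power2_eq_square algebra_simps)

lemma Yc_0 [simp]: "Yc d l z 0 0 = 1"
  by (simp add: Yc_def Pw_def W3_def qf_def)

text \<open>
  The action of \<open>opE'\<close> in terms of coefficients. As above, a common factor \<open>C\<close> reduces the claim to a
  rational identity, the last display in the proof.
\<close>

lemma Yc_lower:
  "1 / Kc l b * ec d (Suc a) * Yc d l z (Suc a) b + z * ec l (Suc b) * Yc d l z a (Suc b) =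
   Dn d l z (a + b) * ec d (Suc (a + b)) * Yc d l z a b"
proof -
  define x y P L where "x = p ^ a" and "y = p ^ b" and "P = p ^ d" and "L = p ^ l"
  note nz = x_def y_def P_def L_def
  have [simp]: "x \<noteq> 0" "y \<noteq> 0" "P \<noteq> 0" "L \<noteq> 0" by (simp_all add: nz)
  define \<alpha> where "\<alpha> = 1 - (p * x)\<^sup>2"
  define \<beta> where "\<beta> = 1 - (p * y)\<^sup>2"
  define \<gamma> where "\<gamma> = 1 - (p * x * y)\<^sup>2"
  have [simp]: "\<alpha> \<noteq> 0" "\<beta> \<noteq> 0" "\<gamma> \<noteq> 0"
    using one_minus_pow_nz[of a] one_minus_pow_nz[of b] one_minus_pow_nz[of "a + b"]
    by (simp_all add: \<alpha>_def \<beta>_def \<gamma>_def nz power_add mult_ac)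
  define \<kappa> where "\<kappa> = (p - 1 / p)\<^sup>2"
  have [simp]: "\<kappa> \<noteq> 0" by (simp add: \<kappa>_def)
  define w where "w = L - z\<^sup>2 * (P / (x * x))"
  define C where "C = z ^ b * qf (a + b) * \<gamma> / (qf a * qf b) * (Pw d a b * w1 d (a + b)) * W3 d l z a / (p ^ (a * b))\<^sup>2"
  have S: "w1 d a * Pw d (Suc a) b = Pw d a b * w1 d (a + b)"
    using Pw_Suc[of d a b] Pw_Suc_shift[of d a b] by simp
  have e1: "ec d (Suc a) = \<alpha> * w1 d a / (p * P * \<kappa>)"
    unfolding ec_def \<kappa>_def[symmetric] by (simp add: \<alpha>_def w1_def nz field_simps power2_eq_square)
  have e2: "ec d (Suc (a + b)) = \<gamma> * w1 d (a + b) / (p * P * \<kappa>)"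
    unfolding ec_def \<kappa>_def[symmetric]
    by (simp add: \<gamma>_def w1_def nz field_simps power2_eq_square power_add)
  have e3: "ec l (Suc b) = - \<beta> / (p * y) * (L / y - y / L) / \<kappa>"
    unfolding ec_def \<kappa>_def[symmetric] by (simp add: \<beta>_def nz field_simps power2_eq_square)
  have qs: "qf (Suc (a + b)) = qf (a + b) * \<gamma>" "qf (Suc a) = qf a * \<alpha>" "qf (Suc b) = qf b * \<beta>"
    by (simp_all add: qf_Suc \<alpha>_def \<beta>_def \<gamma>_def nz power_add mult_ac)
  have t1: "ec d (Suc a) * Yc d l z (Suc a) b = C * w / (p * P * \<kappa> * y\<^sup>2)"
  proof -
    have "ec d (Suc a) * Yc d l z (Suc a) b = \<alpha> / (p * P * \<kappa>) * (z ^ b * (qf (a + b) * \<gamma> / (qf a * \<alpha> * qf b)) *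
        (w1 d a * Pw d (Suc a) b) * (W3 d l z a * w) / ((p ^ (a * b))\<^sup>2 * y\<^sup>2))"
      by (simp add: Yc_def e1 W3_Suc qs w_def Kc_def power_add nz power_mult_distrib mult_ac)
    then show ?thesis unfolding S by (simp add: C_def mult_ac)
  qed
  have t2: "Yc d l z a (Suc b) = C * z / (\<beta> * x\<^sup>2)"
    by (simp add: C_def Yc_def Pw_Suc qs power_add nz power_mult_distrib mult_ac)
  have t3: "ec d (Suc (a + b)) * Yc d l z a b = C / (p * P * \<kappa>)"
    by (simp add: C_def Yc_def e2 mult_ac)
  have "Dn d l z (a + b) = 1 - z\<^sup>2 * (P * L / (x * y)\<^sup>2)"
    by (simp add: Dn_def Kc_def nz power_add power2_eq_square mult_ac)
  moreover have "Kc l b = L / y\<^sup>2"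
    by (simp add: Kc_def nz power2_eq_square)
  moreover have "y\<^sup>2 / L * (w / (p * P * y\<^sup>2)) + z * (- 1 / (p * y) * (L / y - y / L)) * z / x\<^sup>2 =
      (1 - z\<^sup>2 * (P * L / (x * y)\<^sup>2)) / (p * P)"
    unfolding w_def by (simp add: field_simps power2_eq_square)
  then have "y\<^sup>2 / L * (C * w / (p * P * \<kappa> * y\<^sup>2)) + z * (- \<beta> / (p * y) * (L / y - y / L) / \<kappa>) * (C * z / (\<beta> * x\<^sup>2)) =
      (1 - z\<^sup>2 * (P * L / (x * y)\<^sup>2)) * (C / (p * P * \<kappa>))"
  proof -
    assume h: "y\<^sup>2 / L * (w / (p * P * y\<^sup>2)) + z * (- 1 / (p * y) * (L / y - y / L)) * z / x\<^sup>2 =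
      (1 - z\<^sup>2 * (P * L / (x * y)\<^sup>2)) / (p * P)"
    have "y\<^sup>2 / L * (C * w / (p * P * \<kappa> * y\<^sup>2)) + z * (- \<beta> / (p * y) * (L / y - y / L) / \<kappa>) * (C * z / (\<beta> * x\<^sup>2)) =
      (C / \<kappa>) * (y\<^sup>2 / L * (w / (p * P * y\<^sup>2)) + z * (- 1 / (p * y) * (L / y - y / L)) * z / x\<^sup>2)"
      by (simp add: semiring_class.distrib_left right_diff_distrib add_divide_distrib diff_divide_distrib mult_ac)
    then show ?thesis unfolding h by (simp add: mult_ac)
  qed
  moreover have "1 / (L / y\<^sup>2) = y\<^sup>2 / L" by simp
  ultimately show ?thesis
    by (simp only: t1 t2 t3 e3 mult.assoc)
qed

end

text \<open>
  A linear functional is a linear map to the one-dimensional space \<open>unit vec\<close>, so that the uniqueness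
  principle for linear maps applies.
\<close>

lemma functional_eqI:
  fixes \<phi> \<psi> :: "'a vec \<Rightarrow> complex"
  assumes "\<And>u v. \<phi> (u + v) = \<phi> u + \<phi> v" "\<And>c u. \<phi> (c \<cdot> u) = c * \<phi> u"
    and "\<And>u v. \<psi> (u + v) = \<psi> u + \<psi> v" "\<And>c u. \<psi> (c \<cdot> u) = c * \<psi> u"
    and "\<And>a. \<phi> (bas a) = \<psi> (bas a)"
  shows "\<phi> u = \<psi> u"
proof -
  have "(\<lambda>u. \<phi> u \<cdot> bas ()) = (\<lambda>u. \<psi> u \<cdot> bas ())"
    by (rule lin_eqI) (auto intro!: linI simp: assms add_smul)
  then have "Poly_Mapping.lookup (\<phi> u \<cdot> bas ()) () = Poly_Mapping.lookup (\<psi> u \<cdot> bas ()) ()"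
    using fun_cong[of "\<lambda>u. \<phi> u \<cdot> bas ()" "\<lambda>u. \<psi> u \<cdot> bas ()" u] by simp
  then show ?thesis by (simp add: lookup_bas)
qed

context nonroot
begin

lemma lookup_raise:
  "Poly_Mapping.lookup (raise \<infinity> \<infinity> f g u) (a, b) =
     (case a of 0 \<Rightarrow> 0 | Suc a' \<Rightarrow> f a' b * Poly_Mapping.lookup u (a', b)) +
     (case b of 0 \<Rightarrow> 0 | Suc b' \<Rightarrow> g a b' * Poly_Mapping.lookup u (a, b'))"
  by (rule functional_eqI[where \<phi> = "\<lambda>u. Poly_Mapping.lookup (raise \<infinity> \<infinity> f g u) (a, b)"])
    (auto simp: lin_add[OF lin_raise] lin_smul[OF lin_raise] lookup_add raise_bas up1_def up2_def
      lookup_bas algebra_simps split: nat.splits if_splits)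

lemma lookup_lower:
  "Poly_Mapping.lookup (lower d l f g u) (a, b) =
     f (Suc a) b * ec d (Suc a) * Poly_Mapping.lookup u (Suc a, b) +
     g a (Suc b) * ec l (Suc b) * Poly_Mapping.lookup u (a, Suc b)"
proof (rule functional_eqI[where \<phi> = "\<lambda>u. Poly_Mapping.lookup (lower d l f g u) (a, b)"])
  fix s :: "nat \<times> nat"
  obtain i j where "s = (i, j)" by (cases s)
  then show "Poly_Mapping.lookup (lower d l f g (bas s)) (a, b) =
     f (Suc a) b * ec d (Suc a) * Poly_Mapping.lookup (bas s) (Suc a, b) +
     g a (Suc b) * ec l (Suc b) * Poly_Mapping.lookup (bas s) (a, Suc b)"
    by (cases i; cases j) (auto simp: lower_bas lookup_add lookup_bas)
qed (auto simp: lin_add[OF lin_lower] lin_smul[OF lin_lower] lookup_add algebra_simps)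

text \<open>The images of the states \<open>bas (n, 0)\<close>, freed of denominators (see \<open>Rm_xi\<close>).\<close>

primrec xi :: "nat \<Rightarrow> nat \<Rightarrow> complex \<Rightarrow> nat \<Rightarrow> (nat \<times> nat) vec" where
  "xi d l z 0 = bas (0, 0)"
| "xi d l z (Suc n) = opA' \<infinity> \<infinity> l z (xi d l z n) - (z * Kc d n) \<cdot> opB' \<infinity> \<infinity> d z (xi d l z n)"

lemma lookup_xi: "Poly_Mapping.lookup (xi d l z n) (a, b) = (if a + b = n then Yc d l z a b else 0)"
proof (induction n arbitrary: a b)
  case 0
  then show ?case by (auto simp: lookup_bas)
next
  case (Suc n)
  have 1: "Poly_Mapping.lookup (xi d l z (Suc n)) (a, b) =
     (case a of 0 \<Rightarrow> 0 | Suc a' \<Rightarrow> (Kc l b - z * Kc d n * z) * Poly_Mapping.lookup (xi d l z n) (a', b)) +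
     (case b of 0 \<Rightarrow> 0 | Suc b' \<Rightarrow> (z - z * Kc d n * Kc d a) * Poly_Mapping.lookup (xi d l z n) (a, b'))"
    by (auto simp: lookup_minus op_defs lookup_raise algebra_simps split: nat.splits)
  show ?case
  proof (cases "a + b = Suc n")
    case False
    then show ?thesis unfolding 1 Suc by (auto split: nat.splits)
  next
    case True
    then consider a' b' where "a = Suc a'" "b = Suc b'" "n = Suc (a' + b')"
      | "a = Suc n" "b = 0" | "a = 0" "b = Suc n"
      by (cases a; cases b) auto
    then show ?thesis
    proof cases
      case 1
      then show ?thesis unfolding \<open>_ = _ + _\<close> Suc
        using Yc_rec_inner[of d l z a' b'] by simp
    next
      case 2
      then show ?thesis unfolding 1 Suc using Yc_rec_left[of d l z n] by simp
    next
      case 3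
      then show ?thesis unfolding 1 Suc using Yc_rec_right[of d l z n] by simp
    qed
  qed
qed

text \<open>Lowering undoes one step of the recursion, up to the factor that the recursion divides by.\<close>

lemma opE'_xi: "opE' d l z (xi d l z (Suc n)) = (Dn d l z n * ec d (Suc n)) \<cdot> xi d l z n"
proof (rule poly_mapping_eqI)
  fix s :: "nat \<times> nat"
  obtain a b where s: "s = (a, b)" by (cases s)
  show "Poly_Mapping.lookup (opE' d l z (xi d l z (Suc n))) s =
        Poly_Mapping.lookup ((Dn d l z n * ec d (Suc n)) \<cdot> xi d l z n) s"
    using Yc_lower[of l b d a z] by (simp add: s opE'_def lookup_lower lookup_xi del: xi.simps)
qed

lemma Rm_xi: "Rm \<infinity> \<infinity> d l z n 0 = (1 / (\<Prod>i<n. Dn d l z i)) \<cdot> xi d l z n"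
  by (induction n) (simp_all add: lin_simps smul_diff mult_ac)

text \<open>
  In weight \<open>d + 1\<close> only \<open>bas (d + 1, 0)\<close> survives: for \<open>b > 0\<close> and \<open>a + b = d + 1\<close> the product \<open>Pw d a b\<close> in
  \<open>Yc\<close> contains the factor \<open>w1 d d = 0\<close>. Hence \<open>R\<close> respects the kernel of the projection to
  the finite-dimensional module.
\<close>

lemma Rm_top: "\<exists>s. Rm \<infinity> \<infinity> d l z (Suc d) 0 = s \<cdot> bas (Suc d, 0)"
proof -
  have Y: "Yc d l z a b = 0" if "a + b = Suc d" "b > 0" for a b
  proof -
    have "w1 d (a + (d - a)) = 0" using that by (simp add: w1_def)
    moreover have "d - a < b" using that by simp
    ultimately have "Pw d a b = 0" unfolding Pw_def by (meson finite_lessThan lessThan_iff prod_zero)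
    then show ?thesis by (simp add: Yc_def)
  qed
  have "xi d l z (Suc d) = Yc d l z (Suc d) 0 \<cdot> bas (Suc d, 0)"
  proof (rule poly_mapping_eqI)
    fix s :: "nat \<times> nat"
    obtain a b where s: "s = (a, b)" by (cases s)
    show "Poly_Mapping.lookup (xi d l z (Suc d)) s = Poly_Mapping.lookup (Yc d l z (Suc d) 0 \<cdot> bas (Suc d, 0)) s"
      using Y[of a b] by (auto simp: s lookup_xi lookup_bas simp del: xi.simps)
  qed
  then show ?thesis unfolding Rm_xi by (metis smul_smul)
qed


section \<open>The R-operator intertwines the lowering operators\<close>

text \<open>The value on weight \<open>n\<close> of the commutator of \<open>opE\<close> with \<open>opB\<close>, and also of that of \<open>opE'\<close> with \<open>opB'\<close>.\<close>

definition Cc :: "nat \<Rightarrow> nat \<Rightarrow> complex \<Rightarrow> nat \<Rightarrow> complex" where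
  "Cc d l z n = z * ((Kc (d + l) n - 1 / Kc (d + l) n) / (p - 1 / p))"

lemma comm_coeff:
  "z * Kc l b * ec d (Suc a) + z / Kc d a * ec l (Suc b) =
   Cc d l z (a + b) + (z * Kc l b * ec d a + z / Kc d a * ec l b)"
proof -
  have e: "ec d (Suc a) = ec d a + (Kc d a - 1 / Kc d a) / (p - 1 / p)"
    "ec l (Suc b) = ec l b + (Kc l b - 1 / Kc l b) / (p - 1 / p)"
    using ec_diff by (simp_all add: algebra_simps)
  have *: "x \<noteq> 0 \<Longrightarrow> y \<noteq> 0 \<Longrightarrow> z * y * (e + (x - 1 / x) * k) + z / x * (e' + (y - 1 / y) * k) =
    z * ((x * y - 1 / (x * y)) * k) + (z * y * e + z / x * e')" for x y e e' k :: complex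
    by (simp add: field_simps)
  show ?thesis
    unfolding e Cc_def Kc_mult[symmetric]
    using *[of "Kc d a" "Kc l b" "ec d a" "1 / (p - 1 / p)" "ec l b"] by simp
qed

lemma opE_opB_bas:
  "opE d l z (opB \<infinity> \<infinity> l z (bas (a, b))) = opB \<infinity> \<infinity> l z (opE d l z (bas (a, b))) + Cc d l z (a + b) \<cdot> bas (a, b)"
proof -
  have 1: "opE d l z (opB \<infinity> \<infinity> l z (bas (a, b))) =
    (z * Kc l b * ec d (Suc a) + z / Kc d a * ec l (Suc b)) \<cdot> bas (a, b)
    + (z * Kc l b * (z / Kc d (Suc a) * ec l b)) \<cdot> bas (Suc a, b - 1) + ec d a \<cdot> bas (a - 1, Suc b)"
    by (simp add: op_defs raise_bas lower_bas up1_def up2_def lin_simps smul_add add_smul)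
  have 2: "opB \<infinity> \<infinity> l z (opE d l z (bas (a, b))) = (z * Kc l b * ec d a + z / Kc d a * ec l b) \<cdot> bas (a, b)
    + (z * Kc l b * (z / Kc d (Suc a) * ec l b)) \<cdot> bas (Suc a, b - 1) + ec d a \<cdot> bas (a - 1, Suc b)"
    by (cases a; cases b)
      (simp_all add: op_defs raise_bas lower_bas up1_def up2_def lin_simps smul_add add_smul Kc_Suc mult_ac)
  show ?thesis unfolding 1 2 comm_coeff by (simp add: add_smul)
qed

lemma opE'_opB'_bas:
  "opE' d l z (opB' \<infinity> \<infinity> d z (bas (a, b))) = opB' \<infinity> \<infinity> d z (opE' d l z (bas (a, b))) + Cc d l z (a + b) \<cdot> bas (a, b)"
proof -
  have 1: "opE' d l z (opB' \<infinity> \<infinity> d z (bas (a, b))) =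
    (z / Kc l b * ec d (Suc a) + z * Kc d a * ec l (Suc b)) \<cdot> bas (a, b)
    + (z * z * ec l b) \<cdot> bas (Suc a, b - 1) + (Kc d a / Kc l (Suc b) * ec d a) \<cdot> bas (a - 1, Suc b)"
    by (simp add: op_defs raise_bas lower_bas up1_def up2_def lin_simps smul_add add_smul mult_ac)
  have 2: "opB' \<infinity> \<infinity> d z (opE' d l z (bas (a, b))) = (z / Kc l b * ec d a + z * Kc d a * ec l b) \<cdot> bas (a, b)
    + (z * z * ec l b) \<cdot> bas (Suc a, b - 1) + (Kc d a / Kc l (Suc b) * ec d a) \<cdot> bas (a - 1, Suc b)"
    by (cases a; cases b)
      (simp_all add: op_defs raise_bas lower_bas up1_def up2_def lin_simps smul_add add_smul Kc_Suc mult_ac)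
  have 3: "z / Kc l b * ec d (Suc a) + z * Kc d a * ec l (Suc b) =
     Cc d l z (a + b) + (z / Kc l b * ec d a + z * Kc d a * ec l b)"
    using comm_coeff[of z d a l b] by (simp add: Cc_def add.commute mult_ac)
  show ?thesis unfolding 1 2 3 by (simp add: add_smul)
qed

lemma opE'_opB'_level:
  assumes "u \<in> level n"
  shows "opE' d l z (opB' \<infinity> \<infinity> d z u) = opB' \<infinity> \<infinity> d z (opE' d l z u) + Cc d l z n \<cdot> u"
  by (rule lin_eq_on[of _ _ "{(a, b). a + b = n}"])
    (use assms in \<open>auto simp: level_def opE'_opB'_bas intro!: linI simp: lin_simps smul_add mult_ac\<close>)

context
  fixes d l z
  assumes Dn: "\<And>n. Dn d l z n \<noteq> 0"
begin

private abbreviation "R \<equiv> Rop \<infinity> \<infinity> d l z"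

lemma Rop_opA: "R (opA \<infinity> \<infinity> d z u) = opA' \<infinity> \<infinity> l z (R u)"
proof -
  have "R \<circ> opA \<infinity> \<infinity> d z = opA' \<infinity> \<infinity> l z \<circ> R"
  proof (rule lin_eqI)
    fix s :: "nat \<times> nat"
    show "(R \<circ> opA \<infinity> \<infinity> d z) (bas s) = (opA' \<infinity> \<infinity> l z \<circ> R) (bas s)"
      using Rop_opA_opB_bas(1)[OF Dn, where c = \<infinity> and c' = \<infinity>] by (cases s) simp
  qed auto
  then show ?thesis by (metis comp_apply)
qed

lemma Rop_opB: "R (opB \<infinity> \<infinity> l z u) = opB' \<infinity> \<infinity> d z (R u)"
proof -
  have "R \<circ> opB \<infinity> \<infinity> l z = opB' \<infinity> \<infinity> d z \<circ> R"
  proof (rule lin_eqI)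
    fix s :: "nat \<times> nat"
    show "(R \<circ> opB \<infinity> \<infinity> l z) (bas s) = (opB' \<infinity> \<infinity> d z \<circ> R) (bas s)"
      using Rop_opA_opB_bas(2)[OF Dn, where c = \<infinity> and c' = \<infinity>] by (cases s) simp
  qed auto
  then show ?thesis by (metis comp_apply)
qed

end

text \<open>
  The defect \<open>X = R E - E' R\<close> satisfies \<open>X B = B' X\<close>, because the commutators of \<open>E\<close> with \<open>B\<close> and of
  \<open>E'\<close> with \<open>B'\<close> are the same function of the weight. Modulo the image of \<open>B\<close> every state comes from
  the first factor, so that it is enough that \<open>X\<close> kills the states \<open>bas (a, 0)\<close>.
\<close>

lemma Rop_opE_bas:
  assumes "\<forall>n<a + b. Dn d l z n \<noteq> 0"
  shows "Rop \<infinity> \<infinity> d l z (opE d l z (bas (a, b))) = opE' d l z (Rm \<infinity> \<infinity> d l z a b)"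
proof -
  let ?R = "Rop \<infinity> \<infinity> d l z"
  define X where "X u = ?R (opE d l z u) - opE' d l z (?R u)" for u
  have linX: "lin X"
    unfolding X_def by (auto intro!: linI simp: lin_simps smul_diff)
  have RB: "?R (opB \<infinity> \<infinity> l z (bas (a, b))) = opB' \<infinity> \<infinity> d z (Rm \<infinity> \<infinity> d l z a b)"
    if "Dn d l z (a + b) \<noteq> 0" for a b
    using Rop_opA_opB_bas(2)[of d l z a b \<infinity> \<infinity>] that by simp
  have XB: "X (opB \<infinity> \<infinity> l z (bas (a, b))) = opB' \<infinity> \<infinity> d z (X (bas (a, b)))"
    if D: "\<forall>n<Suc (a + b). Dn d l z n \<noteq> 0" for a b
  proof -
    have 1: "Dn d l z (a - 1 + b) \<noteq> 0" "Dn d l z (a + (b - 1)) \<noteq> 0" "Dn d l z (a + b) \<noteq> 0"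
      using D by auto
    have "?R (opB \<infinity> \<infinity> l z (opE d l z (bas (a, b)))) = opB' \<infinity> \<infinity> d z (?R (opE d l z (bas (a, b))))"
      unfolding opE_def lower_bas by (simp add: lin_add lin_smul RB[OF 1(1)] RB[OF 1(2)] del: One_nat_def)
    then show ?thesis
      unfolding X_def by (simp add: opE_opB_bas RB[OF 1(3)] lin_simps opE'_opB'_level[OF Rm_level])
  qed
  have "X (bas (a, b)) = 0" using assms
  proof (induction b arbitrary: a)
    case 0
    show ?case
    proof (cases a)
      case 0
      then show ?thesis by (simp add: X_def op_defs lower_bas lin_zero)
    next
      case (Suc n)
      have "?R (opE d l z (bas (Suc n, 0))) = (ec d (Suc n)) \<cdot> Rm \<infinity> \<infinity> d l z n 0"
        by (simp add: op_defs lower_bas lin_smul)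
      moreover have "Dn d l z n \<noteq> 0" using 0 Suc by simp
      then have "opE' d l z (?R (bas (Suc n, 0))) = (ec d (Suc n)) \<cdot> Rm \<infinity> \<infinity> d l z n 0"
        unfolding Rop_bas Rm_xi by (simp add: lin_smul opE'_xi del: xi.simps)
      ultimately show ?thesis by (simp add: X_def Suc)
    qed
  next
    case (Suc b)
    have "opB \<infinity> \<infinity> l z (bas (a, b)) = (z * Kc l b) \<cdot> bas (Suc a, b) + bas (a, Suc b)"
      by (simp add: opB_def raise_bas up1_def up2_def)
    then have "X (bas (a, Suc b)) = X (opB \<infinity> \<infinity> l z (bas (a, b))) - (z * Kc l b) \<cdot> X (bas (Suc a, b))"
      by (simp add: lin_simps linX)
    then show ?case using Suc.IH[of a] Suc.IH[of "Suc a"] Suc.prems by (simp add: XB lin_zero)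
  qed
  then show ?thesis unfolding X_def by simp
qed

lemma Rop_opG_bas:
  assumes "\<forall>n<a + b. Dn d l z n \<noteq> 0"
  shows "Rop \<infinity> \<infinity> d l z (opG d l z (bas (a, b))) = opG' d l z (Rm \<infinity> \<infinity> d l z a b)"
proof -
  have "perm (Rop \<infinity> \<infinity> d l z (opG d l z (bas (a, b)))) = perm (opG' d l z (Rm \<infinity> \<infinity> d l z a b))"
    using Rop_opE_bas[of b a l d z] assms
    by (simp add: perm_Rop perm_ops perm_Rm Dn_commute[of l d] add.commute)
  then show ?thesis by (metis perm_perm)
qed

lemma Rop_opE:
  assumes "\<And>n. Dn d l z n \<noteq> 0"
  shows "Rop \<infinity> \<infinity> d l z (opE d l z u) = opE' d l z (Rop \<infinity> \<infinity> d l z u)"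
proof -
  have "Rop \<infinity> \<infinity> d l z \<circ> opE d l z = opE' d l z \<circ> Rop \<infinity> \<infinity> d l z"
    by (rule lin_eqI) (use assms Rop_opE_bas in auto)
  then show ?thesis by (metis comp_apply)
qed

lemma Rop_opG:
  assumes "\<And>n. Dn d l z n \<noteq> 0"
  shows "Rop \<infinity> \<infinity> d l z (opG d l z u) = opG' d l z (Rop \<infinity> \<infinity> d l z u)"
proof -
  have "Rop \<infinity> \<infinity> d l z \<circ> opG d l z = opG' d l z \<circ> Rop \<infinity> \<infinity> d l z"
    by (rule lin_eqI) (use assms Rop_opG_bas in auto)
  then show ?thesis by (metis comp_apply)
qed

end


section \<open>Functions that are rational in the exponential\<close>

lemma rational_in_exp_reduce:
  assumes "q \<noteq> 0"
  shows "\<exists>f. rational_in_exp f \<and> (\<forall>x. poly q (exp x) \<noteq> 0 \<longrightarrow> f x = poly r (exp x) / poly q (exp x))"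
proof -
  define g where "g = gcd r q"
  have g: "g \<noteq> 0" using assms by (simp add: g_def)
  obtain r' q' where rq: "r = r' * g" "q = q' * g" "coprime r' q'"
    using gcd_coprime_exists[of r q] assms unfolding g_def by auto
  show ?thesis
  proof (intro exI conjI allI impI)
    show "rational_in_exp (\<lambda>x. poly r' (exp x) / poly q' (exp x))"
      unfolding rational_in_exp_def using rq assms by auto
    show "poly r' (exp x) / poly q' (exp x) = poly r (exp x) / poly q (exp x)"
      if "poly q (exp x) \<noteq> 0" for x
      using that unfolding rq by simp
  qed
qed

lemma rational_in_exp_zero [simp]: "rational_in_exp (\<lambda>x. 0)"
  unfolding rational_in_exp_def by (rule exI[of _ 0], rule exI[of _ 1]) simp

lemma countable_exp_eq: "countable {x::complex. exp x = w}"
proof (cases "w = 0")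
  case False
  then obtain x0 where x0: "exp x0 = w" using exp_Ln by metis
  have "{x. exp x = w} \<subseteq> range (\<lambda>n::int. x0 + (of_int (2 * n) * of_real pi) * \<i>)"
    unfolding x0[symmetric] exp_eq by auto
  then show ?thesis by (rule countable_subset) auto
qed auto

lemma countable_poly_exp:
  assumes "(q :: complex poly) \<noteq> 0"
  shows "countable {x. poly q (exp x) = 0}"
proof -
  have "{x. poly q (exp x) = 0} = (\<Union>w\<in>{w. poly q w = 0}. {x. exp x = w})"
    by auto
  moreover have "countable {w. poly q w = 0}"
    by (rule countable_finite) (rule poly_roots_finite[OF assms])
  ultimately show ?thesis
    by (simp add: countable_UN countable_exp_eq)
qed

text \<open>
  Off a countable set the two quotients agree, which makes the cross-multiplied polynomials equal. As both
  fractions are reduced, their denominators have the same zeros, so that the functions agree at the poles, too.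
\<close>

lemma rational_in_exp_unique:
  assumes f: "rational_in_exp f" and g: "rational_in_exp g" and Z: "countable Z"
    and eq: "\<And>x. x \<notin> Z \<Longrightarrow> f x = g x"
  shows "f = g"
proof -
  obtain p1 q1 where 1: "q1 \<noteq> 0" "coprime p1 q1" "\<And>x. f x = poly p1 (exp x) / poly q1 (exp x)"
    using f unfolding rational_in_exp_def by blast
  obtain p2 q2 where 2: "q2 \<noteq> 0" "coprime p2 q2" "\<And>x. g x = poly p2 (exp x) / poly q2 (exp x)"
    using g unfolding rational_in_exp_def by blast
  define h where "h = p1 * q2 - p2 * q1"
  have "h = 0"
  proof (rule ccontr)
    assume "h \<noteq> 0"
    define Z' where "Z' = Z \<union> {x. poly q1 (exp x) = 0} \<union> {x. poly q2 (exp x) = 0} \<union> {x. poly h (exp x) = 0}"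
    have "countable Z'"
      unfolding Z'_def using Z 1(1) 2(1) \<open>h \<noteq> 0\<close> countable_poly_exp by auto
    then have "Z' \<noteq> UNIV"
      using uncountable_UNIV_complex by auto
    then obtain x where "x \<notin> Z'" by auto
    then have "poly p1 (exp x) / poly q1 (exp x) = poly p2 (exp x) / poly q2 (exp x)"
      "poly q1 (exp x) \<noteq> 0" "poly q2 (exp x) \<noteq> 0" "poly h (exp x) \<noteq> 0"
      using eq[of x] by (auto simp: Z'_def 1(3) 2(3))
    then show False by (simp add: h_def field_simps)
  qed
  then have h: "p1 * q2 = p2 * q1" by (simp add: h_def)
  have "q1 dvd q2"
    using 1(2) h by (metis coprime_commute coprime_dvd_mult_right_iff dvd_triv_right)
  moreover have "q2 dvd q1"
    using 2(2) h by (metis coprime_commute coprime_dvd_mult_right_iff dvd_triv_right)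
  ultimately have q: "poly q1 w = 0 \<longleftrightarrow> poly q2 w = 0" for w
    by (metis dvd_def mult_eq_0_iff poly_mult)
  show "f = g"
  proof
    fix x
    have "poly p1 (exp x) * poly q2 (exp x) = poly p2 (exp x) * poly q1 (exp x)"
      using h by (metis poly_mult)
    then show "f x = g x"
      unfolding 1(3) 2(3) using q[of "exp x"] by (cases "poly q1 (exp x) = 0") (auto simp: field_simps)
  qed
qed

context nonroot
begin


section \<open>The R-operator on Verma modules\<close>

definition DnP :: "nat \<Rightarrow> nat \<Rightarrow> nat \<Rightarrow> complex poly" where
  "DnP d l n = [:1, 0, - Kc (d + l) n:]"

lemma poly_DnP: "poly (DnP d l n) z = Dn d l z n"
  by (simp add: DnP_def Dn_def power2_eq_square)

lemma DnP_nz [simp]: "DnP d l n \<noteq> 0"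
  by (simp add: DnP_def)

text \<open>
  Each step of the recursion divides by one more \<open>Dn\<close>; hence in weight \<open>n\<close> the first \<open>n\<close> of them suffice as
  denominators.
\<close>

definition bounded_denominator :: "nat \<Rightarrow> nat \<Rightarrow> nat \<Rightarrow> (complex \<Rightarrow> complex) \<Rightarrow> bool" where
  "bounded_denominator d l n f \<longleftrightarrow> (\<exists>r. \<forall>z. f z = poly r z / (\<Prod>i<n. Dn d l z i))"

lemma bounded_denominator_intros:
  "bounded_denominator d l n (\<lambda>z. 0)"
  "bounded_denominator d l n f \<Longrightarrow> bounded_denominator d l n g \<Longrightarrow> bounded_denominator d l n (\<lambda>z. f z + g z)"
  "bounded_denominator d l n f \<Longrightarrow> bounded_denominator d l n g \<Longrightarrow> bounded_denominator d l n (\<lambda>z. f z - g z)"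
  "bounded_denominator d l n f \<Longrightarrow> bounded_denominator d l n (\<lambda>z. poly r z * f z)"
  "bounded_denominator d l n f \<Longrightarrow> bounded_denominator d l (Suc n) (\<lambda>z. 1 / Dn d l z n * f z)"
proof -
  show "bounded_denominator d l n (\<lambda>z. 0)"
    unfolding bounded_denominator_def by (rule exI[of _ 0]) simp
  show "bounded_denominator d l n (\<lambda>z. f z + g z)" if fg: "bounded_denominator d l n f" "bounded_denominator d l n g"
  proof -
    obtain r1 r2 where "\<forall>z. f z = poly r1 z / (\<Prod>i<n. Dn d l z i)" "\<forall>z. g z = poly r2 z / (\<Prod>i<n. Dn d l z i)"
      using fg unfolding bounded_denominator_def by blast
    then show ?thesis unfolding bounded_denominator_def
      by (intro exI[of _ "r1 + r2"]) (simp add: add_divide_distrib)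
  qed
  show "bounded_denominator d l n (\<lambda>z. f z - g z)" if fg: "bounded_denominator d l n f" "bounded_denominator d l n g"
  proof -
    obtain r1 r2 where "\<forall>z. f z = poly r1 z / (\<Prod>i<n. Dn d l z i)" "\<forall>z. g z = poly r2 z / (\<Prod>i<n. Dn d l z i)"
      using fg unfolding bounded_denominator_def by blast
    then show ?thesis unfolding bounded_denominator_def
      by (intro exI[of _ "r1 - r2"]) (simp add: diff_divide_distrib)
  qed
  assume "bounded_denominator d l n f"
  then obtain r1 where r1: "\<forall>z. f z = poly r1 z / (\<Prod>i<n. Dn d l z i)"
    unfolding bounded_denominator_def by blast
  show "bounded_denominator d l n (\<lambda>z. poly r z * f z)"
    unfolding bounded_denominator_def using r1 by (intro exI[of _ "r * r1"]) simp
  show "bounded_denominator d l (Suc n) (\<lambda>z. 1 / Dn d l z n * f z)"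
    unfolding bounded_denominator_def using r1 by (intro exI[of _ r1]) (simp add: mult.commute)
qed

lemma bounded_denominator_Rm:
  "bounded_denominator d l (a + b) (\<lambda>z. Poly_Mapping.lookup (Rm \<infinity> \<infinity> d l z a b) (i, j))"
proof -
  have var: "bounded_denominator d l n (\<lambda>z. z * f z)" if "bounded_denominator d l n f" for n f
    using bounded_denominator_intros(4)[OF that, of "[:0, 1:]"] by simp
  have const: "bounded_denominator d l n (\<lambda>z. s * f z)" if "bounded_denominator d l n f" for n f s
    using bounded_denominator_intros(4)[OF that, of "[:s:]"] by simp
  note bd = bounded_denominator_intros(1-3) var const
  have A': "bounded_denominator d l n (\<lambda>z. Poly_Mapping.lookup (opA' \<infinity> \<infinity> l z (F z)) (i, j))"
    and B': "bounded_denominator d l n (\<lambda>z. Poly_Mapping.lookup (opB' \<infinity> \<infinity> d z (F z)) (i, j))"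
    if "\<And>i j. bounded_denominator d l n (\<lambda>z. Poly_Mapping.lookup (F z) (i, j))" for n F i j
    unfolding op_defs lookup_raise by (cases i; cases j; auto intro!: bd that)+
  have base: "bounded_denominator d l a (\<lambda>z. Poly_Mapping.lookup (Rm \<infinity> \<infinity> d l z a 0) (i, j))" for i j
  proof (induction a arbitrary: i j)
    case 0
    show ?case unfolding bounded_denominator_def
      by (rule exI[of _ "if i = 0 \<and> j = 0 then 1 else 0"]) (auto simp: lookup_bas)
  next
    case (Suc a)
    show ?case
      unfolding Rm.simps lookup_smul lookup_minus mult.assoc
      by (intro bounded_denominator_intros(5) bounded_denominator_intros(3) var const A' B' Suc)
  qed
  show ?thesis
  proof (induction b arbitrary: i j)
    case 0
    then show ?case using base by simp
  next
    case (Suc b)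
    show ?case
      unfolding Rm.simps lookup_smul lookup_minus mult.assoc add_Suc_right
      by (intro bounded_denominator_intros(5) bounded_denominator_intros(3) var const A' B' Suc)
  qed
qed

lemma Rm_coeff_rational:
  "\<exists>f. rational_in_exp f \<and> (\<forall>x. (\<forall>i<a + b. Dn d l (exp x) i \<noteq> 0) \<longrightarrow>
     f x = Poly_Mapping.lookup (Rm \<infinity> \<infinity> d l (exp x) a b) (i, j))"
proof -
  obtain r where r: "\<And>z. Poly_Mapping.lookup (Rm \<infinity> \<infinity> d l z a b) (i, j) = poly r z / (\<Prod>i<a + b. Dn d l z i)"
    using bounded_denominator_Rm[of d l a b i j] unfolding bounded_denominator_def by blast
  define q where "q = (\<Prod>i<a + b. DnP d l i)"
  have q: "poly q z = (\<Prod>i<a + b. Dn d l z i)" for z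
    by (simp add: q_def poly_prod poly_DnP)
  have "q \<noteq> 0" by (simp add: q_def)
  then obtain f where "rational_in_exp f" "\<And>x. poly q (exp x) \<noteq> 0 \<Longrightarrow> f x = poly r (exp x) / poly q (exp x)"
    using rational_in_exp_reduce[of q r] by blast
  then show ?thesis by (intro exI[of _ f]) (auto simp: q r)
qed

text \<open>The coefficients of \<open>Rm\<close> as functions of \<open>x\<close>, extended to the zeros of the denominators.\<close>

definition rc :: "nat \<Rightarrow> nat \<Rightarrow> nat \<Rightarrow> nat \<Rightarrow> nat \<Rightarrow> nat \<Rightarrow> complex \<Rightarrow> complex" where
  "rc d l a b i j = (SOME f. rational_in_exp f \<and> (\<forall>x. (\<forall>i<a + b. Dn d l (exp x) i \<noteq> 0) \<longrightarrow>
     f x = Poly_Mapping.lookup (Rm \<infinity> \<infinity> d l (exp x) a b) (i, j)))"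

lemma rc_rational: "rational_in_exp (rc d l a b i j)"
  and rc_eq: "(\<forall>i<a + b. Dn d l (exp x) i \<noteq> 0) \<Longrightarrow>
     rc d l a b i j x = Poly_Mapping.lookup (Rm \<infinity> \<infinity> d l (exp x) a b) (i, j)"
  using someI_ex[OF Rm_coeff_rational[of a b d l i j]] unfolding rc_def[symmetric] by blast+

text \<open>
  The matrix coefficients of \<open>Rop\<close> made reduced fractions, which prescribes the values at the zeros
  of the denominators.
\<close>

definition vR :: "nat \<Rightarrow> nat \<Rightarrow> complex \<Rightarrow> (nat \<times> nat) vec \<Rightarrow> (nat \<times> nat) vec" where
  "vR d l x = lin_ext (\<lambda>(a, b). \<Sum>i\<le>a + b. rc d l a b i (a + b - i) x \<cdot> bas (i, a + b - i))"

lemma lin_vR [simp, intro]: "lin (vR d l x)"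
  by (simp add: vR_def)

lemma lookup_vR_bas:
  "Poly_Mapping.lookup (vR d l x (bas (a, b))) (i, j) = (if i + j = a + b then rc d l a b i j x else 0)"
proof -
  have "Poly_Mapping.lookup (vR d l x (bas (a, b))) (i, j) =
     (\<Sum>i'\<le>a + b. if i' = i then (if a + b - i = j then rc d l a b i j x else 0) else 0)"
    unfolding vR_def lin_ext_bas split lookup_sum by (rule sum.cong) (auto simp: lookup_bas)
  also have "\<dots> = (if i \<le> a + b then (if a + b - i = j then rc d l a b i j x else 0) else 0)"
    by (subst sum.delta) auto
  finally show ?thesis by auto
qed

lemma vR_bas:
  assumes "\<forall>i<a + b. Dn d l (exp x) i \<noteq> 0"
  shows "vR d l x (bas (a, b)) = Rm \<infinity> \<infinity> d l (exp x) a b"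
proof (rule poly_mapping_eqI)
  fix s :: "nat \<times> nat"
  obtain i j where s: "s = (i, j)" by (cases s)
  have "i + j \<noteq> a + b \<Longrightarrow> Poly_Mapping.lookup (Rm \<infinity> \<infinity> d l (exp x) a b) (i, j) = 0"
    using Rm_level[of \<infinity> \<infinity> d l "exp x" a b] unfolding level_def coord_space_def
    by (auto simp: in_keys_iff subset_iff)
  then show "Poly_Mapping.lookup (vR d l x (bas (a, b))) s = Poly_Mapping.lookup (Rm \<infinity> \<infinity> d l (exp x) a b) s"
    unfolding s lookup_vR_bas using rc_eq[OF assms] by auto
qed

definition bad :: "nat \<Rightarrow> nat \<Rightarrow> complex set" where
  "bad d l = {x. \<exists>n. Dn d l (exp x) n = 0}"

lemma countable_bad: "countable (bad d l)"
proof -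
  have "bad d l = (\<Union>n. {x. poly (DnP d l n) (exp x) = 0})"
    by (auto simp: bad_def poly_DnP)
  then show ?thesis using countable_poly_exp[OF DnP_nz] by simp
qed

lemma vR_Rop: "x \<notin> bad d l \<Longrightarrow> vR d l x = Rop \<infinity> \<infinity> d l (exp x)"
  by (rule lin_eqI) (auto simp: vR_bas bad_def)

lemma vR_top: "vR d l x (bas (0, 0)) = bas (0, 0)"
  using vR_bas[of 0 0 d l x] by simp

lemma sinh_ec:
  "sinh ((of_nat (Suc i) - 1) * \<eta>) * sinh ((2 * half d + 2 - of_nat (Suc i)) * \<eta>) / (sinh \<eta>)\<^sup>2 = ec d i"
proof -
  have e: "exp (of_nat n * \<eta>) = p ^ n" for n
    by (simp add: p_def exp_of_nat_mult)
  have 1: "sinh ((of_nat (Suc i) - 1) * \<eta>) = (p ^ i - 1 / p ^ i) / 2"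
    using e[of i] by (simp add: sinh_field_def exp_minus inverse_eq_divide)
  have "(2 * half d + 2 - of_nat (Suc i)) * \<eta> = of_nat (Suc d) * \<eta> - of_nat i * \<eta>"
    by (simp add: half_def algebra_simps)
  then have 2: "sinh ((2 * half d + 2 - of_nat (Suc i)) * \<eta>) = (p ^ Suc d / p ^ i - p ^ i / p ^ Suc d) / 2"
    unfolding sinh_field_def by (simp add: exp_diff exp_minus e del: of_nat_Suc power_Suc)
  have 3: "sinh \<eta> = (p - 1 / p) / 2"
    by (simp add: sinh_field_def p_def exp_minus field_simps)
  show ?thesis unfolding 1 2 3 ec_def by (simp add: power_divide power2_eq_square)
qed

lemma eval_verma_gens:
  "eval_verma \<eta> (half d) x (gE N0) (bas i) = exp (- x) \<cdot> bas (Suc i)"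
  "eval_verma \<eta> (half d) x (gF N1) (bas i) = exp x \<cdot> bas (Suc i)"
  "eval_verma \<eta> (half d) x (gE N1) (bas i) = (exp (- x) * ec d i) \<cdot> bas (i - 1)" (is ?third)
  "eval_verma \<eta> (half d) x (gF N0) (bas i) = (exp x * ec d i) \<cdot> bas (i - 1)" (is ?fourth)
  "eval_verma \<eta> (half d) x (gP h) (bas i) = exp ((snd h - fst h) * \<eta> * (of_nat d - 2 * of_nat i)) \<cdot> bas i" (is ?fifth)
proof -
  have "eval_verma \<eta> (half d) x (gP h) (bas i) = ppow \<eta> (2 * (snd h - fst h) * (half d + 1 - of_nat (Suc i))) \<cdot> bas i"
    by (simp add: eval_verma_def phi_def verma_def mvec_def times_alg_def Let_def)
  also have "ppow \<eta> (2 * (snd h - fst h) * (half d + 1 - of_nat (Suc i))) =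
      exp ((snd h - fst h) * \<eta> * (of_nat d - 2 * of_nat i))"
    unfolding ppow_def half_def by (intro arg_cong[where f = exp]) (simp add: field_simps)
  finally show ?fifth .
  have mv: "ec d i \<cdot> mvec i = ec d i \<cdot> bas (i - 1)" for i
    by (cases i) (auto simp: mvec_def)
  have "verma_gen \<eta> (half d) SE (bas i) = ec d i \<cdot> bas (i - 1)"
    using sinh_ec[of i d] mv[of i] by (simp add: Let_def)
  then show ?third ?fourth
    by (simp_all add: eval_verma_def phi_def verma_def times_alg_def del: verma_gen.simps)
qed (simp_all add: eval_verma_def phi_def verma_def mvec_def times_alg_def Let_def)

lemma Kc_exp: "exp (\<eta> * (of_nat d - 2 * of_nat i)) = Kc d i"
proof -
  have "\<eta> * (of_nat d - 2 * of_nat i) = of_nat d * \<eta> - of_nat (i + i) * \<eta>"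
    by (simp add: algebra_simps)
  then show ?thesis
    unfolding Kc_def p_def by (simp only: exp_diff exp_of_nat_mult power_add)
qed

lemma Kc_inv_exp: "exp (- (\<eta> * (of_nat d - 2 * of_nat i))) = 1 / Kc d i"
  unfolding exp_minus Kc_exp by (simp add: inverse_eq_divide)

abbreviation TR where
  "TR d l x y \<equiv> tens_rep (eval_verma \<eta> (half d) x) (eval_verma \<eta> (half l) y)"

lemma lin_alg_rep: "(\<And>g. lin (\<theta> g)) \<Longrightarrow> lin (alg_rep \<theta> t)"
  by (induction t) (auto intro: lin_comp)

lemma lin_TR [simp, intro]: "lin (TR d l x y t)"
  unfolding tens_rep_def by (rule lin_alg_rep) (auto split: sum.splits)

lemma TR_eqI: "lin U \<Longrightarrow> (\<And>a b. TR d l x y t (bas (a, b)) = U (bas (a, b))) \<Longrightarrow> TR d l x y t = U"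
  by (rule lin_eqI) auto

lemmas comult_simps = tens_rep_def comult_op_def comult_def flip_def tens_alg_def left_copy_def
  right_copy_def plus_alg_def times_alg_def one_alg_def lin_smul[OF lin_tens_op]

lemma TR_gE0: "TR d l x y (comult (gE N0)) = (\<lambda>u. exp (- x) \<cdot> opA \<infinity> \<infinity> d (exp (x - y)) u)" (is ?first)
  "TR d l x y (comult_op (gE N0)) = (\<lambda>u. exp (- x) \<cdot> opA' \<infinity> \<infinity> l (exp (x - y)) u)" (is ?second)
proof -
  have z: "exp (- x) * exp (x - y) = exp (- y)" by (simp add: exp_add[symmetric])
  show ?first
    by (rule TR_eqI) (auto simp: comult_simps eval_verma_gens op_defs raise_bas up1_def up2_def
        smul_add Kc_exp mult.assoc[symmetric] z  intro!: lin_scale)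
  show ?second
    by (rule TR_eqI) (auto simp: comult_simps eval_verma_gens op_defs raise_bas up1_def up2_def
        smul_add Kc_exp mult.assoc[symmetric] z add.commute intro!: lin_scale)
qed

lemma TR_gF1: "TR d l x y (comult (gF N1)) = (\<lambda>u. exp y \<cdot> opB \<infinity> \<infinity> l (exp (x - y)) u)" (is ?first)
  "TR d l x y (comult_op (gF N1)) = (\<lambda>u. exp y \<cdot> opB' \<infinity> \<infinity> d (exp (x - y)) u)" (is ?second)
proof -
  have z: "exp y * exp (x - y) = exp x" by (simp add: exp_add[symmetric])
  show ?first
    by (rule TR_eqI) (auto simp: comult_simps eval_verma_gens op_defs raise_bas up1_def up2_def
        smul_add Kc_exp mult.assoc[symmetric] z mult.commute[of "Kc _ _"] intro!: lin_scale)
  show ?second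
    by (rule TR_eqI) (auto simp: comult_simps eval_verma_gens op_defs raise_bas up1_def up2_def
        smul_add Kc_exp mult.assoc[symmetric] z add.commute mult.commute[of "Kc _ _"] intro!: lin_scale)
qed

lemma TR_gE1: "TR d l x y (comult (gE N1)) = (\<lambda>u. exp (- x) \<cdot> opE d l (exp (x - y)) u)" (is ?first)
  "TR d l x y (comult_op (gE N1)) = (\<lambda>u. exp (- x) \<cdot> opE' d l (exp (x - y)) u)" (is ?second)
proof -
  have z: "exp (- x) * exp (x - y) = exp (- y)" by (simp add: exp_add[symmetric])
  show ?first
    by (rule TR_eqI) (auto simp: comult_simps eval_verma_gens op_defs lower_bas
        smul_add Kc_inv_exp mult.assoc[symmetric] z intro!: lin_scale)
  show ?second
    by (rule TR_eqI) (auto simp: comult_simps eval_verma_gens op_defs lower_bas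
        smul_add Kc_inv_exp mult.assoc[symmetric] z add.commute intro!: lin_scale)
qed

lemma TR_gF0: "TR d l x y (comult (gF N0)) = (\<lambda>u. exp y \<cdot> opG d l (exp (x - y)) u)" (is ?first)
  "TR d l x y (comult_op (gF N0)) = (\<lambda>u. exp y \<cdot> opG' d l (exp (x - y)) u)" (is ?second)
proof -
  have z: "exp y * exp (x - y) = exp x" by (simp add: exp_add[symmetric])
  show ?first
    by (rule TR_eqI) (auto simp: comult_simps eval_verma_gens op_defs lower_bas
        smul_add Kc_inv_exp mult.assoc[symmetric] z intro!: lin_scale)
  show ?second
    by (rule TR_eqI) (auto simp: comult_simps eval_verma_gens op_defs lower_bas
        smul_add Kc_inv_exp mult.assoc[symmetric] z add.commute intro!: lin_scale)
qed

lemma TR_gP_bas: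
  "TR d l x y (comult (gP h)) (bas (a, b)) =
     exp ((snd h - fst h) * \<eta> * (of_nat (d + l) - 2 * of_nat (a + b))) \<cdot> bas (a, b)"
  "TR d l x y (comult_op (gP h)) (bas (a, b)) =
     exp ((snd h - fst h) * \<eta> * (of_nat (d + l) - 2 * of_nat (a + b))) \<cdot> bas (a, b)"
  by (simp_all add: comult_simps eval_verma_gens exp_add[symmetric])
    (simp_all add: algebra_simps)

text \<open>
  A generator that acts by a function of the weight is intertwined by every operator that preserves the
  weight.
\<close>

lemma lin_commute_level:
  assumes "lin R" "\<And>a b. R (bas (a, b)) \<in> level (a + b)"
    and "lin T" "\<And>a b. T (bas (a, b)) = f (a + b) \<cdot> bas (a, b)"
    and "lin T'" "\<And>a b. T' (bas (a, b)) = f (a + b) \<cdot> bas (a, b)"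
  shows "R \<circ> T = T' \<circ> R"
proof (rule lin_eqI)
  fix s :: "nat \<times> nat"
  obtain a b where s: "s = (a, b)" by (cases s)
  have "T' u = f n \<cdot> u" if "u \<in> level n" for u n
    by (rule lin_eq_on[of T' "\<lambda>u. f n \<cdot> u" "{(a, b). a + b = n}"])
      (use assms that in \<open>auto simp: level_def intro!: lin_smul_id\<close>)
  from this[OF assms(2)[of a b]] show "(R \<circ> T) (bas s) = (T' \<circ> R) (bas s)"
    by (simp add: s assms(4) lin_smul[OF assms(1)])
qed (use assms in auto)

text \<open>Both sides are multiplicative and additive in the term \<open>t\<close>, so that the generators suffice.\<close>

lemma vR_intertwines:
  assumes "x - y \<notin> bad d l"
  shows "vR d l (x - y) \<circ> TR d l x y (comult t) = TR d l x y (comult_op t) \<circ> vR d l (x - y)"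
proof (induction t)
  case (Gen g)
  have D: "Dn d l (exp (x - y)) n \<noteq> 0" for n
    using assms by (auto simp: bad_def)
  note R = vR_Rop[OF assms]
  show ?case
  proof (cases g)
    case (Egen i)
    then show ?thesis
      by (cases i) (auto simp: R TR_gE0 TR_gE1 fun_eq_iff lin_smul[OF lin_Rop] Rop_opA[OF D] Rop_opE[OF D])
  next
    case (Fgen i)
    then show ?thesis
      by (cases i) (auto simp: R TR_gF0 TR_gF1 fun_eq_iff lin_smul[OF lin_Rop] Rop_opB[OF D] Rop_opG[OF D])
  next
    case (Pgen h)
    show ?thesis
      unfolding R Pgen
      by (rule lin_commute_level[where f = "\<lambda>n. exp ((snd h - fst h) * \<eta> * (of_nat (d + l) - 2 * of_nat n))"])
        (auto simp: TR_gP_bas Rm_level)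
  qed
next
  case (Const c)
  then show ?case
    by (auto simp: comult_simps lin_smul[OF lin_vR])
next
  case (Add s t)
  have "TR d l x y (comult (Add s t)) = (\<lambda>u. TR d l x y (comult s) u + TR d l x y (comult t) u)"
    "TR d l x y (comult_op (Add s t)) = (\<lambda>u. TR d l x y (comult_op s) u + TR d l x y (comult_op t) u)"
    by (auto simp: comult_simps)
  then show ?case using Add by (simp add: fun_eq_iff lin_add[OF lin_vR])
next
  case (Mul s t)
  have "TR d l x y (comult (Mul s t)) = TR d l x y (comult s) \<circ> TR d l x y (comult t)"
    "TR d l x y (comult_op (Mul s t)) = TR d l x y (comult_op s) \<circ> TR d l x y (comult_op t)"
    by (auto simp: comult_simps)
  then show ?case using Mul by (simp add: fun_eq_iff)
qed

lemma vR_rational: "rational_in_exp (\<lambda>x. mcoeff (vR d l x) s t)"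
proof -
  obtain a b i j where st: "s = (a, b)" "t = (i, j)" by (cases s; cases t)
  show ?thesis
    unfolding mcoeff_def st lookup_vR_bas using rc_rational[of d l a b i j]
    by (cases "i + j = a + b") auto
qed

lemma is_verma_R_vR: "is_verma_R \<eta> (half d) (half l) (vR d l)"
  unfolding is_verma_R_def
proof (intro conjI allI)
  show "linear_map UNIV UNIV (vR d l x)" for x
    using lin_vR by (simp add: lin_def)
  show "rational_in_exp (\<lambda>x. mcoeff (vR d l x) s t)" for s t
    by (rule vR_rational)
next
  fix x show "vR d l x (tens (mvec 1) (mvec 1)) = tens (mvec 1) (mvec 1)"
    by (simp add: mvec_def vR_top)
next
  show "\<exists>Z. countable Z \<and> (\<forall>x y. x - y \<notin> Z \<longrightarrow> (\<forall>X\<in>Uhat \<eta>. \<forall>t\<in>X.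
      vR d l (x - y) \<circ> TR d l x y (comult t) = TR d l x y (comult_op t) \<circ> vR d l (x - y)))"
    by (rule exI[of _ "bad d l"]) (auto simp: countable_bad vR_intertwines)
qed

text \<open>
  Cyclicity: at generic arguments every state is reached from the top state by the two raising
  operators \<open>opA\<close> and \<open>opB\<close>, so that a map which intertwines them is determined by its value there.
\<close>

lemma cyclic:
  assumes T: "lin T" and U: "lin U" and top: "T (bas (0, 0)) = U (bas (0, 0))"
    and A: "\<And>a b. enat a \<le> c \<Longrightarrow> enat b \<le> c' \<Longrightarrow> T (bas (a, b)) = U (bas (a, b)) \<Longrightarrow>
      T (opA c c' d z (bas (a, b))) = U (opA c c' d z (bas (a, b)))"
    and B: "\<And>a b. enat a \<le> c \<Longrightarrow> enat b \<le> c' \<Longrightarrow> T (bas (a, b)) = U (bas (a, b)) \<Longrightarrow>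
      T (opB c c' l z (bas (a, b))) = U (opB c c' l z (bas (a, b)))"
    and D: "\<And>a b. enat a \<le> c \<Longrightarrow> enat b \<le> c' \<Longrightarrow> enat a < c \<or> enat b < c' \<Longrightarrow> Dn d l z (a + b) \<noteq> 0"
    and ab: "enat a \<le> c" "enat b \<le> c'"
  shows "T (bas (a, b)) = U (bas (a, b))"
proof -
  have step: "T (up1 c a b) = U (up1 c a b) \<and> T (up2 c' a b) = U (up2 c' a b)"
    if h: "T (bas (a, b)) = U (bas (a, b))" and ab: "enat a \<le> c" "enat b \<le> c'" for a b
  proof (cases "enat a < c \<or> enat b < c'")
    case True
    have D: "Dn d l z (a + b) \<noteq> 0" using D ab True by blast
    have "T (Dn d l z (a + b) \<cdot> up1 c a b) = U (Dn d l z (a + b) \<cdot> up1 c a b)"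
      unfolding raise_left[symmetric, where c' = c'] by (simp add: lin_simps T U A B h ab)
    moreover have "T (Dn d l z (a + b) \<cdot> up2 c' a b) = U (Dn d l z (a + b) \<cdot> up2 c' a b)"
      unfolding raise_right[symmetric, where c = c] by (simp add: lin_simps T U A B h ab)
    ultimately show ?thesis using D by (simp add: lin_smul T U smul_left_cancel)
  next
    case False
    then show ?thesis by (simp add: up1_def up2_def lin_zero T U)
  qed
  have a0: "T (bas (a, 0)) = U (bas (a, 0))" if "enat a \<le> c" for a
    using that
  proof (induction a)
    case (Suc a)
    then have "enat a < c" by (metis Suc_ile_eq)
    then show ?case
      using step[of a 0] Suc by (auto simp: up1_def zero_enat_def[symmetric])
  qed (simp add: top)
  show ?thesis using ab(2)
  proof (induction b)
    case 0
    show ?case by (rule a0[OF ab(1)])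
  next
    case (Suc b)
    then have "enat b < c'" by (metis Suc_ile_eq)
    then show ?case
      using step[of a b] Suc ab(1) by (auto simp: up2_def)
  qed
qed

text \<open>
  The relations for \<open>e\<^sub>0\<close> and \<open>f\<^sub>1\<close> determine the operator by cyclicity off a countable set of arguments, and
  thereby everywhere, since its coefficients are reduced fractions.
\<close>

lemma is_verma_R_unique:
  assumes "is_verma_R \<eta> (half d) (half l) S"
  shows "S = vR d l"
proof -
  have linS: "lin (S x)" for x
    using assms unfolding is_verma_R_def lin_def by blast
  have ratS: "rational_in_exp (\<lambda>x. mcoeff (S x) s t)" for s t
    using assms unfolding is_verma_R_def by blast
  have topS: "S x (bas (0, 0)) = bas (0, 0)" for x
    using assms unfolding is_verma_R_def by (simp add: mvec_def)
  obtain Z where Z: "countable Z" and int: "\<And>x y X t. x - y \<notin> Z \<Longrightarrow> X \<in> Uhat \<eta> \<Longrightarrow> t \<in> X \<Longrightarrow>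
      S (x - y) \<circ> TR d l x y (comult t) = TR d l x y (comult_op t) \<circ> S (x - y)"
    using assms[unfolded is_verma_R_def, THEN conjunct2, THEN conjunct2, THEN conjunct2] by metis
  have int': "S (x - y) (TR d l x y (comult t) u) = TR d l x y (comult_op t) (S (x - y) u)"
    if "x - y \<notin> Z" for x y t u
  proof -
    let ?X = "{(s, t). alg_eq (affine_rels \<eta>) s t} `` {t}"
    have "?X \<in> Uhat \<eta>" unfolding Uhat_def presented_def by (rule quotientI) simp
    moreover have "t \<in> ?X" by (simp add: alg_eq.refl)
    ultimately show ?thesis using int[OF that] by (metis comp_apply)
  qed
  have eq: "S x = vR d l x" if x: "x \<notin> Z \<union> bad d l" for x
  proof (rule lin_eqI)
    have D: "Dn d l (exp x) n \<noteq> 0" for n using x by (auto simp: bad_def)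
    have R: "vR d l x = Rop \<infinity> \<infinity> d l (exp x)" using x by (intro vR_Rop) auto
    have A: "S x (opA \<infinity> \<infinity> d (exp x) u) = opA' \<infinity> \<infinity> l (exp x) (S x u)" for u
      using int'[of x 0 "gE N0" u] x by (simp add: TR_gE0 lin_smul linS smul_left_cancel)
    have B: "S x (opB \<infinity> \<infinity> l (exp x) u) = opB' \<infinity> \<infinity> d (exp x) (S x u)" for u
      using int'[of x 0 "gF N1" u] x by (simp add: TR_gF1 lin_smul linS smul_left_cancel)
    fix s :: "nat \<times> nat"
    obtain a b where s: "s = (a, b)" by (cases s)
    show "S x (bas s) = vR d l x (bas s)"
      unfolding s by (rule cyclic[where c = \<infinity> and c' = \<infinity> and d = d and l = l and z = "exp x"])
        (use D in \<open>auto simp: linS topS vR_top R Rop_opA[OF D] Rop_opB[OF D] A B\<close>)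
  qed (use linS in auto)
  have "S x (bas s) = vR d l x (bas s)" for x s
  proof (rule poly_mapping_eqI)
    fix t
    have "(\<lambda>x. mcoeff (S x) s t) = (\<lambda>x. mcoeff (vR d l x) s t)"
      by (rule rational_in_exp_unique[where Z = "Z \<union> bad d l"])
        (use ratS vR_rational Z countable_bad eq in auto)
    then show "Poly_Mapping.lookup (S x (bas s)) t = Poly_Mapping.lookup (vR d l x (bas s)) t"
      unfolding mcoeff_def by meson
  qed
  then have "S x = vR d l x" for x by (rule lin_eqI[OF linS lin_vR])
  then show ?thesis by (rule ext)
qed

lemma verma_R_eq: "verma_R \<eta> (half d) (half l) = vR d l"
  unfolding verma_R_def using is_verma_R_vR is_verma_R_unique by (rule the_equality)


section \<open>The R-operator on finite-dimensional modules\<close>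

abbreviation pr2 :: "nat \<Rightarrow> nat \<Rightarrow> (nat \<times> nat) vec \<Rightarrow> (nat \<times> nat) vec" where
  "pr2 d l \<equiv> tens_op (pr_V d) (pr_V l)"

lemma pr2_bas: "pr2 d l (bas (a, b)) = (if a \<le> d \<and> b \<le> l then bas (a, b) else 0)"
  by (simp add: pr_V_def)

lemma pr2_VV: "pr2 d l u \<in> VV_space d l"
  unfolding VV_space_def by (rule lin_in_coord_space[of _ UNIV]) (auto simp: pr_V_def)

lemma pr2_id: "u \<in> VV_space d l \<Longrightarrow> pr2 d l u = u"
  unfolding VV_space_def using lin_eq_on[of "pr2 d l" id "{..d} \<times> {..l}" u]
  by (auto simp: pr_V_def)

lemma pr2_raise: "pr2 d l (raise \<infinity> \<infinity> f g u) = raise (enat d) (enat l) f g (pr2 d l u)"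
proof -
  have "pr2 d l \<circ> raise \<infinity> \<infinity> f g = raise (enat d) (enat l) f g \<circ> pr2 d l"
  proof (rule lin_eqI)
    fix s :: "nat \<times> nat"
    obtain a b where s: "s = (a, b)" by (cases s)
    show "(pr2 d l \<circ> raise \<infinity> \<infinity> f g) (bas s) = (raise (enat d) (enat l) f g \<circ> pr2 d l) (bas s)"
      unfolding s by (auto simp: raise_bas up1_def up2_def lin_simps pr2_bas simp del: tens_op_bas)
  qed auto
  then show ?thesis by (metis comp_apply)
qed

lemma pr2_Rm: "pr2 d l (Rm \<infinity> \<infinity> m n z a b) = Rm (enat d) (enat l) m n z a b"
proof -
  have "pr2 d l (Rm c c' m n z a b) = Rm (enat d) (enat l) m n z a b" if "c = \<infinity>" "c' = \<infinity>" for c c'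
    using that
  proof (induction c c' m n z a b rule: Rm.induct)
    case 1
    then show ?case by (simp add: pr2_bas del: tens_op_bas)
  qed (simp_all add: lin_simps op_defs pr2_raise)
  then show ?thesis by simp
qed

text \<open>
  The states with \<open>a > d\<close> arise by raising from \<open>bas (d + 1, 0)\<close>, whose image vanishes in the quotient by
  \<open>Rm_top\<close>.
\<close>

lemma fRm_zero_left:
  assumes "d < a"
  shows "Rm (enat d) (enat l) d l z a b = 0"
proof -
  have "Rm (enat d) (enat l) d l z (Suc d) 0 = 0"
  proof -
    obtain s where "Rm \<infinity> \<infinity> d l z (Suc d) 0 = s \<cdot> bas (Suc d, 0)" using Rm_top by blast
    then have "pr2 d l (Rm \<infinity> \<infinity> d l z (Suc d) 0) = 0"
      by (simp add: lin_smul[OF lin_tens_op] pr2_bas del: tens_op_bas)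
    then show ?thesis unfolding pr2_Rm .
  qed
  moreover have "Rm (enat d) (enat l) d l z (Suc a) 0 = 0" if "Rm (enat d) (enat l) d l z a 0 = 0" for a
    using that by (simp add: lin_zero)
  ultimately have "Rm (enat d) (enat l) d l z a 0 = 0"
    using assms by (induction a) (auto simp: less_Suc_eq simp del: Rm.simps)
  then show ?thesis by (induction b) (simp_all add: lin_zero)
qed

lemma fRm_zero_right: "l < b \<Longrightarrow> Rm (enat d) (enat l) d l z a b = 0"
  using fRm_zero_left[of l b d z a] perm_Rm[of "enat d" "enat l" d l z a b] by (metis perm_perm perm_zero)

abbreviation fA where "fA d l z \<equiv> opA (enat d) (enat l) d z"
abbreviation fB where "fB d l z \<equiv> opB (enat d) (enat l) l z"
abbreviation fA' where "fA' d l z \<equiv> opA' (enat d) (enat l) l z"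
abbreviation fB' where "fB' d l z \<equiv> opB' (enat d) (enat l) d z"
abbreviation fRop where "fRop d l z \<equiv> Rop (enat d) (enat l) d l z"

text \<open>
  The \<open>R\<close>-operator of the finite-dimensional modules at every argument (\<open>fin_R_eq\<close>); for good arguments it is
  given by the recursion (\<open>fS_eq\<close>).
\<close>

definition fS :: "nat \<Rightarrow> nat \<Rightarrow> complex \<Rightarrow> (nat \<times> nat) vec \<Rightarrow> (nat \<times> nat) vec" where
  "fS d l x = pr2 d l \<circ> vR d l x \<circ> pr2 d l"

lemma lin_fS [simp, intro]: "lin (fS d l x)"
  unfolding fS_def by (intro lin_comp) auto

text \<open>None of the denominators that occur above the bottom state \<open>bas (d, l)\<close> vanishes.\<close>

definition good :: "nat \<Rightarrow> nat \<Rightarrow> complex \<Rightarrow> bool" where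
  "good d l x \<longleftrightarrow> (\<forall>n<d + l. Dn d l (exp x) n \<noteq> 0)"

lemma fS_eq:
  assumes "good d l x"
  shows "fS d l x = fRop d l (exp x)"
proof (rule lin_eqI)
  fix s :: "nat \<times> nat"
  obtain a b where s: "s = (a, b)" by (cases s)
  show "fS d l x (bas s) = fRop d l (exp x) (bas s)"
  proof (cases "a \<le> d \<and> b \<le> l")
    case True
    then have "vR d l x (bas (a, b)) = Rm \<infinity> \<infinity> d l (exp x) a b"
      using assms by (intro vR_bas) (auto simp: good_def)
    then show ?thesis using True by (simp add: s fS_def pr2_bas pr2_Rm del: tens_op_bas)
  next
    case False
    then show ?thesis using fRm_zero_left[of d a l "exp x" b] fRm_zero_right[of l b d "exp x" a]
      by (auto simp: s fS_def pr2_bas lin_zero simp del: tens_op_bas)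
  qed
qed auto

lemma pr2_vR:
  assumes "x \<notin> bad d l"
  shows "pr2 d l \<circ> vR d l x = fS d l x"
proof (rule lin_eqI)
  fix s :: "nat \<times> nat"
  obtain a b where s: "s = (a, b)" by (cases s)
  have "good d l x" using assms by (auto simp: good_def bad_def)
  then show "(pr2 d l \<circ> vR d l x) (bas s) = fS d l x (bas s)"
    by (simp add: s fS_eq vR_Rop[OF assms] pr2_Rm del: tens_op_bas)
qed auto

lemma fS_coeff:
  "Poly_Mapping.lookup (fS d l x (bas (a, b))) (i, j) =
    (if a \<le> d \<and> b \<le> l \<and> i \<le> d \<and> j \<le> l \<and> i + j = a + b then rc d l a b i j x else 0)"
proof -
  have "Poly_Mapping.lookup (pr2 d l u) (i, j) = (if i \<le> d \<and> j \<le> l then Poly_Mapping.lookup u (i, j) else 0)" for u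
    by (rule functional_eqI[where \<phi> = "\<lambda>u. Poly_Mapping.lookup (pr2 d l u) (i, j)"])
      (auto simp: lin_add[OF lin_tens_op] lin_smul[OF lin_tens_op] lookup_add lookup_bas pr2_bas
        simp del: tens_op_bas split: if_splits)
  then show ?thesis
    by (auto simp: fS_def pr2_bas lookup_vR_bas lin_zero simp del: tens_op_bas)
qed

lemma fS_rational: "rational_in_exp (\<lambda>x. mcoeff (fS d l x) s t)"
proof -
  obtain a b i j where st: "s = (a, b)" "t = (i, j)" by (cases s; cases t)
  show ?thesis unfolding mcoeff_def st fS_coeff using rc_rational[of d l a b i j]
    by (cases "a \<le> d \<and> b \<le> l \<and> i \<le> d \<and> j \<le> l \<and> i + j = a + b") auto
qed

lemma is_fin_R_fS: "is_fin_R \<eta> d l (fS d l)"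
  unfolding is_fin_R_def verma_R_eq
proof (intro conjI allI)
  show "linear_map UNIV (VV_space d l) (fS d l x)" for x
    by (rule lin_imp_linear_map) (auto simp: fS_def pr2_VV)
  show "fS d l x = fS d l x \<circ> pr2 d l" for x
    by (simp add: fS_def fun_eq_iff pr2_id pr2_VV)
  show "\<exists>Z. countable Z \<and> (\<forall>x. x \<notin> Z \<longrightarrow> pr2 d l \<circ> vR d l x = fS d l x \<circ> pr2 d l)"
    by (rule exI[of _ "bad d l"])
      (auto simp: countable_bad pr2_vR, auto simp: fS_def fun_eq_iff pr2_id pr2_VV)
qed (rule fS_rational)

lemma is_fin_R_unique:
  assumes "is_fin_R \<eta> d l S"
  shows "S = fS d l"
proof -
  have linS: "lin (S x)" for x
    using assms unfolding is_fin_R_def lin_def linear_map_def by blast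
  have prS: "S x = S x \<circ> pr2 d l" for x
    using assms unfolding is_fin_R_def by blast
  have ratS: "rational_in_exp (\<lambda>x. mcoeff (S x) s t)" for s t
    using assms unfolding is_fin_R_def by blast
  obtain Z where Z: "countable Z" "\<And>x. x \<notin> Z \<Longrightarrow> pr2 d l \<circ> vR d l x = S x \<circ> pr2 d l"
    using assms unfolding is_fin_R_def verma_R_eq by blast
  have eq: "S x = fS d l x" if "x \<notin> Z \<union> bad d l" for x
    using Z(2)[of x] prS[of x] pr2_vR[of x d l] that by auto
  have "S x (bas s) = fS d l x (bas s)" for x s
  proof (rule poly_mapping_eqI)
    fix t
    have "(\<lambda>x. mcoeff (S x) s t) = (\<lambda>x. mcoeff (fS d l x) s t)"
      by (rule rational_in_exp_unique[where Z = "Z \<union> bad d l"])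
        (use ratS fS_rational Z countable_bad eq in auto)
    then show "Poly_Mapping.lookup (S x (bas s)) t = Poly_Mapping.lookup (fS d l x (bas s)) t"
      unfolding mcoeff_def by meson
  qed
  then have "S x = fS d l x" for x by (rule lin_eqI[OF linS lin_fS])
  then show ?thesis by (rule ext)
qed

lemma fin_R_eq: "fin_R \<eta> d l = fS d l"
  unfolding fin_R_def using is_fin_R_fS is_fin_R_unique by (rule the_equality)

text \<open>The condition \<open>good\<close> in terms of \<open>z = exp x\<close>.\<close>

definition goodz :: "nat \<Rightarrow> nat \<Rightarrow> complex \<Rightarrow> bool" where
  "goodz d l z \<longleftrightarrow> (\<forall>n<d + l. Dn d l z n \<noteq> 0)"

lemma pr2_lower: "pr2 d l (lower d l f g u) = lower d l f g (pr2 d l u)"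
proof -
  have "pr2 d l \<circ> lower d l f g = lower d l f g \<circ> pr2 d l"
  proof (rule lin_eqI)
    fix s :: "nat \<times> nat"
    obtain a b where s: "s = (a, b)" by (cases s)
    have "a = Suc d \<or> (a - 1 \<le> d \<longleftrightarrow> a \<le> d)" "b = Suc l \<or> (b - 1 \<le> l \<longleftrightarrow> b \<le> l)" by auto
    then show "(pr2 d l \<circ> lower d l f g) (bas s) = (lower d l f g \<circ> pr2 d l) (bas s)"
      unfolding s by (auto simp: lower_bas lin_simps pr2_bas simp del: tens_op_bas)
  qed auto
  then show ?thesis by (metis comp_apply)
qed

lemma fRm_VV: "Rm (enat d) (enat l) d l z a b \<in> VV_space d l"
  by (metis pr2_Rm pr2_VV)

lemma pr2_Rop: "pr2 d l (Rop \<infinity> \<infinity> d l z u) = fRop d l z u"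
proof -
  have "pr2 d l \<circ> Rop \<infinity> \<infinity> d l z = fRop d l z"
    by (rule lin_eqI) (auto simp: pr2_Rm)
  then show ?thesis by (metis comp_apply)
qed

lemma fRop_outside: "\<not> (a \<le> d \<and> b \<le> l) \<Longrightarrow> fRop d l z (bas (a, b)) = 0"
  using fRm_zero_left[of d a l z b] fRm_zero_right[of l b d z a] by auto

text \<open>At the bottom state \<open>bas (d, l)\<close> the denominator is not controlled, but there both sides vanish.\<close>

lemma fRop_raise_bas:
  assumes "goodz d l z"
  shows "fRop d l z (fA d l z (bas (a, b))) = fA' d l z (Rm (enat d) (enat l) d l z a b)" (is ?first)
    and "fRop d l z (fB d l z (bas (a, b))) = fB' d l z (Rm (enat d) (enat l) d l z a b)" (is ?second)
proof -
  consider (inside) "a \<le> d" "b \<le> l" "a + b < d + l" | (bottom) "a = d" "b = l" | (outside) "\<not> (a \<le> d \<and> b \<le> l)"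
    by linarith
  then have "?first \<and> ?second"
  proof cases
    case inside
    then have "Dn d l z (a + b) \<noteq> 0" using assms by (simp add: goodz_def)
    then show ?thesis
      using Rop_opA_opB_bas[of d l z a b "enat d" "enat l"] fRm_zero_left[of d "Suc a" l z b]
        fRm_zero_right[of l "Suc b" d z a] by simp
  next
    case bottom
    have "Rm (enat d) (enat l) d l z d l \<in> coord_space {(d, l)}"
      using Rm_level[of "enat d" "enat l" d l z d l] fRm_VV[of d l z d l]
      unfolding level_def VV_space_def coord_space_def by force
    then have "raise (enat d) (enat l) f g (Rm (enat d) (enat l) d l z d l) = 0" for f g
      using lin_eq_on[of "raise (enat d) (enat l) f g" "\<lambda>_. 0" "{(d, l)}"]
      by (auto intro!: linI simp: raise_bas up1_def up2_def)
    then show ?thesis using bottom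
      by (simp add: op_defs raise_bas up1_def up2_def lin_zero del: Rm.simps)
  next
    case outside
    have "\<not> (Suc a \<le> d \<and> b \<le> l)" "\<not> (a \<le> d \<and> Suc b \<le> l)" using outside by auto
    then have 1: "fRop d l z (bas (Suc a, b)) = 0" "fRop d l z (bas (a, Suc b)) = 0"
      "fRop d l z (bas (a, b)) = 0"
      using outside fRop_outside by blast+
    then have "Rm (enat d) (enat l) d l z a b = 0" by simp
    then show ?thesis
      using 1 by (simp add: op_defs raise_bas up1_def up2_def lin_simps del: Rop_bas)
  qed
  then show ?first
    and ?second
    by auto
qed

lemma fRop_fA: "goodz d l z \<Longrightarrow> fRop d l z (fA d l z u) = fA' d l z (fRop d l z u)"
  using lin_eqI[of "fRop d l z \<circ> fA d l z" "fA' d l z \<circ> fRop d l z"] fRop_raise_bas(1)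
  by (force simp: fun_eq_iff)

lemma fRop_fB: "goodz d l z \<Longrightarrow> fRop d l z (fB d l z u) = fB' d l z (fRop d l z u)"
  using lin_eqI[of "fRop d l z \<circ> fB d l z" "fB' d l z \<circ> fRop d l z"] fRop_raise_bas(2)
  by (force simp: fun_eq_iff)

text \<open>Projected from the Verma modules; lowering commutes with the projection as \<open>ec d (d + 1) = 0\<close>.\<close>

lemma fRop_lower_bas:
  assumes "goodz d l z"
  shows "fRop d l z (opE d l z (bas (a, b))) = opE' d l z (Rm (enat d) (enat l) d l z a b)" (is ?first)
    and "fRop d l z (opG d l z (bas (a, b))) = opG' d l z (Rm (enat d) (enat l) d l z a b)" (is ?second)
proof -
  have "?first \<and> ?second"
  proof (cases "a \<le> d \<and> b \<le> l")
    case True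
    then have D: "\<forall>n<a + b. Dn d l z n \<noteq> 0" using assms by (simp add: goodz_def)
    show ?thesis
      unfolding pr2_Rop[symmetric] Rop_opE_bas[OF D] Rop_opG_bas[OF D]
      unfolding pr2_Rm[symmetric] by (simp add: opE'_def opG'_def pr2_lower)
  next
    case False
    have "fRop d l z u = fRop d l z (pr2 d l u)" for u
    proof -
      have "fRop d l z = fRop d l z \<circ> pr2 d l"
      proof (rule lin_eqI)
        fix s :: "nat \<times> nat"
        obtain a b where s: "s = (a, b)" by (cases s)
        show "fRop d l z (bas s) = (fRop d l z \<circ> pr2 d l) (bas s)"
          unfolding s using fRop_outside[of a d b l z] by (auto simp: pr2_bas lin_zero simp del: tens_op_bas)
      qed auto
      then show ?thesis by (metis comp_apply)
    qed
    note pr = this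
    have "Rm (enat d) (enat l) d l z a b = 0" using fRop_outside[OF False, of z] by simp
    moreover have "pr2 d l (bas (a, b)) = 0" unfolding pr2_bas using False by auto
    ultimately show ?thesis
      unfolding pr[of "opE _ _ _ _"] pr[of "opG _ _ _ _"] by (simp add: opE_def opG_def pr2_lower lin_zero)
  qed
  then show ?first
    and ?second
    by auto
qed

lemma fRop_opE: "goodz d l z \<Longrightarrow> fRop d l z (opE d l z u) = opE' d l z (fRop d l z u)"
  using lin_eqI[of "fRop d l z \<circ> opE d l z" "opE' d l z \<circ> fRop d l z"] fRop_lower_bas(1)
  by (force simp: fun_eq_iff)

lemma fRop_opG: "goodz d l z \<Longrightarrow> fRop d l z (opG d l z u) = opG' d l z (fRop d l z u)"
  using lin_eqI[of "fRop d l z \<circ> opG d l z" "opG' d l z \<circ> fRop d l z"] fRop_lower_bas(2)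
  by (force simp: fun_eq_iff)

text \<open>Cyclicity of the finite-dimensional tensor product.\<close>

lemma fcyclic:
  assumes "lin T" "lin U" "T (bas (0, 0)) = U (bas (0, 0))"
    and "\<And>a b. a \<le> d \<Longrightarrow> b \<le> l \<Longrightarrow> T (bas (a, b)) = U (bas (a, b)) \<Longrightarrow>
      T (fA d l z (bas (a, b))) = U (fA d l z (bas (a, b)))"
    and "\<And>a b. a \<le> d \<Longrightarrow> b \<le> l \<Longrightarrow> T (bas (a, b)) = U (bas (a, b)) \<Longrightarrow>
      T (fB d l z (bas (a, b))) = U (fB d l z (bas (a, b)))"
    and "goodz d l z" "u \<in> VV_space d l"
  shows "T u = U u"
proof (rule lin_eq_on[where C = "{..d} \<times> {..l}"])
  show "u \<in> coord_space ({..d} \<times> {..l})" using assms(7) by (simp add: VV_space_def)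
  fix s :: "nat \<times> nat" assume "s \<in> {..d} \<times> {..l}"
  then obtain a b where s: "s = (a, b)" "a \<le> d" "b \<le> l" by auto
  show "T (bas s) = U (bas s)"
    unfolding s(1)
    by (rule cyclic[where c = "enat d" and c' = "enat l" and d = d and l = l and z = z])
      (use assms s in \<open>auto simp: goodz_def\<close>)
qed (use assms in auto)

text \<open>
  Inverting \<open>z\<close> exchanges the coproduct of \<open>e\<^sub>0\<close> with the opposite coproduct of \<open>f\<^sub>1\<close> and vice versa, up to
  a scalar.
\<close>

lemma op_inverse:
  assumes "z \<noteq> 0"
  shows "fA' d l z u = z \<cdot> fB d l (1 / z) u" "fB' d l z u = z \<cdot> fA d l (1 / z) u"
proof -
  have sc: "raise c c' f g u = z \<cdot> raise c c' f' g' u"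
    if "\<And>a b. f a b = z * f' a b" "\<And>a b. g a b = z * g' a b" for c c' f g f' g'
  proof -
    have "raise c c' f g = (\<lambda>u. z \<cdot> raise c c' f' g' u)"
      by (rule lin_eqI) (auto simp: raise_bas that smul_add intro!: lin_scale)
    then show ?thesis by meson
  qed
  show "fA' d l z u = z \<cdot> fB d l (1 / z) u" "fB' d l z u = z \<cdot> fA d l (1 / z) u"
    unfolding op_defs by (rule sc; use assms in simp)+
qed

text \<open>
  Unitarity: by \<open>op_inverse\<close> the operator at \<open>1 / z\<close> intertwines back what the operator at \<open>z\<close>
  intertwined, so that their composition commutes with both raising operators and fixes the top state.
\<close>

lemma fRop_inverse:
  assumes "goodz d l z" "goodz d l (1 / z)" "z \<noteq> 0" "u \<in> VV_space d l"
  shows "fRop d l (1 / z) (fRop d l z u) = u"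
proof -
  have A: "fRop d l (1 / z) (fA' d l z v) = fA d l z (fRop d l (1 / z) v)"
    and B: "fRop d l (1 / z) (fB' d l z v) = fB d l z (fRop d l (1 / z) v)" for v
    using op_inverse[of "1 / z" d l] assms(3)
    by (simp_all add: op_inverse[OF assms(3)] lin_smul fRop_fA[OF assms(2)] fRop_fB[OF assms(2)])
  have "(fRop d l (1 / z) \<circ> fRop d l z) u = id u"
    by (rule fcyclic[OF _ _ _ _ _ assms(1,4)])
      (auto simp: fRop_fA[OF assms(1)] fRop_fB[OF assms(1)] A B)
  then show ?thesis by simp
qed

lemma perm_fS: "good d l x \<Longrightarrow> perm (fS l d x (perm u)) = fS d l x u"
proof -
  assume g: "good d l x"
  then have "good l d x" by (simp add: good_def Dn_commute[of l d] add.commute)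
  then show ?thesis using g by (simp add: fS_eq perm_Rop)
qed

lemma fin_R21_eq: "fin_R21 \<eta> l d x = fin_R \<eta> d l x" if "good d l x"
  using perm_fS[OF that] by (simp add: fin_R21_def fin_R_eq fun_eq_iff)


section \<open>The L-operator\<close>

definition La where "La l z n = p ^ n * (1 - z\<^sup>2 * p * Kc l n)"
definition Lb where "Lb l z n = z * (p ^ l / p ^ n) * (1 - p\<^sup>2) * ec l n"
definition Lc where "Lc z n = z * p ^ n * (1 - p\<^sup>2)"
definition Ld where "Ld l z n = p ^ l / p ^ n * (1 - z\<^sup>2 * p / Kc l n)"

text \<open>The numerator of the \<open>R\<close>-operator whose first factor is the two-dimensional module.\<close>

definition Lop :: "nat \<Rightarrow> complex \<Rightarrow> (nat \<times> nat) vec \<Rightarrow> (nat \<times> nat) vec" where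
  "Lop l z = lin_ext (\<lambda>(a, n).
     if n \<le> l \<and> a = 0 then La l z n \<cdot> bas (0, n) + Lb l z n \<cdot> bas (1, n - 1)
     else if n \<le> l \<and> a = 1 then (if n < l then Lc z n \<cdot> bas (0, Suc n) else 0) + Ld l z n \<cdot> bas (1, n)
     else 0)"

lemma lin_Lop [simp, intro]: "lin (Lop l z)"
  by (simp add: Lop_def)

lemma Lop_0: "n \<le> l \<Longrightarrow> Lop l z (bas (0, n)) = La l z n \<cdot> bas (0, n) + Lb l z n \<cdot> bas (Suc 0, n - 1)"
  and Lop_1: "n \<le> l \<Longrightarrow> Lop l z (bas (Suc 0, n)) =
    (if n < l then Lc z n \<cdot> bas (0, Suc n) else 0) + Ld l z n \<cdot> bas (Suc 0, n)"
  by (auto simp: Lop_def)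

lemma Lb_0 [simp]: "Lb l z 0 = 0"
  by (simp add: Lb_def)

text \<open>
  The four identities that express that \<open>Lop\<close> intertwines the raising operators on the states with \<open>a = 0\<close>:
  the first two for raising the second factor, the other two for raising the first.
\<close>

lemma L_rel1: "Lc z n + z * p * La l z (Suc n) = z * La l z n"
  by (simp add: Lc_def La_def Kc_Suc power2_eq_square field_simps)

lemma L_rel2: "z * Kc l n * Lc z n + La l z (Suc n) = p * La l z n"
  by (simp add: Lc_def La_def Kc_Suc power2_eq_square field_simps)

lemma L_rel3: "Ld l z n + z * p * Lb l z (Suc n) = La l z n * Kc l n + z * Lb l z n"
proof -
  have e: "ec l (Suc n) = ec l n + (Kc l n - 1 / Kc l n) / (p - 1 / p)"
    using ec_diff[of l n] by (simp add: algebra_simps)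
  have q: "(1 - p\<^sup>2) / (p - 1 / p) = - p"
    using pp_neq_1 by (simp add: field_simps power2_eq_square)
  have "z * p * Lb l z (Suc n) = z * Lb l z n + z\<^sup>2 * (p ^ l / p ^ n) * (Kc l n - 1 / Kc l n) * ((1 - p\<^sup>2) / (p - 1 / p))"
  proof -
    have "z * p * (z * (P / (p * N)) * c * (E + G / r)) = z * (z * (P / N) * c * E) + z\<^sup>2 * (P / N) * G * (c / r)"
      for P N E G r c :: complex
      by (simp add: semiring_class.distrib_left power2_eq_square) (simp add: mult_ac)
    then show ?thesis unfolding Lb_def e power_Suc .
  qed
  then have h: "z * p * Lb l z (Suc n) = z * Lb l z n + z\<^sup>2 * (p ^ l / p ^ n) * (Kc l n - 1 / Kc l n) * (- p)"
    unfolding q .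
  have pl: "p ^ l / p ^ n = p ^ n * Kc l n" by (simp add: Kc_def)
  show ?thesis
    unfolding h Ld_def La_def pl by (simp add: field_simps power2_eq_square)
qed

lemma L_rel4: "z * Kc l n * Ld l z n + Lb l z (Suc n) = z * La l z n + Lb l z n / p"
proof -
  have e: "ec l (Suc n) = ec l n + (Kc l n - 1 / Kc l n) / (p - 1 / p)"
    using ec_diff[of l n] by (simp add: algebra_simps)
  have q: "(1 - p\<^sup>2) / (p - 1 / p) = - p"
    using pp_neq_1 by (simp add: field_simps power2_eq_square)
  have "Lb l z (Suc n) = Lb l z n / p + z / p * (p ^ l / p ^ n) * (Kc l n - 1 / Kc l n) * ((1 - p\<^sup>2) / (p - 1 / p))"
  proof -
    have "z * (P / (p * N)) * c * (E + G / r) = z * (P / N) * c * E / p + z / p * (P / N) * G * (c / r)"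
      for P N E G r c :: complex
      by (simp add: semiring_class.distrib_left) (simp add: mult_ac)
    then show ?thesis unfolding Lb_def e power_Suc .
  qed
  then have h: "Lb l z (Suc n) = Lb l z n / p + z / p * (p ^ l / p ^ n) * (Kc l n - 1 / Kc l n) * (- p)"
    unfolding q .
  have pl: "p ^ l / p ^ n = p ^ n * Kc l n" by (simp add: Kc_def)
  show ?thesis
    unfolding h Ld_def La_def pl by (simp add: field_simps power2_eq_square)
qed

lemma Lop_raise:
  assumes "a \<le> 1" "n \<le> l"
  shows "Lop l z (fA 1 l z (bas (a, n))) = fA' 1 l z (Lop l z (bas (a, n)))" (is ?first)
    and "Lop l z (fB 1 l z (bas (a, n))) = fB' 1 l z (Lop l z (bas (a, n)))" (is ?second)
proof -
  have K1: "Kc 1 0 = p" "Kc 1 (Suc 0) = 1 / p" "Kc (Suc 0) (Suc 0) = 1 / p" by (simp_all add: Kc_def)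
  \<comment> \<open>For \<open>n = l\<close> the second factor cannot be raised, and the terms with \<open>Lb l z (Suc l) = 0\<close> drop out.\<close>
  have edge: "Ld l z l = La l z l * Kc l l + z * Lb l z l" "z * Kc l l * Ld l z l = z * La l z l + Lb l z l / p"
    using L_rel3[of l z l] L_rel4[of z l l] by (simp_all add: Lb_def)
  have low: "raise (enat (Suc 0)) (enat l) f g (Lb l z n \<cdot> bas (Suc 0, n - Suc 0)) = (Lb l z n * g (Suc 0) (n - 1)) \<cdot> bas (Suc 0, n)" for f g
    using assms by (cases n) (simp_all add: lin_simps raise_bas up1_def up2_def)
  have "?first \<and> ?second"
  proof (cases a)
    case 0
    let ?X = "if n < l then bas (0, Suc n) else 0" and ?Y = "bas (Suc 0, n)"
    have A: "Lop l z (fA 1 l z (bas (0, n))) = (Lc z n + z * p * La l z (Suc n)) \<cdot> ?X +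
        (Ld l z n + (if n < l then z * p * Lb l z (Suc n) else 0)) \<cdot> ?Y"
      using assms by (simp add: opA_def raise_bas up1_def up2_def lin_simps Lop_0 Lop_1 K1 add_smul smul_add zero_enat_def)
    have A': "fA' 1 l z (Lop l z (bas (0, n))) = (z * La l z n) \<cdot> ?X + (La l z n * Kc l n + z * Lb l z n) \<cdot> ?Y"
      unfolding Lop_0[OF assms(2)] opA'_def lin_add[OF lin_raise] One_nat_def low
      by (simp add: raise_bas up1_def up2_def lin_simps K1 add_smul smul_add zero_enat_def mult_ac)
    have B: "Lop l z (fB 1 l z (bas (0, n))) = (z * Kc l n * Lc z n + La l z (Suc n)) \<cdot> ?X +
        (z * Kc l n * Ld l z n + (if n < l then Lb l z (Suc n) else 0)) \<cdot> ?Y"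
      using assms by (simp add: opB_def raise_bas up1_def up2_def lin_simps Lop_0 Lop_1 K1 add_smul smul_add zero_enat_def)
    have B': "fB' 1 l z (Lop l z (bas (0, n))) = (p * La l z n) \<cdot> ?X + (z * La l z n + Lb l z n / p) \<cdot> ?Y"
      unfolding Lop_0[OF assms(2)] opB'_def lin_add[OF lin_raise] One_nat_def low
      by (simp add: raise_bas up1_def up2_def lin_simps K1 add_smul smul_add zero_enat_def mult_ac)
    have "Ld l z n + (if n < l then z * p * Lb l z (Suc n) else 0) = La l z n * Kc l n + z * Lb l z n"
      "z * Kc l n * Ld l z n + (if n < l then Lb l z (Suc n) else 0) = z * La l z n + Lb l z n / p"
      using L_rel3[of l z n] L_rel4[of z l n] edge assms by (cases "n = l"; simp)+
    then show ?thesis unfolding 0 A A' B B' L_rel1 L_rel2 by simp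
  next
    case (Suc m)
    then have a: "a = Suc 0" using assms by simp
    have r: "Lc z (Suc n) = p * Lc z n" "Ld l z (Suc n) = z * Lc z n + Ld l z n / p"
      "Kc l (Suc n) * Lc z n + z * Ld l z n = z / p * (z * Lc z n + Ld l z n / p)"
      by (simp_all add: Lc_def Ld_def Kc_def field_simps power2_eq_square)
    show ?thesis
    proof (cases "n < l")
      case True
      let ?X = "if Suc n < l then bas (0, Suc (Suc n)) else 0" and ?Y = "bas (Suc 0, Suc n)"
      have A: "Lop l z (fA 1 l z (bas (a, n))) = (z / p * Lc z (Suc n)) \<cdot> ?X + (z / p * Ld l z (Suc n)) \<cdot> ?Y"
        using True by (simp add: a opA_def raise_bas up1_def up2_def lin_simps Lop_1 K1 smul_add one_enat_def)
      have A': "fA' 1 l z (Lop l z (bas (a, n))) = (z * Lc z n) \<cdot> ?X + (Kc l (Suc n) * Lc z n + z * Ld l z n) \<cdot> ?Y"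
        using True by (simp add: a opA'_def raise_bas up1_def up2_def lin_simps Lop_1 K1 smul_add add_smul
            one_enat_def zero_enat_def mult_ac)
      have B: "Lop l z (fB 1 l z (bas (a, n))) = Lc z (Suc n) \<cdot> ?X + Ld l z (Suc n) \<cdot> ?Y"
        using True by (simp add: a opB_def raise_bas up1_def up2_def lin_simps Lop_1 K1 smul_add one_enat_def)
      have B': "fB' 1 l z (Lop l z (bas (a, n))) = (p * Lc z n) \<cdot> ?X + (z * Lc z n + Ld l z n / p) \<cdot> ?Y"
        using True by (simp add: a opB'_def raise_bas up1_def up2_def lin_simps Lop_1 K1 smul_add add_smul
            one_enat_def zero_enat_def mult_ac)
      show ?thesis unfolding A A' B B' r by simp
    next
      case False
      then show ?thesis using assms
        by (simp add: a op_defs raise_bas up1_def up2_def lin_simps Lop_1 K1 one_enat_def)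
    qed
  qed
  then show ?first
    "Lop l z (fB 1 l z (bas (a, n))) = fB' 1 l z (Lop l z (bas (a, n)))"
    by auto
qed

text \<open>By cyclicity, it suffices that \<open>Lop\<close> intertwines the two raising operators.\<close>

lemma fRop_Lop:
  assumes "goodz 1 l z"
  shows "fRop 1 l z = (\<lambda>u. (1 / Dn 1 l z 0) \<cdot> Lop l z u)"
proof (rule lin_eqI)
  have D: "Dn 1 l z 0 \<noteq> 0" using assms by (simp add: goodz_def)
  have La0: "La l z 0 = Dn 1 l z 0" by (simp add: La_def Dn_def Kc_def power2_eq_square)
  fix s :: "nat \<times> nat"
  obtain a b where s: "s = (a, b)" by (cases s)
  show "fRop 1 l z (bas s) = (1 / Dn 1 l z 0) \<cdot> Lop l z (bas s)"
  proof (cases "a \<le> 1 \<and> b \<le> l")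
    case True
    then have "bas s \<in> VV_space 1 l" by (simp add: s VV_space_def)
    then show ?thesis
    proof (rule fcyclic[where u = "bas s" and d = 1 and l = l and z = z, rotated -1])
      show "fRop 1 l z (bas (0, 0)) = (1 / Dn 1 l z 0) \<cdot> Lop l z (bas (0, 0))"
        using D by (simp add: Lop_0 La0)
    next
      fix a b assume ab: "a \<le> 1" "b \<le> l" and eq: "fRop 1 l z (bas (a, b)) = (1 / Dn 1 l z 0) \<cdot> Lop l z (bas (a, b))"
      show "fRop 1 l z (fA 1 l z (bas (a, b))) = (1 / Dn 1 l z 0) \<cdot> Lop l z (fA 1 l z (bas (a, b)))"
        unfolding fRop_fA[OF assms] Lop_raise[OF ab] eq by (simp add: lin_smul)
      show "fRop 1 l z (fB 1 l z (bas (a, b))) = (1 / Dn 1 l z 0) \<cdot> Lop l z (fB 1 l z (bas (a, b)))"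
        unfolding fRop_fB[OF assms] Lop_raise[OF ab] eq by (simp add: lin_smul)
    qed (use assms in \<open>auto intro!: lin_scale\<close>)
  next
    case False
    moreover have "Lop l z (bas s) = 0" using False by (auto simp: s Lop_def)
    ultimately show ?thesis using fRop_outside[of a 1 b l z] by (simp add: s del: Rop_bas)
  qed
qed (auto intro!: lin_scale)

end


section \<open>Operators on three factors\<close>

definition lift12 :: "((nat \<times> nat) vec \<Rightarrow> (nat \<times> nat) vec) \<Rightarrow> (nat \<times> nat \<times> nat) vec \<Rightarrow> (nat \<times> nat \<times> nat) vec" where
  "lift12 = act (\<lambda>(a, b, c). (a, b)) (\<lambda>(i, j) (a, b, c). (i, j, c))"
definition lift13 :: "((nat \<times> nat) vec \<Rightarrow> (nat \<times> nat) vec) \<Rightarrow> (nat \<times> nat \<times> nat) vec \<Rightarrow> (nat \<times> nat \<times> nat) vec" where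
  "lift13 = act (\<lambda>(a, b, c). (a, c)) (\<lambda>(i, j) (a, b, c). (i, b, j))"
definition lift23 :: "((nat \<times> nat) vec \<Rightarrow> (nat \<times> nat) vec) \<Rightarrow> (nat \<times> nat \<times> nat) vec \<Rightarrow> (nat \<times> nat \<times> nat) vec" where
  "lift23 = act (\<lambda>(a, b, c). (b, c)) (\<lambda>(i, j) (a, b, c). (a, i, j))"

lemma lin_lift [simp, intro]: "lin (lift12 T)" "lin (lift13 T)" "lin (lift23 T)"
  by (simp_all add: lift12_def lift13_def lift23_def)

lemma lift_bas:
  "lift12 T (bas (a, b, c)) = lin_ext (\<lambda>(i, j). bas (i, j, c)) (T (bas (a, b)))"
  "lift13 T (bas (a, b, c)) = lin_ext (\<lambda>(i, j). bas (i, b, j)) (T (bas (a, c)))"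
  "lift23 T (bas (a, b, c)) = lin_ext (\<lambda>(i, j). bas (a, i, j)) (T (bas (b, c)))"
  by (simp_all add: lift12_def lift13_def lift23_def act_bas split_def)

lemma lift_scale:
  "lift12 (\<lambda>u. s \<cdot> T u) = (\<lambda>u. s \<cdot> lift12 T u)" "lift13 (\<lambda>u. s \<cdot> T u) = (\<lambda>u. s \<cdot> lift13 T u)"
  "lift23 (\<lambda>u. s \<cdot> T u) = (\<lambda>u. s \<cdot> lift23 T u)"
  by (simp_all add: lift12_def lift13_def lift23_def act_scale)

definition pre :: "nat \<Rightarrow> (nat \<times> nat) vec \<Rightarrow> (nat \<times> nat \<times> nat) vec" where
  "pre a = lin_ext (\<lambda>(b, c). bas (a, b, c))"

lemma lin_pre [simp, intro]: "lin (pre a)"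
  by (simp add: pre_def)

lemma pre_bas [simp]: "pre a (bas (b, c)) = bas (a, b, c)"
  by (simp add: pre_def)

lemma lift23_pre: "lin S \<Longrightarrow> lift23 S (pre a u) = pre a (S u)"
proof -
  assume "lin S"
  then have "lift23 S \<circ> pre a = pre a \<circ> S"
    by (intro lin_eqI) (auto simp: lift_bas pre_def)
  then show ?thesis by (metis comp_apply)
qed

lemma lift_comp:
  assumes "lin S"
  shows "lift12 (S \<circ> T) = lift12 S \<circ> lift12 T" "lift13 (S \<circ> T) = lift13 S \<circ> lift13 T"
    "lift23 (S \<circ> T) = lift23 S \<circ> lift23 T"
  unfolding lift12_def lift13_def lift23_def by (rule act_comp[symmetric, OF assms]; auto)+

definition leg1 where "leg1 = act (\<lambda>(a, b, c). a) (\<lambda>i (a, b, c). (i, b, c))"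
definition leg2 where "leg2 = act (\<lambda>(a, b, c). b) (\<lambda>i (a, b, c). (a, i, c))"
definition leg3 where "leg3 = act (\<lambda>(a, b, c). c) (\<lambda>i (a, b, c). (a, b, i))"

text \<open>Which of the other factors a one-factor operator was combined with is immaterial.\<close>

lemma lift_op:
  "lift12 (op1 T) = leg1 T" "lift13 (op1 T) = leg1 T" "lift12 (op2 T) = leg2 T"
  "lift23 (op1 T) = leg2 T" "lift13 (op2 T) = leg3 T" "lift23 (op2 T) = leg3 T"
  unfolding lift12_def lift13_def lift23_def leg1_def leg2_def leg3_def
  by (rule lin_eqI; auto simp: act_bas op1_act op2_act lin_ext_compose)+

lemma leg_lift_commute:
  "lift23 S (leg1 T u) = leg1 T (lift23 S u)" "lift13 S (leg2 T u) = leg2 T (lift13 S u)"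
  "lift12 S (leg3 T u) = leg3 T (lift12 S u)"
proof -
  have "lift23 S \<circ> leg1 T = leg1 T \<circ> lift23 S" "lift13 S \<circ> leg2 T = leg2 T \<circ> lift13 S"
    "lift12 S \<circ> leg3 T = leg3 T \<circ> lift12 S"
    unfolding lift12_def lift13_def lift23_def leg1_def leg2_def leg3_def
    by (rule act_commute; auto)+
  then show "lift23 S (leg1 T u) = leg1 T (lift23 S u)" "lift13 S (leg2 T u) = leg2 T (lift13 S u)"
    "lift12 S (leg3 T u) = leg3 T (lift12 S u)"
    by (metis comp_apply)+
qed

definition swap23 :: "(nat \<times> nat \<times> nat) vec \<Rightarrow> (nat \<times> nat \<times> nat) vec" where
  "swap23 = lin_ext (\<lambda>(a, b, c). bas (a, c, b))"

lemma swap23_swap23 [simp]: "swap23 (swap23 u) = u"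
proof -
  have "swap23 \<circ> swap23 = id" by (rule lin_eqI) (auto simp: swap23_def)
  then show ?thesis by (metis comp_apply id_apply)
qed

lemma swap23_lift:
  "swap23 (lift12 T u) = lift13 T (swap23 u)" "swap23 (lift13 T u) = lift12 T (swap23 u)"
  "swap23 (lift23 T u) = lift23 (perm \<circ> T \<circ> perm) (swap23 u)"
proof -
  have "swap23 \<circ> lift12 T = lift13 T \<circ> swap23" "swap23 \<circ> lift13 T = lift12 T \<circ> swap23"
    "swap23 \<circ> lift23 T = lift23 (perm \<circ> T \<circ> perm) \<circ> swap23"
    by (rule lin_eqI; auto simp: swap23_def lift_bas lin_ext_compose perm_def split_def)+
  then show "swap23 (lift12 T u) = lift13 T (swap23 u)" "swap23 (lift13 T u) = lift12 T (swap23 u)"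
    "swap23 (lift23 T u) = lift23 (perm \<circ> T \<circ> perm) (swap23 u)"
    by (metis comp_apply)+
qed

context nonroot
begin


section \<open>The Yang-Baxter equation\<close>

lemma ec_Kc_pred: "Kc l (b - Suc 0) * ec l b = p\<^sup>2 * Kc l b * ec l b"
  by (cases b) (simp_all add: Kc_Suc power2_eq_square)

definition casimir :: "nat \<Rightarrow> complex" where
  "casimir l = p * p ^ l + 1 / (p * p ^ l)"

definition kap :: complex where "kap = (p - 1 / p)\<^sup>2"

lemma kap_nz [simp]: "kap \<noteq> 0"
  by (simp add: kap_def)

text \<open>The Casimir element acts by a scalar on each factor.\<close>

lemma ec_casimir: "ec l b = (casimir l - (p * Kc l b + 1 / (p * Kc l b))) / kap"
  unfolding ec_def kap_def[symmetric] by (simp add: casimir_def Kc_def field_simps)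

lemma ec_Suc_casimir: "ec l (Suc b) = (casimir l - (Kc l b / p + p / Kc l b)) / kap"
  unfolding ec_casimir by (simp add: Kc_Suc)

lemma lower_raise:
  assumes "b \<le> l" "c \<le> m"
  shows "lower l m f g (raise (enat l) (enat m) f' g' (bas (b, c))) =
     (f' b c * f (Suc b) c * ec l (Suc b) + g' b c * g b (Suc c) * ec m (Suc c)) \<cdot> bas (b, c)
     + (f' b c * g (Suc b) c * ec m c) \<cdot> (if b < l then bas (Suc b, c - 1) else 0)
     + (g' b c * f b (Suc c) * ec l b) \<cdot> (if c < m then bas (b - 1, Suc c) else 0)"
proof -
  have "b = l \<Longrightarrow> ec l (Suc b) = 0" "c = m \<Longrightarrow> ec m (Suc c) = 0" by simp_all
  then show ?thesis using assms
    by (cases "b = l"; cases "c = m")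
      (simp_all add: raise_bas lower_bas up1_def up2_def lin_simps smul_add add_smul mult_ac)
qed

lemma raise_lower:
  assumes "b \<le> l" "c \<le> m"
  shows "raise (enat l) (enat m) f' g' (lower l m f g (bas (b, c))) =
     (f b c * ec l b * f' (b - 1) c + g b c * ec m c * g' b (c - 1)) \<cdot> bas (b, c)
     + (g b c * ec m c * f' b (c - 1)) \<cdot> (if b < l then bas (Suc b, c - 1) else 0)
     + (f b c * ec l b * g' (b - 1) c) \<cdot> (if c < m then bas (b - 1, Suc c) else 0)"
  using assms
  by (cases b; cases c)
    (auto simp: raise_bas lower_bas up1_def up2_def lin_simps smul_add add_smul mult_ac)

text \<open>
  \<open>q\<close>-commutators of a raising and a lowering operator. For \<open>q = p\<^sup>2\<close> and for \<open>q = p\<^sup>-\<^sup>2\<close> one of the two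
  cross terms vanishes, as it does in the diagonal entries of a product of two \<open>L\<close>-operators.
\<close>

definition qEA where "qEA l m w q u = opE l m w (fA l m w u) - q \<cdot> fA l m w (opE l m w u)"
definition qEA' where "qEA' l m w q u = opE' l m w (fA' l m w u) - q \<cdot> fA' l m w (opE' l m w u)"

lemma lin_qEA [simp, intro]: "lin (qEA l m w q)" "lin (qEA' l m w q)"
  by (rule linI; simp add: qEA_def qEA'_def lin_simps smul_add smul_diff mult.commute)+

text \<open>The common diagonal part of \<open>qEA\<close> and \<open>qEA'\<close>.\<close>

definition dg where "dg l m w q b c =
  ec l (Suc b) - q * ec l b + w\<^sup>2 * (ec m (Suc c) - q * ec m c)"

lemma qEA_bas:
  assumes "b \<le> l" "c \<le> m"
  shows "qEA l m w q (bas (b, c)) = dg l m w q b c \<cdot> bas (b, c)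
    + (w / Kc l b * ec m c * (p\<^sup>2 - q)) \<cdot> (if b < l then bas (Suc b, c - 1) else 0)
    + (w * Kc l b * ec l b * (1 - q * p\<^sup>2)) \<cdot> (if c < m then bas (b - 1, Suc c) else 0)"
    (is "_ = _ \<cdot> ?U + _ \<cdot> ?X1 + _ \<cdot> ?X2")
proof -
  have *: "ec l b * Kc l (b - Suc 0) = p * (p * (ec l b * Kc l b))"
    using ec_Kc_pred[of l b] by (simp add: power2_eq_square mult_ac)
  have 1: "opE l m w (fA l m w (bas (b, c))) = (ec l (Suc b) + w\<^sup>2 * ec m (Suc c)) \<cdot> ?U
     + (w / Kc l b * ec m c * p\<^sup>2) \<cdot> ?X1 + (w * Kc l b * ec l b) \<cdot> ?X2"
    unfolding opE_def opA_def lower_raise[OF assms]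
    by (simp add: Kc_Suc power2_eq_square mult_ac)
  have 2: "fA l m w (opE l m w (bas (b, c))) = (ec l b + w\<^sup>2 * ec m c) \<cdot> ?U
     + (w / Kc l b * ec m c) \<cdot> ?X1 + (w * (p\<^sup>2 * Kc l b * ec l b)) \<cdot> ?X2"
    unfolding opE_def opA_def raise_lower[OF assms]
    by (simp add: power2_eq_square mult_ac *)
  show ?thesis unfolding qEA_def 1 2 dg_def
    by (simp add: smul_add algebra_simps add_smul diff_smul diff_divide_distrib)
qed

lemma qEA'_bas:
  assumes "b \<le> l" "c \<le> m"
  shows "qEA' l m w q (bas (b, c)) = dg l m w q b c \<cdot> bas (b, c)
    + (w * Kc m c * ec m c * (1 - q * p\<^sup>2)) \<cdot> (if b < l then bas (Suc b, c - 1) else 0)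
    + (w / Kc m c * ec l b * (p\<^sup>2 - q)) \<cdot> (if c < m then bas (b - 1, Suc c) else 0)"
    (is "_ = _ \<cdot> ?U + _ \<cdot> ?X1 + _ \<cdot> ?X2")
proof -
  have *: "ec m c * Kc m (c - Suc 0) = p * (p * (ec m c * Kc m c))"
    using ec_Kc_pred[of m c] by (simp add: power2_eq_square mult_ac)
  have 1: "opE' l m w (fA' l m w (bas (b, c))) = (ec l (Suc b) + w\<^sup>2 * ec m (Suc c)) \<cdot> ?U
     + (w * Kc m c * ec m c) \<cdot> ?X1 + (w / Kc m c * ec l b * p\<^sup>2) \<cdot> ?X2"
    unfolding opE'_def opA'_def lower_raise[OF assms]
    by (simp add: Kc_Suc power2_eq_square mult_ac)
  have 2: "fA' l m w (opE' l m w (bas (b, c))) = (ec l b + w\<^sup>2 * ec m c) \<cdot> ?U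
     + (w * (p\<^sup>2 * Kc m c * ec m c)) \<cdot> ?X1 + (w / Kc m c * ec l b) \<cdot> ?X2"
    unfolding opE'_def opA'_def raise_lower[OF assms]
    by (simp add: power2_eq_square mult_ac *)
  show ?thesis unfolding qEA'_def 1 2 dg_def
    by (simp add: smul_add algebra_simps add_smul diff_smul diff_divide_distrib)
qed

lemma p4_nz: "1 - p ^ 4 \<noteq> 0" "p\<^sup>2 - 1 / p\<^sup>2 \<noteq> 0"
proof -
  show 1: "1 - p ^ 4 \<noteq> 0" using p_pow_neq_1[of 4] by simp
  have "p\<^sup>2 * p\<^sup>2 = p ^ 4" by (simp add: power2_eq_square power4_eq_xxxx)
  then show "p\<^sup>2 - 1 / p\<^sup>2 \<noteq> 0" using 1 by (auto simp: field_simps power4_eq_xxxx power2_eq_square)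
qed

text \<open>
  The coefficients, functions of the weight \<open>n\<close>, in the expansion of the entries of a product of two
  \<open>L\<close>-operators: \<open>Yt\<close> and \<open>Ys\<close> belong to the diagonal entry at the state 0, the primed ones to that at the
  state 1, \<open>Yr\<close> to the lowering and \<open>Yq\<close> to the raising entry, where \<open>Yk\<close> weighs the second
  generator against the first.
\<close>

definition Ys where "Ys z n = z\<^sup>2 * (1 - p\<^sup>2)\<^sup>2 * p ^ n / (1 - p ^ 4)"
definition Yt where "Yt l m z w n = p ^ n * (1 + z\<^sup>2 * (z * w)\<^sup>2 * p\<^sup>2 * Kc (l + m) n)
  - Ys z n * (1 - p\<^sup>2) * (casimir l + w\<^sup>2 * casimir m) / kap"
definition Ys' where "Ys' l m z n = z\<^sup>2 * (1 - p\<^sup>2)\<^sup>2 * (p ^ (l + m) / p ^ n) / (p\<^sup>2 - 1 / p\<^sup>2)"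
definition Yt' where "Yt' l m z w n = p ^ (l + m) / p ^ n * (1 + z\<^sup>2 * (z * w)\<^sup>2 * p\<^sup>2 / Kc (l + m) n)
  - Ys' l m z n * (1 - 1 / p\<^sup>2) * (casimir l + w\<^sup>2 * casimir m) / kap"
definition Yr where "Yr l m z n = z * (p ^ (l + m) / p ^ n) * (1 - p\<^sup>2)"
definition Yq where "Yq z n = z * p ^ n * (1 - p\<^sup>2)"
definition Yk where "Yk z w = z\<^sup>2 * w * p"

lemma kap_eq: "(1 - p\<^sup>2)\<^sup>2 = p\<^sup>2 * kap"
proof -
  have "1 - p\<^sup>2 = - (p * (p - 1 / p))" by (simp add: right_diff_distrib power2_eq_square)
  then show ?thesis by (simp add: kap_def power_mult_distrib)
qed

lemma ec_q_diff:
  "ec l (Suc b) - p\<^sup>2 * ec l b = ((1 - p\<^sup>2) * casimir l - (1 - p ^ 4) / p * Kc l b) / kap" (is ?first)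
  "ec l (Suc b) - 1 / p\<^sup>2 * ec l b = ((1 - 1 / p\<^sup>2) * casimir l - (p\<^sup>2 - 1 / p\<^sup>2) / p * (1 / Kc l b)) / kap" (is ?second)
proof -
  have gen: "(c - (K / q + q / K)) - q\<^sup>2 * (c - (q * K + 1 / (q * K))) = (1 - q\<^sup>2) * c - (1 - q ^ 4) / q * K"
    "(c - (K / q + q / K)) - 1 / q\<^sup>2 * (c - (q * K + 1 / (q * K))) = (1 - 1 / q\<^sup>2) * c - (q\<^sup>2 - 1 / q\<^sup>2) / q * (1 / K)"
    if "K \<noteq> 0" "q \<noteq> 0" for q c K :: complex
    using that by (simp_all add: algebra_simps diff_divide_distrib power2_eq_square power4_eq_xxxx)
  have 1: "(c - (K / p + p / K)) - p\<^sup>2 * (c - (p * K + 1 / (p * K))) = (1 - p\<^sup>2) * c - (1 - p ^ 4) / p * K"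
    and 2: "(c - (K / p + p / K)) - 1 / p\<^sup>2 * (c - (p * K + 1 / (p * K))) = (1 - 1 / p\<^sup>2) * c - (p\<^sup>2 - 1 / p\<^sup>2) / p * (1 / K)"
    if "K \<noteq> 0" for c K
    using that gen[of K p c] by simp_all
  show ?first ?second
    unfolding ec_Suc_casimir unfolding ec_casimir times_divide_eq_right diff_divide_distrib[symmetric]
      1[OF Kc_nz] 2[OF Kc_nz] by (rule HOL.refl)+
qed

text \<open>
  The product on the left contains \<open>Kc l b + w\<^sup>2 * Kc m c\<close>, which is not a function of the weight. The same
  expression occurs in the \<open>q\<close>-commutator, by the Casimir element.
\<close>

lemma Y00: "La l z b * La m (z * w) c = Yt l m z w (b + c) + Ys z (b + c) * dg l m w (p\<^sup>2) b c"
proof -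
  define K1 K2 N where "K1 = Kc l b" and "K2 = Kc m c" and "N = p ^ (b + c)"
  have [simp]: "K1 \<noteq> 0" "K2 \<noteq> 0" by (simp_all add: K1_def K2_def)
  have d: "dg l m w (p\<^sup>2) b c = ((1 - p\<^sup>2) * (casimir l + w\<^sup>2 * casimir m) - (1 - p ^ 4) / p * (K1 + w\<^sup>2 * K2)) / kap"
    unfolding dg_def ec_q_diff K1_def[symmetric] K2_def[symmetric] times_divide_eq_right add_divide_distrib[symmetric]
    by (rule arg_cong[where f = "\<lambda>v. v / kap"]) (simp add: algebra_simps add_divide_distrib diff_divide_distrib)
  have s: "Ys z (b + c) * ((1 - p ^ 4) / p * V) / kap = z\<^sup>2 * N * p * V" for V
    unfolding Ys_def kap_eq N_def using p4_nz by (simp add: power2_eq_square)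
  have h1: "Ys z (b + c) * dg l m w (p\<^sup>2) b c = Ys z (b + c) * (1 - p\<^sup>2) * (casimir l + w\<^sup>2 * casimir m) / kap - z\<^sup>2 * N * p * (K1 + w\<^sup>2 * K2)"
  proof -
    have "Y * ((u * v - X) / k) = Y * u * v / k - Y * X / k" for Y u v X k :: complex
      by (simp add: right_diff_distrib diff_divide_distrib mult.assoc)
    then show ?thesis unfolding d s[symmetric] .
  qed
  have h2: "Kc (l + m) (b + c) = K1 * K2" by (simp add: K1_def K2_def Kc_mult)
  have h3: "La l z b * La m (z * w) c = N * ((1 - z\<^sup>2 * p * K1) * (1 - (z * w)\<^sup>2 * p * K2))"
    by (simp add: La_def N_def K1_def K2_def power_add mult_ac)
  show ?thesis
    unfolding h3 h1 Yt_def h2 N_def[symmetric] by (simp add: algebra_simps power2_eq_square)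
qed

lemma Y11: "Ld l z b * Ld m (z * w) c = Yt' l m z w (b + c) + Ys' l m z (b + c) * dg l m w (1 / p\<^sup>2) b c"
proof -
  define K1 K2 N where "K1 = Kc l b" and "K2 = Kc m c" and "N = p ^ (l + m) / p ^ (b + c)"
  have [simp]: "K1 \<noteq> 0" "K2 \<noteq> 0" by (simp_all add: K1_def K2_def)
  have d: "dg l m w (1 / p\<^sup>2) b c = ((1 - 1 / p\<^sup>2) * (casimir l + w\<^sup>2 * casimir m) - (p\<^sup>2 - 1 / p\<^sup>2) / p * (1 / K1 + w\<^sup>2 / K2)) / kap"
    unfolding dg_def ec_q_diff K1_def[symmetric] K2_def[symmetric] times_divide_eq_right add_divide_distrib[symmetric]
    by (rule arg_cong[where f = "\<lambda>v. v / kap"]) (simp add: algebra_simps add_divide_distrib diff_divide_distrib)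
  have s: "Ys' l m z (b + c) * ((p\<^sup>2 - 1 / p\<^sup>2) / p * V) / kap = z\<^sup>2 * N * p * V" for V
    unfolding Ys'_def kap_eq N_def[symmetric] using p4_nz by (simp add: power2_eq_square)
  have h1: "Ys' l m z (b + c) * dg l m w (1 / p\<^sup>2) b c = Ys' l m z (b + c) * (1 - 1 / p\<^sup>2) * (casimir l + w\<^sup>2 * casimir m) / kap - z\<^sup>2 * N * p * (1 / K1 + w\<^sup>2 / K2)"
  proof -
    have "Y * ((u * v - X) / k) = Y * u * v / k - Y * X / k" for Y u v X k :: complex
      by (simp add: right_diff_distrib diff_divide_distrib mult.assoc)
    then show ?thesis unfolding d s[symmetric] .
  qed
  have h2: "Kc (l + m) (b + c) = K1 * K2" by (simp add: K1_def K2_def Kc_mult)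
  have h3: "Ld l z b * Ld m (z * w) c = N * ((1 - z\<^sup>2 * p / K1) * (1 - (z * w)\<^sup>2 * p / K2))"
    by (simp add: Ld_def N_def K1_def K2_def power_add mult_ac)
  show ?thesis
    unfolding h3 h1 Yt'_def h2 N_def[symmetric]
    by (simp add: algebra_simps power2_eq_square diff_divide_distrib)
qed

lemma Y_off:
  "Lc z b * Lb m (z * w) c = Ys z (b + c) * (w * Kc m c * ec m c * (1 - p\<^sup>2 * p\<^sup>2))" (is ?first)
  "Lb l z b * Lc (z * w) c = Ys z (b + c) * (w * Kc l b * ec l b * (1 - p\<^sup>2 * p\<^sup>2))" (is ?second)
  "Lb l z b * Lc (z * w) c = Ys' l m z (b + c) * (w / Kc m c * ec l b * (p\<^sup>2 - 1 / p\<^sup>2))" (is ?third)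
  "Lc z b * Lb m (z * w) c = Ys' l m z (b + c) * (w / Kc l b * ec m c * (p\<^sup>2 - 1 / p\<^sup>2))" (is ?fourth)
proof -
  have 4: "1 - p\<^sup>2 * p\<^sup>2 = 1 - p ^ 4" by (simp add: power2_eq_square power4_eq_xxxx)
  have s: "Ys z n * (V * (1 - p ^ 4)) = z\<^sup>2 * (1 - p\<^sup>2)\<^sup>2 * p ^ n * V" for V n
    unfolding Ys_def using p4_nz by simp
  have s': "Ys' l m z n * (V * (p\<^sup>2 - 1 / p\<^sup>2)) = z\<^sup>2 * (1 - p\<^sup>2)\<^sup>2 * (p ^ (l + m) / p ^ n) * V" for V n
    unfolding Ys'_def using p4_nz by simp
  show ?first ?second ?third ?fourth
    unfolding 4 s s' Lc_def Lb_def Kc_def power_add by (simp_all add: power2_eq_square mult_ac)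
qed

lemma Y_low:
  "La m (z * w) c * Lb l z b = Yr l m z (b + c) * (1 / Kc m c - Yk z w * w) * ec l b"
  "Lb m (z * w) c * Ld l z b = Yr l m z (b + c) * (w - Yk z w * (1 / Kc l b)) * ec m c"
  "La l z b * Lb m (z * w) c = Yr l m z (b + c) * (w / Kc l b - Yk z w) * ec m c"
  "Lb l z b * Ld m (z * w) c = Yr l m z (b + c) * (1 - Yk z w * (w / Kc m c)) * ec l b"
  unfolding Yr_def Yk_def La_def Lb_def Ld_def Kc_def power_add
  by (simp_all add: power2_eq_square field_simps)

lemma Y_up:
  "Lc (z * w) c * La l z b = Yq z (b + c) * (w - Yk z w * Kc l b)"
  "Ld m (z * w) c * Lc z b = Yq z (b + c) * (Kc m c - Yk z w * w)"
  "Lc z b * La m (z * w) c = Yq z (b + c) * (1 - Yk z w * (w * Kc m c))"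
  "Ld l z b * Lc (z * w) c = Yq z (b + c) * (w * Kc l b - Yk z w)"
  unfolding Yq_def Yk_def La_def Lc_def Ld_def Kc_def power_add
  by (simp_all add: power2_eq_square field_simps)

definition VVlev where "VVlev l m n = coord_space {(b, c). b \<le> l \<and> c \<le> m \<and> b + c = n}"

lemma eq_on_VVlev:
  assumes "u \<in> VVlev l m n" "lin T" "lin U"
    and "\<And>b c. b \<le> l \<Longrightarrow> c \<le> m \<Longrightarrow> b + c = n \<Longrightarrow> T (bas (b, c)) = U (bas (b, c))"
  shows "T u = U u"
  using lin_eq_on[of T U "{(b, c). b \<le> l \<and> c \<le> m \<and> b + c = n}" u] assms
  by (auto simp: VVlev_def)

lemma LL_entries_0:
  assumes "u \<in> VVlev l m n"
  shows "lift12 (Lop l z) (lift13 (Lop m (z * w)) (pre 0 u)) =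
      pre 0 (Yt l m z w n \<cdot> u + Ys z n \<cdot> qEA' l m w (p\<^sup>2) u) +
      pre (Suc 0) (Yr l m z n \<cdot> (opE' l m w u - Yk z w \<cdot> opG' l m w u))" (is ?first)
    and "lift13 (Lop m (z * w)) (lift12 (Lop l z) (pre 0 u)) =
      pre 0 (Yt l m z w n \<cdot> u + Ys z n \<cdot> qEA l m w (p\<^sup>2) u) +
      pre (Suc 0) (Yr l m z n \<cdot> (opE l m w u - Yk z w \<cdot> opG l m w u))" (is ?second)
proof -
  show ?first
    using assms
  proof (rule eq_on_VVlev)
    fix b c assume bc: "b \<le> l" "c \<le> m" "b + c = n"
    let ?X1 = "if b < l then bas (0, Suc b, c - 1) else 0"
    have L: "lift12 (Lop l z) (lift13 (Lop m (z * w)) (pre 0 (bas (b, c)))) =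
      (La l z b * La m (z * w) c) \<cdot> bas (0, b, c) + (Lc z b * Lb m (z * w) c) \<cdot> ?X1 +
      ((La m (z * w) c * Lb l z b) \<cdot> bas (Suc 0, b - 1, c) + (Lb m (z * w) c * Ld l z b) \<cdot> bas (Suc 0, b, c - 1))"
      using bc by (simp add: lift_bas Lop_0 Lop_1 lin_simps smul_add mult_ac)
    have X1: "pre 0 (if b < l then bas (Suc b, c - 1) else 0) = ?X1" by (simp add: lin_zero)
    have q: "qEA' l m w (p\<^sup>2) (bas (b, c)) = dg l m w (p\<^sup>2) b c \<cdot> bas (b, c)
      + (w * Kc m c * ec m c * (1 - p\<^sup>2 * p\<^sup>2)) \<cdot> (if b < l then bas (Suc b, c - 1) else 0)"
      unfolding qEA'_bas[OF bc(1,2)] by simp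
    show "lift12 (Lop l z) (lift13 (Lop m (z * w)) (pre 0 (bas (b, c)))) =
      pre 0 (Yt l m z w n \<cdot> bas (b, c) + Ys z n \<cdot> qEA' l m w (p\<^sup>2) (bas (b, c))) +
      pre (Suc 0) (Yr l m z n \<cdot> (opE' l m w (bas (b, c)) - Yk z w \<cdot> opG' l m w (bas (b, c))))"
      unfolding L Y00 Y_off(1) Y_low(1,2) q bc(3)
      unfolding opE'_def opG'_def lower_bas lin_add[OF lin_pre] lin_smul[OF lin_pre] lin_diff[OF lin_pre] X1 smul_add
      by (simp add: add_smul smul_add smul_diff diff_smul algebra_simps)
  qed (auto intro!: linI simp: lin_simps smul_add smul_diff mult_ac)
  show ?second
    using assms
  proof (rule eq_on_VVlev)
    fix b c assume bc: "b \<le> l" "c \<le> m" "b + c = n"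
    let ?X2 = "if c < m then bas (0, b - 1, Suc c) else 0"
    have L: "lift13 (Lop m (z * w)) (lift12 (Lop l z) (pre 0 (bas (b, c)))) =
      (La l z b * La m (z * w) c) \<cdot> bas (0, b, c) + (Lb l z b * Lc (z * w) c) \<cdot> ?X2 +
      ((Lb l z b * Ld m (z * w) c) \<cdot> bas (Suc 0, b - 1, c) + (La l z b * Lb m (z * w) c) \<cdot> bas (Suc 0, b, c - 1))"
      using bc by (simp add: lift_bas Lop_0 Lop_1 lin_simps smul_add mult_ac)
    have X2: "pre 0 (if c < m then bas (b - 1, Suc c) else 0) = ?X2" by (simp add: lin_zero)
    have q: "qEA l m w (p\<^sup>2) (bas (b, c)) = dg l m w (p\<^sup>2) b c \<cdot> bas (b, c)
      + (w * Kc l b * ec l b * (1 - p\<^sup>2 * p\<^sup>2)) \<cdot> (if c < m then bas (b - 1, Suc c) else 0)"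
      unfolding qEA_bas[OF bc(1,2)] by simp
    show "lift13 (Lop m (z * w)) (lift12 (Lop l z) (pre 0 (bas (b, c)))) =
      pre 0 (Yt l m z w n \<cdot> bas (b, c) + Ys z n \<cdot> qEA l m w (p\<^sup>2) (bas (b, c))) +
      pre (Suc 0) (Yr l m z n \<cdot> (opE l m w (bas (b, c)) - Yk z w \<cdot> opG l m w (bas (b, c))))"
      unfolding L Y00 Y_off(2) Y_low(3,4) q bc(3)
      unfolding opE_def opG_def lower_bas lin_add[OF lin_pre] lin_smul[OF lin_pre] lin_diff[OF lin_pre] X2 smul_add
      by (simp add: add_smul smul_add smul_diff diff_smul algebra_simps)
  qed (auto intro!: linI simp: lin_simps smul_add smul_diff mult_ac)
qed

lemma LL_entries_1:
  assumes "u \<in> VVlev l m n"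
  shows "lift12 (Lop l z) (lift13 (Lop m (z * w)) (pre (Suc 0) u)) =
      pre 0 (Yq z n \<cdot> (fA' l m w u - Yk z w \<cdot> fB' l m w u)) +
      pre (Suc 0) (Yt' l m z w n \<cdot> u + Ys' l m z n \<cdot> qEA' l m w (1 / p\<^sup>2) u)" (is ?first)
    and "lift13 (Lop m (z * w)) (lift12 (Lop l z) (pre (Suc 0) u)) =
      pre 0 (Yq z n \<cdot> (fA l m w u - Yk z w \<cdot> fB l m w u)) +
      pre (Suc 0) (Yt' l m z w n \<cdot> u + Ys' l m z n \<cdot> qEA l m w (1 / p\<^sup>2) u)" (is ?second)
proof -
  show ?first
    using assms
  proof (rule eq_on_VVlev)
    fix b c assume bc: "b \<le> l" "c \<le> m" "b + c = n"
    let ?X2 = "if c < m then bas (Suc 0, b - 1, Suc c) else 0"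
    let ?U1 = "if b < l then bas (0, Suc b, c) else 0"
    let ?U2 = "if c < m then bas (0, b, Suc c) else 0"
    have L: "lift12 (Lop l z) (lift13 (Lop m (z * w)) (pre (Suc 0) (bas (b, c)))) =
      ((Ld m (z * w) c * Lc z b) \<cdot> ?U1 + (Lc (z * w) c * La l z b) \<cdot> ?U2) +
      ((Ld l z b * Ld m (z * w) c) \<cdot> bas (Suc 0, b, c) + (Lb l z b * Lc (z * w) c) \<cdot> ?X2)"
      using bc by (simp add: lift_bas Lop_0 Lop_1 lin_simps smul_add mult_ac)
    have X2: "pre (Suc 0) (if c < m then bas (b - 1, Suc c) else 0) = ?X2"
      "pre 0 (up1 (enat l) b c) = ?U1" "pre 0 (up2 (enat m) b c) = ?U2"
      by (simp_all add: lin_zero up1_def up2_def)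
    have q: "qEA' l m w (1 / p\<^sup>2) (bas (b, c)) = dg l m w (1 / p\<^sup>2) b c \<cdot> bas (b, c)
      + (w / Kc m c * ec l b * (p\<^sup>2 - 1 / p\<^sup>2)) \<cdot> (if c < m then bas (b - 1, Suc c) else 0)"
      unfolding qEA'_bas[OF bc(1,2)] by simp
    show "lift12 (Lop l z) (lift13 (Lop m (z * w)) (pre (Suc 0) (bas (b, c)))) =
      pre 0 (Yq z n \<cdot> (fA' l m w (bas (b, c)) - Yk z w \<cdot> fB' l m w (bas (b, c)))) +
      pre (Suc 0) (Yt' l m z w n \<cdot> bas (b, c) + Ys' l m z n \<cdot> qEA' l m w (1 / p\<^sup>2) (bas (b, c)))"
      unfolding L Y11 Y_off(3)[of l z b w c m] Y_up(1,2) q bc(3)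
      unfolding opA'_def opB'_def raise_bas lin_add[OF lin_pre] lin_smul[OF lin_pre] lin_diff[OF lin_pre] X2 smul_add
      by (simp add: add_smul smul_add smul_diff diff_smul algebra_simps)
  qed (auto intro!: linI simp: lin_simps smul_add smul_diff mult_ac)
  show ?second
    using assms
  proof (rule eq_on_VVlev)
    fix b c assume bc: "b \<le> l" "c \<le> m" "b + c = n"
    let ?X1 = "if b < l then bas (Suc 0, Suc b, c - 1) else 0"
    let ?U1 = "if b < l then bas (0, Suc b, c) else 0"
    let ?U2 = "if c < m then bas (0, b, Suc c) else 0"
    have L: "lift13 (Lop m (z * w)) (lift12 (Lop l z) (pre (Suc 0) (bas (b, c)))) =
      ((Lc z b * La m (z * w) c) \<cdot> ?U1 + (Ld l z b * Lc (z * w) c) \<cdot> ?U2) +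
      ((Ld l z b * Ld m (z * w) c) \<cdot> bas (Suc 0, b, c) + (Lc z b * Lb m (z * w) c) \<cdot> ?X1)"
      using bc by (simp add: lift_bas Lop_0 Lop_1 lin_simps smul_add mult_ac)
    have X2: "pre (Suc 0) (if b < l then bas (Suc b, c - 1) else 0) = ?X1"
      "pre 0 (up1 (enat l) b c) = ?U1" "pre 0 (up2 (enat m) b c) = ?U2"
      by (simp_all add: lin_zero up1_def up2_def)
    have q: "qEA l m w (1 / p\<^sup>2) (bas (b, c)) = dg l m w (1 / p\<^sup>2) b c \<cdot> bas (b, c)
      + (w / Kc l b * ec m c * (p\<^sup>2 - 1 / p\<^sup>2)) \<cdot> (if b < l then bas (Suc b, c - 1) else 0)"
      unfolding qEA_bas[OF bc(1,2)] by simp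
    show "lift13 (Lop m (z * w)) (lift12 (Lop l z) (pre (Suc 0) (bas (b, c)))) =
      pre 0 (Yq z n \<cdot> (fA l m w (bas (b, c)) - Yk z w \<cdot> fB l m w (bas (b, c)))) +
      pre (Suc 0) (Yt' l m z w n \<cdot> bas (b, c) + Ys' l m z n \<cdot> qEA l m w (1 / p\<^sup>2) (bas (b, c)))"
      unfolding L Y11 Y_off(4)[of z b m w c l] Y_up(3,4) q bc(3)
      unfolding opA_def opB_def raise_bas lin_add[OF lin_pre] lin_smul[OF lin_pre] lin_diff[OF lin_pre] X2 smul_add
      by (simp add: add_smul smul_add smul_diff diff_smul algebra_simps)
  qed (auto intro!: linI simp: lin_simps smul_add smul_diff mult_ac)
qed

lemma fRop_VVlev:
  assumes "u \<in> VVlev l m n"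
  shows "fRop l m w u \<in> VVlev l m n"
proof -
  have "fRop l m w (bas s) \<in> VVlev l m n" if s: "s \<in> {(b, c). b \<le> l \<and> c \<le> m \<and> b + c = n}" for s
  proof -
    obtain b c where s: "s = (b, c)" "b + c = n" using s by auto
    have "Rm (enat l) (enat m) l m w b c \<in> level n" "Rm (enat l) (enat m) l m w b c \<in> VV_space l m"
      using Rm_level[of "enat l" "enat m" l m w b c] fRm_VV s by auto
    then show ?thesis
      by (auto simp: s VVlev_def level_def VV_space_def coord_space_def)
  qed
  then show ?thesis
    using lin_in_coord_space[OF lin_Rop _ assms[unfolded VVlev_def]] unfolding VVlev_def by blast
qed

text \<open>
  Each entry of the product of two \<open>L\<close>-operators is a combination of the identity, of operators
  representing generators and of their \<open>q\<close>-commutators, with coefficients depending on the weight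
  only. These are intertwined, which is the Yang-Baxter equation.
\<close>

theorem yang_baxter:
  assumes "goodz 1 l z" "goodz 1 m (z * w)" "goodz l m w"
  shows "lift12 (fRop 1 l z) (lift13 (fRop 1 m (z * w)) (lift23 (fRop l m w) u)) =
         lift23 (fRop l m w) (lift13 (fRop 1 m (z * w)) (lift12 (fRop 1 l z) u))"
proof -
  let ?S = "fRop l m w"
  note S_lev = fRop_VVlev[where w = w]
  have q: "?S (qEA l m w q u) = qEA' l m w q (?S u)" for q u
    by (simp add: qEA_def qEA'_def lin_simps fRop_fA fRop_opE assms(3))
  note S = fRop_fA[OF assms(3)] fRop_fB[OF assms(3)] fRop_opE[OF assms(3)] fRop_opG[OF assms(3)]
  have "lift12 (Lop l z) (lift13 (Lop m (z * w)) (lift23 ?S (bas s))) =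
        lift23 ?S (lift13 (Lop m (z * w)) (lift12 (Lop l z) (bas s)))" for s
  proof -
    obtain a b c where s: "s = (a, b, c)" by (cases s)
    consider (in0) "a = 0" "b \<le> l" "c \<le> m" | (in1) "a = Suc 0" "b \<le> l" "c \<le> m"
      | (out1) "\<not> (b \<le> l \<and> c \<le> m)" | (out2) "a > Suc 0" by linarith
    then show ?thesis
    proof cases
      case in0
      have lev: "bas (b, c) \<in> VVlev l m (b + c)" using in0 by (simp add: VVlev_def)
      have b: "bas s = pre 0 (bas (b, c))" by (simp add: s in0)
      show ?thesis
        unfolding b lift23_pre[OF lin_Rop] LL_entries_0(1)[OF S_lev[OF lev]] LL_entries_0(2)[OF lev]
          lin_add[OF lin_lift(3)]
        by (simp add: lift23_pre lin_simps S q del: Rop_bas)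
    next
      case in1
      have lev: "bas (b, c) \<in> VVlev l m (b + c)" using in1 by (simp add: VVlev_def)
      have b: "bas s = pre (Suc 0) (bas (b, c))" by (simp add: s in1)
      show ?thesis
        unfolding b lift23_pre[OF lin_Rop] LL_entries_1(1)[OF S_lev[OF lev]] LL_entries_1(2)[OF lev]
          lin_add[OF lin_lift(3)]
        by (simp add: lift23_pre lin_simps S q del: Rop_bas)
    next
      case out1
      \<comment> \<open>Outside the finite-dimensional modules both sides vanish.\<close>
      have 1: "lift23 ?S (bas s) = 0"
        using fRop_outside[OF out1, of w] by (simp add: s lift_bas lin_zero del: Rop_bas)
      have 2: "lift13 (Lop m (z * w)) (lift12 (Lop l z) (bas s)) = 0"
      proof (cases "b \<le> l")
        case False
        then have "Lop l z (bas (a, b)) = 0" by (simp add: Lop_def)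
        then show ?thesis by (simp add: s lift_bas lin_zero)
      next
        case True
        then have c: "\<not> c \<le> m" using out1 by auto
        have "lift13 (Lop m (z * w)) \<circ> lin_ext (\<lambda>(i, j). bas (i, j, c)) = (\<lambda>_. 0)"
          by (rule lin_eqI) (use c in \<open>auto simp: lift_bas Lop_def\<close>)
        then show ?thesis by (simp add: s lift_bas fun_eq_iff)
      qed
      show ?thesis unfolding 1 2 by (simp add: lin_zero)
    next
      case out2
      then have z: "Lop l z (bas (a, i)) = 0" "Lop m (z * w) (bas (a, i)) = 0" for i
        by (simp_all add: Lop_def)
      have "lift13 (Lop m (z * w)) \<circ> pre a = (\<lambda>_. 0)"
        by (rule lin_eqI) (auto simp: lift_bas z)
      then have "lift13 (Lop m (z * w)) (pre a v) = 0" for v by (simp add: fun_eq_iff)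
      moreover have "lift23 ?S (bas s) = pre a (?S (bas (b, c)))"
        using lift23_pre[of ?S a "bas (b, c)"] by (simp add: s)
      ultimately show ?thesis by (simp add: s lift_bas z lin_zero)
    qed
  qed
  then have "lift12 (Lop l z) \<circ> lift13 (Lop m (z * w)) \<circ> lift23 ?S =
        lift23 ?S \<circ> lift13 (Lop m (z * w)) \<circ> lift12 (Lop l z)"
    by (intro lin_eqI lin_comp) auto
  then show ?thesis
    unfolding fRop_Lop[OF assms(1)] fRop_Lop[OF assms(2)] lift_scale
    by (simp add: lin_smul fun_eq_iff mult.commute)
qed


section \<open>Fusion of R-operators\<close>

text \<open>A square root of \<open>p\<close>, for the half-integral spins in \<open>\<iota>\<close>.\<close>

definition s :: complex where "s = exp (\<eta> / 2)"

lemma s_nz [simp]: "s \<noteq> 0"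
  by (simp add: s_def)

lemma s_s: "s * s = p"
  by (simp add: s_def p_def exp_add[symmetric])

text \<open>The second coefficient of \<open>iota\<close>, see \<open>iota_bas\<close>.\<close>

definition tc :: "nat \<Rightarrow> nat \<Rightarrow> complex" where
  "tc d i = s ^ Suc d / s ^ i * ((p ^ i - 1 / p ^ i) / (p - 1 / p))"

lemma tc_0 [simp]: "tc d 0 = 0"
  by (simp add: tc_def)

lemma pr_V_bas: "pr_V d (bas i) = (if i \<le> d then bas i else 0)"
  by (simp add: pr_V_def)

lemma iota_bas:
  "iota \<eta> d (bas i) = s ^ i \<cdot> (if i \<le> d then bas (0, i) else 0) +
     tc d i \<cdot> (if i \<le> Suc d then bas (Suc 0, i - 1) else 0)"
proof -
  have e: "exp (of_nat n * \<eta>) = p ^ n" for n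
    by (simp add: p_def exp_of_nat_mult)
  have 1: "exp (\<eta> / 2 * (of_nat (i + 1) - 1)) = s ^ i"
    by (simp add: s_def exp_of_nat_mult[symmetric] mult.commute)
  have "- (\<eta> / 2) * (of_nat (i + 1) - 2 - of_nat d) = of_nat (Suc d) * (\<eta> / 2) - of_nat i * (\<eta> / 2)"
    by (simp add: algebra_simps)
  then have 2: "exp (- (\<eta> / 2) * (of_nat (i + 1) - 2 - of_nat d)) = s ^ Suc d / s ^ i"
    by (simp only: exp_diff exp_of_nat_mult s_def)
  have 3: "sinh ((of_nat (i + 1) - 1) * \<eta>) = (p ^ i - 1 / p ^ i) / 2"
    using e[of i] by (simp add: sinh_field_def exp_minus inverse_eq_divide)
  have 4: "sinh \<eta> = (p - 1 / p) / 2"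
    by (simp add: sinh_field_def p_def exp_minus inverse_eq_divide)
  have v: "vvec (Suc 0) (Suc 0) = bas 0" "vvec (Suc 0) 2 = bas (Suc 0)" "vvec d (Suc i) = (if i \<le> d then bas i else 0)"
    by (simp_all add: vvec_def mvec_def pr_V_bas)
  have v': "tc d i \<cdot> tens (bas (Suc 0)) (vvec d i) = tc d i \<cdot> (if i \<le> Suc d then bas (Suc 0, i - 1) else 0)"
    by (cases i) (simp_all add: vvec_def mvec_def pr_V_bas)
  have "X / 2 / (Y / 2) = X / Y" for X Y :: complex by simp
  then have 5: "sinh ((of_nat (i + 1) - 1) * \<eta>) / sinh \<eta> = (p ^ i - 1 / p ^ i) / (p - 1 / p)"
    unfolding 3 4 .
  show ?thesis
    unfolding iota_def lin_ext_bas Let_def 1 2 5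
    using v' by (simp add: v tc_def)
qed

lemma lin_iota [simp, intro]: "lin (iota \<eta> d)"
  by (simp add: iota_def)

text \<open>By these two recursions \<open>iota\<close> intertwines raising operators.\<close>

lemma tc_rec1: "s ^ i * s ^ d + tc d i / (s * p) = tc d (Suc i)"
proof -
  have q: "p ^ i + (p ^ i - 1 / p ^ i) / (p - 1 / p) / p = (p ^ Suc i - 1 / p ^ Suc i) / (p - 1 / p)"
  proof -
    have "x \<noteq> 0 \<Longrightarrow> (p - 1 / p) * x + (x - 1 / x) / p = p * x - 1 / (p * x)" for x
      by (simp add: algebra_simps diff_divide_distrib)
    from this[of "p ^ i"] have "p ^ Suc i - 1 / p ^ Suc i = (p - 1 / p) * p ^ i + (p ^ i - 1 / p ^ i) / p"
      by simp
    then show ?thesis by (simp add: add_divide_distrib mult_ac)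
  qed
  have si: "s ^ i * s ^ i = p ^ i" by (simp add: power_mult_distrib[symmetric] s_s)
  have "s ^ i * s ^ d = s ^ d / s ^ i * p ^ i" by (simp add: si[symmetric])
  moreover have "tc d i / (s * p) = s ^ d / s ^ i * ((p ^ i - 1 / p ^ i) / (p - 1 / p) / p)"
    by (simp add: tc_def)
  ultimately have "s ^ i * s ^ d + tc d i / (s * p) = s ^ d / s ^ i * (p ^ i + (p ^ i - 1 / p ^ i) / (p - 1 / p) / p)"
    by (simp only: semiring_class.distrib_left)
  then show ?thesis unfolding q by (simp add: tc_def)
qed

lemma tc_rec2: "s ^ i * (Kc d i / s ^ d) + tc d i * s = tc d (Suc i)"
proof -
  have q: "1 / p ^ i + p * ((p ^ i - 1 / p ^ i) / (p - 1 / p)) = (p ^ Suc i - 1 / p ^ Suc i) / (p - 1 / p)"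
  proof -
    have "x \<noteq> 0 \<Longrightarrow> (p - 1 / p) * (1 / x) + p * (x - 1 / x) = p * x - 1 / (p * x)" for x
      by (simp add: algebra_simps diff_divide_distrib)
    from this[of "p ^ i"] have "p ^ Suc i - 1 / p ^ Suc i = (p - 1 / p) * (1 / p ^ i) + p * (p ^ i - 1 / p ^ i)"
      by simp
    then have "(p ^ Suc i - 1 / p ^ Suc i) / (p - 1 / p) = (p - 1 / p) * (1 / p ^ i) / (p - 1 / p) + p * (p ^ i - 1 / p ^ i) / (p - 1 / p)"
      by (simp only: add_divide_distrib)
    then show ?thesis by simp
  qed
  have si: "s ^ i * s ^ i = p ^ i" "s ^ d * s ^ d = p ^ d" by (simp_all add: power_mult_distrib[symmetric] s_s)
  have "s ^ i * (Kc d i / s ^ d) = s ^ d / s ^ i * (1 / p ^ i)"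
    by (simp add: Kc_def si[symmetric])
  moreover have "tc d i * s = s ^ d / s ^ i * (p * ((p ^ i - 1 / p ^ i) / (p - 1 / p)))"
    by (simp add: tc_def s_s[symmetric])
  ultimately have "s ^ i * (Kc d i / s ^ d) + tc d i * s = s ^ d / s ^ i * (1 / p ^ i + p * ((p ^ i - 1 / p ^ i) / (p - 1 / p)))"
    by (simp only: semiring_class.distrib_left)
  then show ?thesis unfolding q by (simp add: tc_def)
qed

text \<open>The analogue of \<open>raise\<close> for three factors with spins \<open>1/2\<close>, \<open>d / 2\<close> and \<open>l / 2\<close>.\<close>

definition raise3 where
  "raise3 d l f g h = lin_ext (\<lambda>(a, b, c).
     f a b c \<cdot> (if a < 1 then bas (Suc a, b, c) else 0) +
     g a b c \<cdot> (if b < d then bas (a, Suc b, c) else 0) +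
     h a b c \<cdot> (if c < l then bas (a, b, Suc c) else (0 :: (nat \<times> nat \<times> nat) vec)))"

lemma lin_raise3 [simp, intro]: "lin (raise3 d l f g h)"
  by (simp add: raise3_def)

lemma raise3_bas: "raise3 d l f g h (bas (a, b, c)) =
     f a b c \<cdot> (if a < 1 then bas (Suc a, b, c) else 0) +
     g a b c \<cdot> (if b < d then bas (a, Suc b, c) else 0) +
     h a b c \<cdot> (if c < l then bas (a, b, Suc c) else 0)"
  by (simp add: raise3_def)

text \<open>
  If a two-factor operator \<open>S\<close> intertwines raising operators of its two factors, then it intertwines
  three-factor ones, provided that the coefficient of raising the remaining factor depends on the state of that
  factor and on the total weight of the other two only.
\<close>

lemma lift23_raise3:
  assumes S: "lin S" "\<And>b c. S (bas (b, c)) \<in> level (b + c)"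
    and int: "\<And>a u. S (raise (enat d) (enat l) (g a) (h a) u) = raise (enat d) (enat l) (g' a) (h' a) (S u)"
  shows "lift23 S (raise3 d l (\<lambda>a b c. \<phi> a (b + c)) g h u) = raise3 d l (\<lambda>a b c. \<phi> a (b + c)) g' h' (lift23 S u)"
proof -
  have "lift23 S \<circ> raise3 d l (\<lambda>a b c. \<phi> a (b + c)) g h = raise3 d l (\<lambda>a b c. \<phi> a (b + c)) g' h' \<circ> lift23 S"
  proof (rule lin_eqI)
    fix t :: "nat \<times> nat \<times> nat"
    obtain a b c where t: "t = (a, b, c)" by (cases t)
    have pre: "raise3 d l (\<lambda>a b c. \<phi> a (b + c)) g h (pre a u) =
        \<phi> a n \<cdot> (if a < 1 then pre (Suc a) u else 0) + pre a (raise (enat d) (enat l) (g a) (h a) u)"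
      if "u \<in> level n" for u n g h
      by (rule lin_eq_on[where C = "{(b, c). b + c = n}"])
        (use that in \<open>auto intro!: linI simp: lin_simps smul_add mult_ac raise3_bas raise_bas up1_def up2_def level_def\<close>)
    have "bas (b, c) \<in> level (b + c)" by (simp add: level_def)
    from pre[OF this, of g h] pre[OF S(2)[of b c], of g' h']
    show "(lift23 S \<circ> raise3 d l (\<lambda>a b c. \<phi> a (b + c)) g h) (bas t) =
      (raise3 d l (\<lambda>a b c. \<phi> a (b + c)) g' h' \<circ> lift23 S) (bas t)"
      using lift23_pre[OF S(1), of a "bas (b, c)"] lift23_pre[OF S(1), of "Suc 0" "bas (b, c)"] by (simp add: t lin_simps lift23_pre[OF S(1)] int)
  qed auto
  then show ?thesis by (metis comp_apply)
qed

definition mid :: "nat \<Rightarrow> (nat \<times> nat) vec \<Rightarrow> (nat \<times> nat \<times> nat) vec" where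
  "mid b = lin_ext (\<lambda>(a, c). bas (a, b, c))"

lemma lin_mid [simp, intro]: "lin (mid b)"
  by (simp add: mid_def)

lemma mid_bas [simp]: "mid b (bas (a, c)) = bas (a, b, c)"
  by (simp add: mid_def)

lemma lift13_mid: "lin S \<Longrightarrow> lift13 S (mid b u) = mid b (S u)"
proof -
  assume "lin S"
  then have "lift13 S \<circ> mid b = mid b \<circ> S"
    by (intro lin_eqI) (auto simp: lift_bas mid_def)
  then show ?thesis by (metis comp_apply)
qed

lemma lift13_raise3:
  assumes S: "lin S" "\<And>b c. S (bas (b, c)) \<in> level (b + c)"
    and int: "\<And>b u. S (raise (enat 1) (enat l) (\<lambda>a c. f a b c) (\<lambda>a c. h a b c) u) =
      raise (enat 1) (enat l) (\<lambda>a c. f' a b c) (\<lambda>a c. h' a b c) (S u)"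
  shows "lift13 S (raise3 d l f (\<lambda>a b c. \<phi> b (a + c)) h u) = raise3 d l f' (\<lambda>a b c. \<phi> b (a + c)) h' (lift13 S u)"
proof -
  have "lift13 S \<circ> raise3 d l f (\<lambda>a b c. \<phi> b (a + c)) h = raise3 d l f' (\<lambda>a b c. \<phi> b (a + c)) h' \<circ> lift13 S"
  proof (rule lin_eqI)
    fix t :: "nat \<times> nat \<times> nat"
    obtain a b c where t: "t = (a, b, c)" by (cases t)
    have mid: "raise3 d l f (\<lambda>a b c. \<phi> b (a + c)) h (mid b u) =
        \<phi> b n \<cdot> (if b < d then mid (Suc b) u else 0) + mid b (raise (enat 1) (enat l) (\<lambda>a c. f a b c) (\<lambda>a c. h a b c) u)"
      if "u \<in> level n" for u n f h
      by (rule lin_eq_on[where C = "{(b, c). b + c = n}"])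
        (use that in \<open>auto intro!: linI simp: lin_simps smul_add mult_ac raise3_bas raise_bas up1_def up2_def level_def\<close>)
    have "bas (a, c) \<in> level (a + c)" by (simp add: level_def)
    from mid[OF this, of f h] mid[OF S(2)[of a c], of f' h']
    show "(lift13 S \<circ> raise3 d l f (\<lambda>a b c. \<phi> b (a + c)) h) (bas t) =
      (raise3 d l f' (\<lambda>a b c. \<phi> b (a + c)) h' \<circ> lift13 S) (bas t)"
      using lift13_mid[OF S(1), of b "bas (a, c)"] lift13_mid[OF S(1), of "Suc b" "bas (a, c)"]
      by (simp add: t lin_simps lift13_mid[OF S(1)] int[unfolded One_nat_def])
  qed auto
  then show ?thesis by (metis comp_apply)
qed

lemma raise_scale: "raise c c' (\<lambda>a b. t * f a b) (\<lambda>a b. t * g a b) u = t \<cdot> raise c c' f g u"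
proof -
  have "raise c c' (\<lambda>a b. t * f a b) (\<lambda>a b. t * g a b) = (\<lambda>u. t \<cdot> raise c c' f g u)"
    by (rule lin_eqI) (auto simp: raise_bas smul_add intro!: lin_scale)
  then show ?thesis by meson
qed

text \<open>\<open>iota\<close> applied to the first of two factors.\<close>

definition iota_left :: "nat \<Rightarrow> (nat \<times> nat) vec \<Rightarrow> (nat \<times> nat \<times> nat) vec" where
  "iota_left d = act fst (\<lambda>(a, b) (i, c). (a, b, c)) (iota \<eta> d)"

lemma lin_iota_left [simp, intro]: "lin (iota_left d)"
  by (simp add: iota_left_def)

lemma iota_left_bas: "iota_left d (bas (i, c)) = s ^ i \<cdot> (if i \<le> d then bas (0, i, c) else 0) +
     tc d i \<cdot> (if i \<le> Suc d then bas (Suc 0, i - 1, c) else 0)"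
  by (auto simp: iota_left_def act_bas iota_bas)

text \<open>
  Raising the first factor becomes a combination of raising its two constituents. The two ways in which
  \<open>bas (1, i, c)\<close> arises from \<open>bas (i, c)\<close> give the second condition.
\<close>

lemma iota_left_raise:
  assumes "\<And>i c. f i c * s = G 0 i c"
    and "\<And>i c. s ^ i * F 0 i c + (if i = 0 then 0 else tc d i * G (Suc 0) (i - 1) c) = tc d (Suc i) * f i c"
    and "\<And>i c. g i c = H 0 i c" "\<And>i c. g (Suc i) c = H (Suc 0) i c"
  shows "iota_left d (raise (enat (Suc d)) (enat l) f g u) = raise3 d l F G H (iota_left d u)"
proof -
  have "iota_left d \<circ> raise (enat (Suc d)) (enat l) f g = raise3 d l F G H \<circ> iota_left d"
  proof (rule lin_eqI)
    fix t :: "nat \<times> nat"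
    obtain i c where t: "t = (i, c)" by (cases t)
    let ?X = "if i < d then bas (0, Suc i, c) else 0"
    let ?Y = "if i \<le> d then bas (Suc 0, i, c) else 0"
    let ?V = "if c < l then s ^ i \<cdot> (if i \<le> d then bas (0, i, Suc c) else 0) +
        tc d i \<cdot> (if i \<le> Suc d then bas (Suc 0, i - 1, Suc c) else 0) else 0"
    have 1: "iota_left d (raise (enat (Suc d)) (enat l) f g (bas (i, c))) =
        (s ^ i * (f i c * s)) \<cdot> ?X + (tc d (Suc i) * f i c) \<cdot> ?Y + g i c \<cdot> ?V"
      by (auto simp: raise_bas up1_def up2_def lin_simps iota_left_bas smul_add mult_ac)
    have 2: "raise3 d l F G H (iota_left d (bas (i, c))) = (s ^ i * G 0 i c) \<cdot> ?X +
        (s ^ i * F 0 i c + (if i = 0 then 0 else tc d i * G (Suc 0) (i - 1) c)) \<cdot> ?Y + g i c \<cdot> ?V"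
    proof (cases i)
      case 0
      then show ?thesis
        by (auto simp: iota_left_bas lin_simps raise3_bas smul_add add_smul assms(3) mult_ac)
    next
      case (Suc j)
      then show ?thesis using assms(3)[of "Suc j" c] assms(4)[of j c]
        by (auto simp: iota_left_bas lin_simps raise3_bas smul_add add_smul mult_ac)
    qed
    show "(iota_left d \<circ> raise (enat (Suc d)) (enat l) f g) (bas t) = (raise3 d l F G H \<circ> iota_left d) (bas t)"
      unfolding t comp_apply 1 2 assms(1,2) ..
  qed auto
  then show ?thesis by (metis comp_apply)
qed

text \<open>
  Fusion follows from cyclicity: both sides agree at the top state and intertwine the raising
  operators with the same operators on three factors. \<open>fusion_A\<close> and \<open>fusion_B\<close> compute these for the product
  of two \<open>R\<close>-operators, passing \<open>A\<close> and \<open>B\<close> through \<open>iota_left\<close> and then through one \<open>R\<close>-operator after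
  the other, and \<open>fusion_A'\<close> and \<open>fusion_B'\<close> compute them for the fused \<open>R\<close>-operator.
\<close>

context
  fixes d l :: nat and z za zb :: complex
  assumes za: "za = z / s ^ d" and zb: "zb = z * s"
    and ga: "goodz 1 l za" and gb: "goodz d l zb"
begin

lemma fusion_A:
  "lift13 (fRop 1 l za) (lift23 (fRop d l zb) (iota_left d (fA (Suc d) l z u))) =
   raise3 d l (\<lambda>a b c. s ^ d * Kc l c) (\<lambda>a b c. Kc 1 a * Kc l c / s) (\<lambda>a b c. z)
     (lift13 (fRop 1 l za) (lift23 (fRop d l zb) (iota_left d u)))"
proof -
  have 1: "iota_left d (fA (Suc d) l z u) =
    raise3 d l (\<lambda>a b c. s ^ d) (\<lambda>a b c. Kc 1 a / s) (\<lambda>a b c. Kc 1 a / s * (zb * Kc d b)) (iota_left d u)"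
    unfolding opA_def
  proof (rule iota_left_raise)
    have k: "p = s * s" by (simp add: s_s)
    show "1 * s = Kc 1 0 / s" by (simp add: k)
    show "s ^ i * s ^ d + (if i = 0 then 0 else tc d i * (Kc 1 (Suc 0) / s)) = tc d (Suc i) * 1" for i
      using tc_rec1[of i d] by (auto simp: Kc_def mult.commute)
    show "z * Kc (Suc d) i = Kc 1 0 / s * (zb * Kc d i)" for i
      by (simp add: Kc_def zb k)
    show "z * Kc (Suc d) (Suc i) = Kc 1 (Suc 0) / s * (zb * Kc d i)" for i
      by (simp add: Kc_def zb)
  qed
  have 2: "lift23 (fRop d l zb) (raise3 d l (\<lambda>a b c. s ^ d) (\<lambda>a b c. Kc 1 a / s) (\<lambda>a b c. Kc 1 a / s * (zb * Kc d b)) v) =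
    raise3 d l (\<lambda>a b c. s ^ d) (\<lambda>a b c. Kc 1 a / s * Kc l c) (\<lambda>a b c. Kc 1 a / s * zb) (lift23 (fRop d l zb) v)" for v
  proof (rule lift23_raise3[where \<phi> = "\<lambda>a n. s ^ d"])
    fix a u
    have "raise (enat d) (enat l) (\<lambda>b c. Kc 1 a / s) (\<lambda>b c. Kc 1 a / s * (zb * Kc d b)) v = (Kc 1 a / s) \<cdot> fA d l zb v"
      and "raise (enat d) (enat l) (\<lambda>b c. Kc 1 a / s * Kc l c) (\<lambda>b c. Kc 1 a / s * zb) v = (Kc 1 a / s) \<cdot> fA' d l zb v" for v
      unfolding op_defs raise_scale[symmetric] by simp_all
    then show "fRop d l zb (raise (enat d) (enat l) (\<lambda>b c. Kc 1 a / s) (\<lambda>b c. Kc 1 a / s * (zb * Kc d b)) u) =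
      raise (enat d) (enat l) (\<lambda>b c. Kc 1 a / s * Kc l c) (\<lambda>b c. Kc 1 a / s * zb) (fRop d l zb u)"
      by (simp add: lin_smul fRop_fA[OF gb])
  qed (auto simp: Rm_level)
  \<comment> \<open>Since \<open>zb / s = s ^ d * za\<close>, the coefficients left by the second factor are those that the first needs.\<close>
  have c: "Kc 1 a / s * zb = s ^ d * (za * Kc 1 a)" "Kc 1 a / s * Kc l c = Kc (1 + l) (a + c) / s" for a c
    using Kc_mult[of 1 a l c] by (simp_all add: za zb)
  have 3: "lift13 (fRop 1 l za) (raise3 d l (\<lambda>a b c. s ^ d) (\<lambda>a b c. Kc (1 + l) (a + c) / s) (\<lambda>a b c. s ^ d * (za * Kc 1 a)) v) =
    raise3 d l (\<lambda>a b c. s ^ d * Kc l c) (\<lambda>a b c. Kc (1 + l) (a + c) / s) (\<lambda>a b c. s ^ d * za) (lift13 (fRop 1 l za) v)" for v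
  proof (rule lift13_raise3[where \<phi> = "\<lambda>b n. Kc (1 + l) n / s"])
    fix b u
    have "raise (enat 1) (enat l) (\<lambda>a c. s ^ d) (\<lambda>a c. s ^ d * (za * Kc 1 a)) v = (s ^ d) \<cdot> fA 1 l za v"
      and "raise (enat 1) (enat l) (\<lambda>a c. s ^ d * Kc l c) (\<lambda>a c. s ^ d * za) v = (s ^ d) \<cdot> fA' 1 l za v" for v
      unfolding op_defs raise_scale[symmetric] by simp_all
    then show "fRop 1 l za (raise (enat 1) (enat l) (\<lambda>a c. s ^ d) (\<lambda>a c. s ^ d * (za * Kc 1 a)) u) =
      raise (enat 1) (enat l) (\<lambda>a c. s ^ d * Kc l c) (\<lambda>a c. s ^ d * za) (fRop 1 l za u)"
      by (simp add: lin_smul fRop_fA[OF ga] del: One_nat_def)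
  qed (auto simp: Rm_level)
  show ?thesis
    unfolding 1 2 c 3 unfolding Kc_mult[symmetric] by (simp add: za)
qed

lemma fusion_B:
  "lift13 (fRop 1 l za) (lift23 (fRop d l zb) (iota_left d (fB (Suc d) l z u))) =
   raise3 d l (\<lambda>a b c. za * Kc d b) (\<lambda>a b c. zb) (\<lambda>a b c. Kc d b * Kc 1 a)
     (lift13 (fRop 1 l za) (lift23 (fRop d l zb) (iota_left d u)))"
proof -
  have 1: "iota_left d (fB (Suc d) l z u) =
    raise3 d l (\<lambda>a b c. za * Kc (d + l) (b + c)) (\<lambda>a b c. zb * Kc l c) (\<lambda>a b c. 1) (iota_left d u)"
    unfolding opB_def
  proof (rule iota_left_raise)
    show "z * Kc l c * s = zb * Kc l c" for c by (simp add: zb)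
    show "s ^ i * (za * Kc (d + l) (i + c)) + (if i = 0 then 0 else tc d i * (zb * Kc l c)) = tc d (Suc i) * (z * Kc l c)" for i c
    proof -
      have "s ^ i * (za * Kc (d + l) (i + c)) + tc d i * (zb * Kc l c) =
         (s ^ i * (Kc d i / s ^ d) + tc d i * s) * (z * Kc l c)"
        unfolding za zb Kc_mult[symmetric] by (simp add: algebra_simps)
      then show ?thesis unfolding tc_rec2 by (cases i) auto
    qed
  qed auto
  have 2: "lift23 (fRop d l zb) (raise3 d l (\<lambda>a b c. za * Kc (d + l) (b + c)) (\<lambda>a b c. zb * Kc l c) (\<lambda>a b c. 1) v) =
    raise3 d l (\<lambda>a b c. za * Kc (d + l) (b + c)) (\<lambda>a b c. zb) (\<lambda>a b c. Kc d b) (lift23 (fRop d l zb) v)" for v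
    by (rule lift23_raise3[where \<phi> = "\<lambda>a n. za * Kc (d + l) n"])
      (use fRop_fB[OF gb] in \<open>auto simp: Rm_level opB_def opB'_def\<close>)
  have c: "za * Kc (d + l) (b + c) = Kc d b * (za * Kc l c)" for b c
    by (simp add: Kc_mult[symmetric])
  have 3: "lift13 (fRop 1 l za) (raise3 d l (\<lambda>a b c. Kc d b * (za * Kc l c)) (\<lambda>a b c. zb) (\<lambda>a b c. Kc d b) v) =
    raise3 d l (\<lambda>a b c. Kc d b * za) (\<lambda>a b c. zb) (\<lambda>a b c. Kc d b * Kc 1 a) (lift13 (fRop 1 l za) v)" for v
  proof (rule lift13_raise3[where \<phi> = "\<lambda>b n. zb"])
    fix b u
    have "raise (enat 1) (enat l) (\<lambda>a c. Kc d b * (za * Kc l c)) (\<lambda>a c. Kc d b) v = Kc d b \<cdot> fB 1 l za v"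
      and "raise (enat 1) (enat l) (\<lambda>a c. Kc d b * za) (\<lambda>a c. Kc d b * Kc 1 a) v = Kc d b \<cdot> fB' 1 l za v" for v
      unfolding op_defs raise_scale[symmetric] by simp_all
    then show "fRop 1 l za (raise (enat 1) (enat l) (\<lambda>a c. Kc d b * (za * Kc l c)) (\<lambda>a c. Kc d b) u) =
      raise (enat 1) (enat l) (\<lambda>a c. Kc d b * za) (\<lambda>a c. Kc d b * Kc 1 a) (fRop 1 l za u)"
      by (simp add: lin_smul fRop_fB[OF ga] del: One_nat_def)
  qed (auto simp: Rm_level)
  show ?thesis
    unfolding 1 2 unfolding c 3 by (simp add: mult.commute)
qed

lemma fusion_A':
  "iota_left d (fA' (Suc d) l z u) =
    raise3 d l (\<lambda>a b c. s ^ d * Kc l c) (\<lambda>a b c. Kc 1 a * Kc l c / s) (\<lambda>a b c. z) (iota_left d u)"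
  unfolding opA'_def
proof (rule iota_left_raise)
  show "Kc l c * s = Kc 1 0 * Kc l c / s" for c by (simp add: s_s[symmetric])
  show "s ^ i * (s ^ d * Kc l c) + (if i = 0 then 0 else tc d i * (Kc 1 (Suc 0) * Kc l c / s)) = tc d (Suc i) * Kc l c" for i c
  proof -
    have "s ^ i * (s ^ d * Kc l c) + tc d i * (Kc 1 (Suc 0) * Kc l c / s) = (s ^ i * s ^ d + tc d i / (s * p)) * Kc l c"
      by (simp add: Kc_Suc semiring_class.distrib_right)
    then show ?thesis unfolding tc_rec1 by (cases i) auto
  qed
qed auto

lemma fusion_B':
  "iota_left d (fB' (Suc d) l z u) =
    raise3 d l (\<lambda>a b c. za * Kc d b) (\<lambda>a b c. zb) (\<lambda>a b c. Kc d b * Kc 1 a) (iota_left d u)"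
  unfolding opB'_def
proof (rule iota_left_raise)
  show "z * s = zb" by (simp add: zb)
  show "s ^ i * (za * Kc d i) + (if i = 0 then 0 else tc d i * zb) = tc d (Suc i) * z" for i
  proof -
    have "s ^ i * (za * Kc d i) + tc d i * zb = (s ^ i * (Kc d i / s ^ d) + tc d i * s) * z"
      by (simp add: za zb semiring_class.distrib_right)
    then show ?thesis unfolding tc_rec2 by (cases i) auto
  qed
  show "Kc (Suc d) i = Kc d i * Kc 1 0" "Kc (Suc d) (Suc i) = Kc d i * Kc 1 (Suc 0)" for i
    by (simp_all add: Kc_def)
qed

theorem fusion_R:
  assumes "goodz (Suc d) l z" "u \<in> VV_space (Suc d) l"
  shows "iota_left d (fRop (Suc d) l z u) = lift13 (fRop 1 l za) (lift23 (fRop d l zb) (iota_left d u))"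
proof (rule fcyclic[where T = "\<lambda>u. iota_left d (fRop (Suc d) l z u)" and
      U = "\<lambda>u. lift13 (fRop 1 l za) (lift23 (fRop d l zb) (iota_left d u))", OF _ _ _ _ _ assms])
  show "lin (\<lambda>u. iota_left d (fRop (Suc d) l z u))"
    and "lin (\<lambda>u. lift13 (fRop 1 l za) (lift23 (fRop d l zb) (iota_left d u)))"
    by (rule linI; simp add: lin_simps)+
  show "iota_left d (fRop (Suc d) l z (bas (0, 0))) = lift13 (fRop 1 l za) (lift23 (fRop d l zb) (iota_left d (bas (0, 0))))"
    by (simp add: iota_left_bas lift_bas)
  fix a b
  assume eq: "iota_left d (fRop (Suc d) l z (bas (a, b))) = lift13 (fRop 1 l za) (lift23 (fRop d l zb) (iota_left d (bas (a, b))))"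
  show "iota_left d (fRop (Suc d) l z (fA (Suc d) l z (bas (a, b)))) =
      lift13 (fRop 1 l za) (lift23 (fRop d l zb) (iota_left d (fA (Suc d) l z (bas (a, b)))))"
    unfolding fRop_fA[OF assms(1)] fusion_A fusion_A' eq ..
  show "iota_left d (fRop (Suc d) l z (fB (Suc d) l z (bas (a, b)))) =
      lift13 (fRop 1 l za) (lift23 (fRop d l zb) (iota_left d (fB (Suc d) l z (bas (a, b)))))"
    unfolding fRop_fB[OF assms(1)] fusion_B fusion_B' eq ..
qed

end


section \<open>The degenerate point\<close>

text \<open>At this value of \<open>exp x\<close> the opposite raising operators preserve the image of \<open>iota\<close>.\<close>

definition z0 :: "nat \<Rightarrow> complex" where "z0 d = s ^ Suc d"

lemma z0_square: "(z0 d)\<^sup>2 = p ^ Suc d"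
  by (simp add: z0_def power2_eq_square power_mult_distrib[symmetric] s_s del: power_Suc)

lemma goodz_z0: "goodz 1 d (z0 d)"
  unfolding goodz_def
proof (intro allI impI)
  fix n assume "n < 1 + d"
  then have n: "p ^ Suc d = p ^ n * p ^ (Suc d - n)" "Suc d - n > 0" by (simp_all add: power_add[symmetric])
  have "Dn 1 d (z0 d) n = 1 - p ^ ((Suc d - n) * 2)"
    unfolding Dn_def z0_square Kc_def by (simp add: n(1)[simplified] power_mult power2_eq_square)
  then show "Dn 1 d (z0 d) n \<noteq> 0" using p_pow_neq_1[of "(Suc d - n) * 2"] n(2) by simp
qed

definition iota_raise :: "nat \<Rightarrow> nat vec \<Rightarrow> nat vec" where
  "iota_raise d = lin_ext (\<lambda>i. if i < Suc d then bas (Suc i) else 0)"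

lemma z0_iota:
  "fA' 1 d (z0 d) (iota \<eta> d v) = s ^ d \<cdot> iota \<eta> d (iota_raise d v)" (is ?first)
  "fB' 1 d (z0 d) (iota \<eta> d v) = s \<cdot> iota \<eta> d (iota_raise d v)" (is ?second)
proof -
  have A: "s ^ i * Kc d i + tc d i * z0 d = s ^ d * tc d (Suc i)" for i
  proof -
    have "s ^ i * Kc d i + tc d i * z0 d = s ^ d * (s ^ i * (Kc d i / s ^ d) + tc d i * s)"
      by (simp add: z0_def semiring_class.distrib_left)
    then show ?thesis unfolding tc_rec2 .
  qed
  have B: "s ^ i * z0 d + tc d i / p = s * tc d (Suc i)" for i
  proof -
    have "s ^ i * z0 d + tc d i / p = s * (s ^ i * s ^ d + tc d i / (s * p))"
      by (simp add: z0_def semiring_class.distrib_left)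
    then show ?thesis unfolding tc_rec1 .
  qed
  have g: "raise (enat 1) (enat d) f g (iota \<eta> d (bas i)) = c \<cdot> iota \<eta> d (iota_raise d (bas i))"
    if fg: "s ^ i * f 0 i + (if i = 0 then 0 else tc d i * g (Suc 0) (i - 1)) = c * tc d (Suc i)" "g 0 i = c * s" for f g c i
  proof -
    let ?X = "if i < d then bas (0, Suc i) else 0"
    let ?Y = "if i \<le> d then bas (Suc 0, i) else 0"
    have 1: "raise (enat 1) (enat d) f g (iota \<eta> d (bas i)) =
      (s ^ i * g 0 i) \<cdot> ?X + (s ^ i * f 0 i + (if i = 0 then 0 else tc d i * g (Suc 0) (i - 1))) \<cdot> ?Y"
      by (cases i) (auto simp: iota_bas raise_bas up1_def up2_def lin_simps smul_add add_smul zero_enat_def)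
    have 2: "c \<cdot> iota \<eta> d (iota_raise d (bas i)) = (s ^ i * (c * s)) \<cdot> ?X + (c * tc d (Suc i)) \<cdot> ?Y"
      by (auto simp: iota_raise_def iota_bas smul_add lin_zero mult_ac)
    show ?thesis unfolding 1 2 fg ..
  qed
  have "fA' 1 d (z0 d) \<circ> iota \<eta> d = (\<lambda>v. s ^ d \<cdot> iota \<eta> d (iota_raise d v))"
  proof (rule lin_eqI)
    fix i
    have "fA' 1 d (z0 d) (iota \<eta> d (bas i)) = s ^ d \<cdot> iota \<eta> d (iota_raise d (bas i))"
      unfolding opA'_def by (rule g) (use A[of i] in \<open>auto simp: z0_def\<close>)
    then show "(fA' 1 d (z0 d) \<circ> iota \<eta> d) (bas i) = s ^ d \<cdot> iota \<eta> d (iota_raise d (bas i))" by simp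
  qed (auto intro!: linI simp: lin_simps iota_raise_def smul_add mult_ac)
  then show ?first by (metis comp_apply)
  have "fB' 1 d (z0 d) \<circ> iota \<eta> d = (\<lambda>v. s \<cdot> iota \<eta> d (iota_raise d v))"
  proof (rule lin_eqI)
    fix i
    have "fB' 1 d (z0 d) (iota \<eta> d (bas i)) = s \<cdot> iota \<eta> d (iota_raise d (bas i))"
      unfolding opB'_def by (rule g) (use B[of i] in \<open>auto simp: Kc_def s_s\<close>)
    then show "(fB' 1 d (z0 d) \<circ> iota \<eta> d) (bas i) = s \<cdot> iota \<eta> d (iota_raise d (bas i))" by simp
  qed (auto intro!: linI simp: lin_simps iota_raise_def smul_add mult_ac)
  then show ?second by (metis comp_apply)
qed

lemma iota_top: "iota \<eta> d (bas 0) = bas (0, 0)"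
  by (simp add: iota_bas)

text \<open>The recursion starts at the top state, which is in the image of \<open>iota\<close>, and never leaves that image.\<close>

lemma fRop_z0_range: "\<exists>v. fRop 1 d (z0 d) u = iota \<eta> d v"
proof -
  have diff: "\<exists>v. c \<cdot> (X - e \<cdot> Y) = iota \<eta> d v" if XY: "\<exists>v. X = iota \<eta> d v" "\<exists>v. Y = iota \<eta> d v" for c e X Y
  proof -
    obtain v w where "X = iota \<eta> d v" "Y = iota \<eta> d w" using XY by blast
    then show ?thesis by (intro exI[of _ "c \<cdot> (v - e \<cdot> w)"]) (simp add: lin_simps)
  qed
  have A: "\<exists>v. fA' 1 d (z0 d) X = iota \<eta> d v" and B: "\<exists>v. fB' 1 d (z0 d) X = iota \<eta> d v"
    if X: "\<exists>v. X = iota \<eta> d v" for X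
  proof -
    obtain v where v: "X = iota \<eta> d v" using X by blast
    show "\<exists>v. fA' 1 d (z0 d) X = iota \<eta> d v"
      unfolding v z0_iota by (rule exI[of _ "s ^ d \<cdot> iota_raise d v"]) (simp add: lin_smul)
    show "\<exists>v. fB' 1 d (z0 d) X = iota \<eta> d v"
      unfolding v z0_iota by (rule exI[of _ "s \<cdot> iota_raise d v"]) (simp add: lin_smul)
  qed
  have a0: "\<exists>v. Rm (enat 1) (enat d) 1 d (z0 d) a 0 = iota \<eta> d v" for a
  proof (induction a)
    case 0
    show ?case unfolding Rm.simps by (rule exI, rule iota_top[symmetric])
  next
    case (Suc a)
    show ?case unfolding Rm.simps by (intro diff A B Suc)
  qed
  have "\<exists>v. Rm (enat 1) (enat d) 1 d (z0 d) a b = iota \<eta> d v" for a b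
  proof (induction b)
    case 0
    show ?case by (rule a0)
  next
    case (Suc b)
    show ?case unfolding Rm.simps by (intro diff A B Suc)
  qed
  then obtain V where V: "\<And>a b. Rm (enat 1) (enat d) 1 d (z0 d) a b = iota \<eta> d (V a b)" by metis
  have "fRop 1 d (z0 d) = iota \<eta> d \<circ> lin_ext (\<lambda>(a, b). V a b)"
    by (rule lin_eqI) (auto simp: V simp del: One_nat_def)
  then show ?thesis by (metis comp_apply)
qed

text \<open>Conversely, raising from the top state reaches the whole image of \<open>iota\<close>.\<close>

lemma iota_in_z0_range: "\<exists>u. iota \<eta> d v = fRop 1 d (z0 d) u"
proof -
  have ex: "\<exists>u. iota \<eta> d (bas i) = fRop 1 d (z0 d) u" for i
  proof (induction i)
    case 0
    then show ?case by (metis iota_top Rop_bas Rm.simps(1))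
  next
    case (Suc i)
    then obtain u where u: "iota \<eta> d (bas i) = fRop 1 d (z0 d) u" by blast
    show ?case
    proof (cases "i < Suc d")
      case True
      then have "s \<cdot> iota \<eta> d (bas (Suc i)) = fB' 1 d (z0 d) (iota \<eta> d (bas i))"
        unfolding z0_iota by (simp add: iota_raise_def)
      also have "\<dots> = fRop 1 d (z0 d) (fB 1 d (z0 d) u)" unfolding u fRop_fB[OF goodz_z0] ..
      finally have "iota \<eta> d (bas (Suc i)) = (1 / s) \<cdot> fRop 1 d (z0 d) (fB 1 d (z0 d) u)"
        by (metis smul_smul smul_one s_nz divide_self_if times_divide_eq_left mult_1)
      then show ?thesis by (metis lin_smul lin_Rop)
    next
      case False
      then have "iota \<eta> d (bas (Suc i)) = 0" by (simp add: iota_bas)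
      then show ?thesis by (metis lin_zero lin_Rop)
    qed
  qed
  then obtain U where U: "\<And>i. iota \<eta> d (bas i) = fRop 1 d (z0 d) (U i)" by metis
  have "iota \<eta> d = fRop 1 d (z0 d) \<circ> lin_ext U"
    by (rule lin_eqI) (auto simp: U simp del: One_nat_def)
  then show ?thesis by (metis comp_apply)
qed

end


section \<open>Families of operators on finite-dimensional coordinate spaces\<close>

text \<open>
  \<open>Q\<close> is a property of functions such as continuity at a point or being meromorphic; the properties of
  interest are closed under products of operators.
\<close>

definition entries :: "((complex \<Rightarrow> complex) \<Rightarrow> bool) \<Rightarrow> 'a set \<Rightarrow> 'b set \<Rightarrow>
    (complex \<Rightarrow> 'a vec \<Rightarrow> 'b vec) \<Rightarrow> bool" where
  "entries Q A B T \<longleftrightarrow> (\<forall>t. linear_map (coord_space A) (coord_space B) (T t)) \<and>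
     (\<forall>a\<in>A. \<forall>b\<in>B. Q (\<lambda>t. mcoeff (T t) a b))"

definition closed_ring :: "((complex \<Rightarrow> complex) \<Rightarrow> bool) \<Rightarrow> bool" where
  "closed_ring Q \<longleftrightarrow> (\<forall>c. Q (\<lambda>_. c)) \<and> (\<forall>f g. Q f \<longrightarrow> Q g \<longrightarrow> Q (\<lambda>t. f t + g t)) \<and>
     (\<forall>f g. Q f \<longrightarrow> Q g \<longrightarrow> Q (\<lambda>t. f t * g t))"

lemma closed_ring_isCont: "closed_ring (\<lambda>f. isCont f t0)"
  by (auto simp: closed_ring_def intro!: continuous_intros)

lemma closed_ring_meromorphic: "closed_ring (\<lambda>f. f meromorphic_on UNIV)"
  by (auto simp: closed_ring_def intro!: meromorphic_intros)

lemma closed_ring_sum: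
  assumes "closed_ring Q" "\<And>i. i \<in> I \<Longrightarrow> Q (f i)"
  shows "Q (\<lambda>t. \<Sum>i\<in>I. f i t)"
  using assms by (induction I rule: infinite_finite_induct) (auto simp: closed_ring_def)

lemma linear_map_lookup:
  assumes T: "linear_map (coord_space A) W T" and "finite A" "u \<in> coord_space A"
  shows "Poly_Mapping.lookup (T u) b = (\<Sum>a\<in>A. Poly_Mapping.lookup u a * mcoeff T a b)"
proof -
  have "Poly_Mapping.lookup (T u) b = (\<Sum>a\<in>Poly_Mapping.keys u. Poly_Mapping.lookup u a * mcoeff T a b)"
    unfolding linear_map_expand[OF T assms(3)] by (simp add: lookup_sum mcoeff_def)
  also have "\<dots> = (\<Sum>a\<in>A. Poly_Mapping.lookup u a * mcoeff T a b)"
    by (rule sum.mono_neutral_left) (use assms in \<open>auto simp: coord_space_def in_keys_iff\<close>)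
  finally show ?thesis .
qed

lemma entries_comp:
  assumes Q: "closed_ring Q" and T: "entries Q A B T" and S: "entries Q B C S" and "finite B"
  shows "entries Q A C (\<lambda>t. S t \<circ> T t)"
proof -
  have lT: "linear_map (coord_space A) (coord_space B) (T t)"
    and lS: "linear_map (coord_space B) (coord_space C) (S t)" for t
    using T S by (auto simp: entries_def)
  have "linear_map (coord_space A) (coord_space C) (S t \<circ> T t)" for t
    using lT[of t] lS[of t] by (auto simp: linear_map_def)
  moreover have "Q (\<lambda>t. mcoeff (S t \<circ> T t) a c)" if "a \<in> A" "c \<in> C" for a c
  proof -
    have "T t (bas a) \<in> coord_space B" for t
      using lT[of t] that by (auto simp: linear_map_def)
    then have "mcoeff (S t \<circ> T t) a c = (\<Sum>b\<in>B. mcoeff (T t) a b * mcoeff (S t) b c)" for t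
      using linear_map_lookup[OF lS \<open>finite B\<close>] by (simp add: mcoeff_def)
    then show ?thesis
      using T S Q that unfolding entries_def
      by (auto intro!: closed_ring_sum[OF Q] simp: closed_ring_def)
  qed
  ultimately show ?thesis by (simp add: entries_def)
qed

lemma entries_const:
  assumes "closed_ring Q" "lin T" "\<And>a. a \<in> A \<Longrightarrow> T (bas a) \<in> coord_space B"
  shows "entries Q A B (\<lambda>_. T)"
  using assms lin_in_coord_space[OF assms(2,3)]
  by (auto simp: entries_def closed_ring_def intro!: lin_imp_linear_map)

lemma lookup_tens: "Poly_Mapping.lookup (tens u v) (a, b) = Poly_Mapping.lookup u a * Poly_Mapping.lookup v b"
proof (rule functional_eqI[where \<phi> = "\<lambda>u. Poly_Mapping.lookup (tens u v) (a, b)"])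
  fix i
  show "Poly_Mapping.lookup (tens (bas i) v) (a, b) = Poly_Mapping.lookup (bas i) a * Poly_Mapping.lookup v b"
    by (rule functional_eqI[where \<phi> = "\<lambda>v. Poly_Mapping.lookup (tens (bas i) v) (a, b)"])
      (auto simp: lookup_add lookup_bas algebra_simps)
qed (auto simp: lookup_add algebra_simps)

lemma tens_coord_space:
  "u \<in> coord_space A \<Longrightarrow> v \<in> coord_space B \<Longrightarrow> tens u v \<in> coord_space (A \<times> B)"
  unfolding coord_space_def by (auto simp: in_keys_iff lookup_tens)

lemma entries_op1:
  assumes "closed_ring Q" "entries Q A B T"
  shows "entries Q (A \<times> C) (B \<times> C) (\<lambda>t. op1 (T t))"
proof -
  have Tb: "T t (bas a) \<in> coord_space B" if "a \<in> A" for t a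
    using assms(2) that by (auto simp: entries_def linear_map_def)
  have "linear_map (coord_space (A \<times> C)) (coord_space (B \<times> C)) (op1 (T t))" for t
  proof (rule lin_imp_linear_map[OF lin_op1])
    fix u assume u: "u \<in> coord_space (A \<times> C)"
    show "op1 (T t) u \<in> coord_space (B \<times> C)"
      by (rule lin_in_coord_space[OF lin_op1 _ u]) (use Tb in \<open>auto simp: op1_def intro!: tens_coord_space\<close>)
  qed
  moreover have "mcoeff (op1 (T t)) (a, c) (b, c') = mcoeff (T t) a b * (if c = c' then 1 else 0)" for t a b c c'
    by (simp add: mcoeff_def op1_def lookup_tens lookup_bas)
  ultimately show ?thesis
    using assms unfolding entries_def closed_ring_def by auto
qed

lemma entries_op2:
  assumes "closed_ring Q" "entries Q A B T"
  shows "entries Q (C \<times> A) (C \<times> B) (\<lambda>t. op2 (T t))"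
proof -
  have Tb: "T t (bas a) \<in> coord_space B" if "a \<in> A" for t a
    using assms(2) that by (auto simp: entries_def linear_map_def)
  have "linear_map (coord_space (C \<times> A)) (coord_space (C \<times> B)) (op2 (T t))" for t
  proof (rule lin_imp_linear_map[OF lin_op2])
    fix u assume u: "u \<in> coord_space (C \<times> A)"
    show "op2 (T t) u \<in> coord_space (C \<times> B)"
      by (rule lin_in_coord_space[OF lin_op2 _ u]) (use Tb in \<open>auto simp: op2_def intro!: tens_coord_space\<close>)
  qed
  moreover have "mcoeff (op2 (T t)) (c, a) (c', b) = (if c = c' then 1 else 0) * mcoeff (T t) a b" for t a b c c'
    by (simp add: mcoeff_def op2_def lookup_tens lookup_bas)
  ultimately show ?thesis
    using assms unfolding entries_def closed_ring_def by auto
qed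


text \<open>An identity that holds in a punctured neighbourhood of \<open>t0\<close> extends to \<open>t0\<close> by continuity.\<close>

lemma entries_eq_limit:
  assumes T: "entries (\<lambda>f. isCont f t0) A B T" and U: "entries (\<lambda>f. isCont f t0) A B U"
    and eq: "\<forall>\<^sub>F t in at t0. \<forall>u\<in>coord_space A. T t u = U t u" and u: "u \<in> coord_space A"
  shows "T t0 u = U t0 u"
proof (rule linear_map_eq_on[where C = A, OF _ _ _ u])
  fix a assume a: "a \<in> A"
  show "T t0 (bas a) = U t0 (bas a)"
  proof (rule poly_mapping_eqI)
    fix b
    show "Poly_Mapping.lookup (T t0 (bas a)) b = Poly_Mapping.lookup (U t0 (bas a)) b"
    proof (cases "b \<in> B")
      case True
      have lT: "((\<lambda>t. mcoeff (T t) a b) \<longlongrightarrow> mcoeff (T t0) a b) (at t0)"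
        and lU: "((\<lambda>t. mcoeff (U t) a b) \<longlongrightarrow> mcoeff (U t0) a b) (at t0)"
        using T U a True by (auto simp: entries_def isCont_def)
      have "\<forall>\<^sub>F t in at t0. mcoeff (U t) a b = mcoeff (T t) a b"
        using eq by eventually_elim (use a in \<open>simp add: mcoeff_def\<close>)
      from tendsto_unique[OF at_neq_bot lT iffD1[OF tendsto_cong[OF this] lU]]
      have "mcoeff (T t0) a b = mcoeff (U t0) a b" .
      then show ?thesis by (simp add: mcoeff_def)
    next
      case False
      have "T t0 (bas a) \<in> coord_space B" "U t0 (bas a) \<in> coord_space B"
        using T U a by (auto simp: entries_def linear_map_def)
      then show ?thesis using False unfolding coord_space_def
        by (metis (lifting) in_keys_iff mem_Collect_eq subsetD)
    qed
  qed
qed (use T U in \<open>auto simp: entries_def\<close>)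

text \<open>Statements that hold in a punctured neighbourhood of every point.\<close>

definition generic :: "(complex \<Rightarrow> bool) \<Rightarrow> bool" where
  "generic P \<longleftrightarrow> (\<forall>x0. \<forall>\<^sub>F x in at x0. P x)"

lemma generic_affine:
  assumes "generic P" "c \<noteq> 0"
  shows "\<forall>\<^sub>F t in at t0. P (x + c * t)"
proof -
  have "filterlim (\<lambda>t. x + c * t) (at (x + c * t0)) (at t0)"
    unfolding filterlim_at using assms(2)
    by (auto intro!: tendsto_intros simp: eventually_at_filter)
  moreover have "\<forall>\<^sub>F y in at (x + c * t0). P y" using assms(1) by (simp add: generic_def)
  ultimately show ?thesis using eventually_compose_filterlim by blast
qed

lemma generic_ball: "finite I \<Longrightarrow> (\<And>i. i \<in> I \<Longrightarrow> generic (P i)) \<Longrightarrow> generic (\<lambda>x. \<forall>i\<in>I. P i x)"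
  by (simp add: generic_def eventually_ball_finite)

lemma generic_poly_exp:
  assumes "q \<noteq> 0"
  shows "generic (\<lambda>x. poly q (exp x) \<noteq> 0)"
proof -
  have "{x. poly q (exp x) = 0} \<noteq> UNIV"
    using countable_poly_exp[OF assms] uncountable_UNIV_complex by metis
  then obtain \<beta> where \<beta>: "poly q (exp \<beta>) \<noteq> 0" by auto
  show ?thesis
    unfolding generic_def
  proof
    fix x0
    have "\<forall>\<^sub>F x in at x0. poly q (exp x) \<noteq> 0 \<and> x \<in> UNIV"
      by (rule non_zero_neighbour_alt[where \<beta> = \<beta>]) (use \<beta> in \<open>auto intro!: holomorphic_intros\<close>)
    then show "\<forall>\<^sub>F x in at x0. poly q (exp x) \<noteq> 0" by simp
  qed
qed

lemma generic_analytic: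
  assumes "f meromorphic_on UNIV"
  shows "generic (\<lambda>x. f analytic_on {x})"
  unfolding generic_def
proof
  fix x0
  have "isolated_singularity_at f x0"
    using assms meromorphic_on_isolated_singularity meromorphic_on_subset by blast
  then obtain r where r: "r > 0" "f analytic_on ball x0 r - {x0}"
    unfolding isolated_singularity_at_def by blast
  have "\<forall>\<^sub>F x in at x0. x \<in> ball x0 r - {x0}"
    using eventually_at_ball[OF r(1), of x0 UNIV] by (auto simp: eventually_at_filter elim: eventually_mono)
  then show "\<forall>\<^sub>F x in at x0. f analytic_on {x}"
    by eventually_elim (use r(2) analytic_on_subset in blast)
qed

lemma generic_regular:
  assumes "finite B" "\<And>a b. a \<in> B \<Longrightarrow> b \<in> B \<Longrightarrow> (\<lambda>z. mcoeff (T z) a b) meromorphic_on UNIV"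
  shows "generic (regular_at B T)"
  unfolding regular_at_def using assms by (intro generic_ball generic_analytic)

lemma poly_exp_analytic [analytic_intros]: "(\<lambda>x. poly q (exp x)) analytic_on S"
  by (induction q) (auto intro!: analytic_intros)

lemma rational_in_exp_meromorphic:
  assumes "rational_in_exp f"
  shows "f meromorphic_on UNIV"
proof -
  obtain p q where f: "\<And>x. f x = poly p (exp x) / poly q (exp x)"
    using assms unfolding rational_in_exp_def by blast
  have "(\<lambda>x. poly p (exp x) / poly q (exp x)) meromorphic_on UNIV"
    by (intro meromorphic_on_divide analytic_on_imp_meromorphic_on analytic_intros)
  then show ?thesis unfolding f[symmetric] .
qed

lemma entries_isCont_compose:
  assumes T: "\<And>x. linear_map (coord_space B) (coord_space B) (T x)"
    and reg: "regular_at B T (g t0)" and g: "isCont g t0"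
  shows "entries (\<lambda>f. isCont f t0) B B (\<lambda>t. T (g t))"
  unfolding entries_def
proof (intro conjI allI ballI)
  fix a b assume "a \<in> B" "b \<in> B"
  then have "isCont (\<lambda>z. mcoeff (T z) a b) (g t0)"
    using reg analytic_at_imp_isCont by (auto simp: regular_at_def)
  from isCont_o2[OF g this] show "isCont (\<lambda>t. mcoeff (T (g t)) a b) t0" .
qed (use T in auto)

lemma entries_meromorphic_compose:
  assumes T: "\<And>x. linear_map (coord_space B) (coord_space B) (T x)"
    and mero: "\<And>a b. a \<in> B \<Longrightarrow> b \<in> B \<Longrightarrow> (\<lambda>z. mcoeff (T z) a b) meromorphic_on UNIV"
    and g: "g analytic_on UNIV"
  shows "entries (\<lambda>f. f meromorphic_on UNIV) B B (\<lambda>t. T (g t))"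
  unfolding entries_def
proof (intro conjI allI ballI)
  fix a b assume "a \<in> B" "b \<in> B"
  from meromorphic_on_compose[OF mero[OF this] g] show "(\<lambda>t. mcoeff (T (g t)) a b) meromorphic_on UNIV"
    by simp
qed (use T in auto)

context nonroot
begin

lemma good_goodz: "good d l x \<longleftrightarrow> goodz d l (exp x)"
  by (simp add: good_def goodz_def)

lemma generic_good: "generic (good d l)"
proof -
  have "generic (\<lambda>x. \<forall>n\<in>{..<d + l}. poly (DnP d l n) (exp x) \<noteq> 0)"
    by (intro generic_ball generic_poly_exp) auto
  then show ?thesis by (simp add: good_def[abs_def] poly_DnP Ball_def)
qed

lemma good_commute: "good d l x \<longleftrightarrow> good l d x"
  by (simp add: good_def Dn_commute[of l d] add.commute)

lemma fS_VV: "fS d l x u \<in> VV_space d l"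
  by (simp add: fS_def pr2_VV)

lemma linear_map_fS: "linear_map (coord_space ({..d} \<times> {..l})) (coord_space ({..d} \<times> {..l})) (fS d l x)"
  using fS_VV by (intro lin_imp_linear_map) (auto simp: VV_space_def)

lemma fS_meromorphic: "(\<lambda>x. mcoeff (fS d l x) a b) meromorphic_on UNIV"
  by (rule rational_in_exp_meromorphic[OF fS_rational])

text \<open>At a good point the denominators of the matrix coefficients do not vanish.\<close>

lemma rc_analytic:
  assumes "\<forall>i<a + b. Dn d l (exp x) i \<noteq> 0"
  shows "rc d l a b i j analytic_on {x}"
proof -
  obtain r where r: "\<And>z. Poly_Mapping.lookup (Rm \<infinity> \<infinity> d l z a b) (i, j) = poly r z / (\<Prod>i<a + b. Dn d l z i)"
    using bounded_denominator_Rm[of d l a b i j] unfolding bounded_denominator_def by blast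
  define q where "q = (\<Prod>i<a + b. DnP d l i)"
  have q: "poly q z = (\<Prod>i<a + b. Dn d l z i)" for z
    by (simp add: q_def poly_prod poly_DnP)
  have "poly q (exp x) \<noteq> 0" using assms by (simp add: q)
  moreover have "isCont (\<lambda>y. poly q (exp y)) x" by (intro continuous_intros)
  ultimately have "\<forall>\<^sub>F y in nhds x. poly q (exp y) \<noteq> 0"
    by (simp add: isCont_def tendsto_imp_eventually_ne eventually_nhds_conv_at)
  then have ev: "\<forall>\<^sub>F y in nhds x. rc d l a b i j y = poly r (exp y) / poly q (exp y)"
  proof eventually_elim
    case (elim y)
    then have "\<forall>i<a + b. Dn d l (exp y) i \<noteq> 0" by (auto simp: q)
    from rc_eq[OF this, of i j] show ?case by (simp add: r q)
  qed
  have an: "(\<lambda>y. poly r (exp y) / poly q (exp y)) analytic_on {x}"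
    using \<open>poly q (exp x) \<noteq> 0\<close> by (auto intro!: analytic_intros)
  show ?thesis by (rule iffD2[OF analytic_at_cong[OF ev HOL.refl] an])
qed

lemma good_imp_regular:
  assumes "good d l x"
  shows "R_regular_at \<eta> d l x"
  unfolding R_regular_at_def regular_at_def fin_R_eq
proof (intro ballI)
  fix s t assume st: "s \<in> {..d} \<times> {..l}" "t \<in> {..d} \<times> {..l}"
  then obtain a b i j where ab: "s = (a, b)" "t = (i, j)" "a \<le> d" "b \<le> l" "i \<le> d" "j \<le> l" by auto
  have "mcoeff (fS d l y) s t = (if i + j = a + b then rc d l a b i j y else 0)" for y
    unfolding mcoeff_def ab fS_coeff using ab by auto
  moreover have "rc d l a b i j analytic_on {x}"
    using assms ab by (intro rc_analytic) (auto simp: good_def)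
  ultimately show "(\<lambda>y. mcoeff (fS d l y) s t) analytic_on {x}"
    by (cases "i + j = a + b") auto
qed

text \<open>
  At good arguments this is the flip symmetry; it holds at all others since the coefficients are reduced
  fractions.
\<close>

lemma fin_R21_fS: "fin_R21 \<eta> l d x = fS d l x"
proof -
  have "fin_R21 \<eta> l d x (bas s) = fS d l x (bas s)" for s
  proof (rule poly_mapping_eqI)
    fix t :: "nat \<times> nat"
    obtain a b i j where st: "s = (a, b)" "t = (i, j)" by (cases s; cases t)
    have perm: "Poly_Mapping.lookup (perm u) (i, j) = Poly_Mapping.lookup u (j, i)" for u :: "(nat \<times> nat) vec" and i j
      by (rule functional_eqI[where \<phi> = "\<lambda>u. Poly_Mapping.lookup (perm u) (i, j)"])
        (auto simp: lookup_add lookup_bas split: if_splits)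
    have c: "mcoeff (fin_R21 \<eta> l d x) s t = mcoeff (fS l d x) (b, a) (j, i)" for x
      by (simp add: mcoeff_def fin_R21_def fin_R_eq st perm)
    have "(\<lambda>x. mcoeff (fin_R21 \<eta> l d x) s t) = (\<lambda>x. mcoeff (fS d l x) s t)"
    proof (rule rational_in_exp_unique[where Z = "bad d l"])
      show "rational_in_exp (\<lambda>x. mcoeff (fin_R21 \<eta> l d x) s t)" unfolding c by (rule fS_rational)
      fix x assume "x \<notin> bad d l"
      then have "good d l x" by (auto simp: good_def bad_def)
      then show "mcoeff (fin_R21 \<eta> l d x) s t = mcoeff (fS d l x) s t"
        by (simp add: fin_R21_eq fin_R_eq)
    qed (auto simp: fS_rational countable_bad)
    from fun_cong[OF this, of x] show "Poly_Mapping.lookup (fin_R21 \<eta> l d x (bas s)) t = Poly_Mapping.lookup (fS d l x (bas s)) t"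
      by (simp add: mcoeff_def)
  qed
  then show ?thesis
    by (intro lin_eqI) (auto simp: fin_R21_def fin_R_eq intro!: lin_comp)
qed

end


section \<open>K-operators extended to the ambient space\<close>

text \<open>
  A family of \<open>K\<close>-operators is linear on \<open>V_space d\<close> only. This version is linear on the ambient space and
  agrees with it on \<open>V_space d\<close>.
\<close>

definition K_ext :: "nat \<Rightarrow> (complex \<Rightarrow> nat vec \<Rightarrow> nat vec) \<Rightarrow> complex \<Rightarrow> nat vec \<Rightarrow> nat vec" where
  "K_ext d K x = lin_ext (\<lambda>i. if i \<le> d then K x (bas i) else 0)"

lemma lin_K_ext [simp, intro]: "lin (K_ext d K x)"
  by (simp add: K_ext_def)

lemma K_ext_bas: "K_ext d K x (bas i) = (if i \<le> d then K x (bas i) else 0)"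
  by (simp add: K_ext_def)

lemma meromorphic_K_linear:
  "meromorphic_K d K \<Longrightarrow> linear_map (coord_space {..d}) (coord_space {..d}) (K x)"
  by (simp add: meromorphic_K_def meromorphic_operator_def)

lemma K_bas_V: "meromorphic_K d K \<Longrightarrow> i \<le> d \<Longrightarrow> K x (bas i) \<in> coord_space {..d}"
  using meromorphic_K_linear[of d K x] by (auto simp: linear_map_def)

lemma K_ext_V: "meromorphic_K d K \<Longrightarrow> K_ext d K x u \<in> coord_space {..d}"
  using lin_in_coord_space[of "K_ext d K x" UNIV "{..d}" u] K_bas_V[of d K] by (auto simp: K_ext_bas)

lemma K_ext_linear_map: "meromorphic_K d K \<Longrightarrow> linear_map (coord_space {..d}) (coord_space {..d}) (K_ext d K x)"
  by (rule lin_imp_linear_map) (auto simp: K_ext_V)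

lemma K_ext_eq: "meromorphic_K d K \<Longrightarrow> u \<in> coord_space {..d} \<Longrightarrow> K_ext d K x u = K x u"
  by (rule linear_map_eq_on[OF K_ext_linear_map meromorphic_K_linear]) (auto simp: K_ext_bas)

lemma regular_K_ext: "regular_at {..d} (K_ext d K) x \<longleftrightarrow> K_regular_at d K x"
  by (simp add: K_regular_at_def regular_at_def mcoeff_def K_ext_bas)

lemma generic_K_regular: "meromorphic_K d K \<Longrightarrow> generic (K_regular_at d K)"
  unfolding K_regular_at_def[abs_def]
  by (rule generic_regular) (auto simp: meromorphic_K_def meromorphic_operator_def)

lemma K_ext_meromorphic:
  "meromorphic_K d K \<Longrightarrow> i \<le> d \<Longrightarrow> j \<le> d \<Longrightarrow> (\<lambda>x. mcoeff (K_ext d K x) i j) meromorphic_on UNIV"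
  by (simp add: mcoeff_def K_ext_bas meromorphic_K_def meromorphic_operator_def)

lemma op1_K_ext:
  assumes "meromorphic_K d K" "u \<in> VV_space d l"
  shows "op1 (K x) u = op1 (K_ext d K x) u" "op1 (K_ext d K x) u \<in> VV_space d l"
proof -
  show "op1 (K x) u = op1 (K_ext d K x) u"
    using assms(2) unfolding VV_space_def by (rule lin_eq_on[rotated 3]) (auto simp: op1_def K_ext_bas)
  show "op1 (K_ext d K x) u \<in> VV_space d l"
    unfolding VV_space_def
    by (rule lin_in_coord_space[OF lin_op1 _ assms(2)[unfolded VV_space_def]])
      (use K_ext_V[OF assms(1)] in \<open>auto simp: op1_def intro!: tens_coord_space\<close>)
qed

lemma op2_K_ext:
  assumes "meromorphic_K l L" "u \<in> VV_space d l"
  shows "op2 (L x) u = op2 (K_ext l L x) u" "op2 (K_ext l L x) u \<in> VV_space d l"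
proof -
  show "op2 (L x) u = op2 (K_ext l L x) u"
    using assms(2) unfolding VV_space_def by (rule lin_eq_on[rotated 3]) (auto simp: op2_def K_ext_bas)
  show "op2 (K_ext l L x) u \<in> VV_space d l"
    unfolding VV_space_def
    by (rule lin_in_coord_space[OF lin_op2 _ assms(2)[unfolded VV_space_def]])
      (use K_ext_V[OF assms(1)] in \<open>auto simp: op2_def intro!: tens_coord_space\<close>)
qed

lemma perm_op: "perm (op1 T u) = op2 T (perm u)" "perm (op2 T u) = op1 T (perm u)"
proof -
  have "perm \<circ> op1 T = op2 T \<circ> perm" by (rule lin_eqI) (auto simp: op1_def op2_def)
  then show "perm (op1 T u) = op2 T (perm u)" by (metis comp_apply)
  have "perm \<circ> op2 T = op1 T \<circ> perm" by (rule lin_eqI) (auto simp: op1_def op2_def)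
  then show "perm (op2 T u) = op1 T (perm u)" by (metis comp_apply)
qed

context nonroot
begin


section \<open>The reflection equation\<close>

text \<open>The reflection equation at a single pair of arguments, on the ambient space, with \<open>R\<^sub>2\<^sub>1 = R\<close> inserted.\<close>

definition RE where
  "RE d l K L x y \<longleftrightarrow> (\<forall>u.
     fS d l (x - y) (op1 (K_ext d K x) (fS d l (x + y) (op2 (K_ext l L y) u))) =
     op2 (K_ext l L y) (fS d l (x + y) (op1 (K_ext d K x) (fS d l (x - y) u))))"

lemma fS_pr2: "fS d l x (pr2 d l u) = fS d l x u"
  by (simp add: fS_def pr2_id pr2_VV)

lemma pr2_op_K_ext:
  assumes "meromorphic_K d K"
  shows "pr2 d l (op1 (K_ext d K x) u) = op1 (K_ext d K x) (pr2 d l u)" (is ?first)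
    and "pr2 l d (op2 (K_ext d K x) u) = op2 (K_ext d K x) (pr2 l d u)" (is ?second)
proof -
  have 1: "pr2 d l \<circ> op1 (K_ext d K x) = op1 (K_ext d K x) \<circ> pr2 d l"
  proof (rule lin_eqI)
    fix s :: "nat \<times> nat"
    obtain a b where s: "s = (a, b)" by (cases s)
    show "(pr2 d l \<circ> op1 (K_ext d K x)) (bas s) = (op1 (K_ext d K x) \<circ> pr2 d l) (bas s)"
    proof (cases "a \<le> d \<and> b \<le> l")
      case True
      then have "bas s \<in> VV_space d l" by (simp add: s VV_space_def)
      then show ?thesis using op1_K_ext(2)[OF assms] by (simp add: pr2_id)
    next
      case False
      then have "tens_op (pr_V d) (pr_V l) (tens (K_ext d K x (bas a)) (bas b)) = 0"
      proof (cases "a \<le> d")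
        case True
        then have "b > l" using False by simp
        then have "lin_ext (\<lambda>i. tens_op (pr_V d) (pr_V l) (bas (i, b))) v = 0" for v
          by (simp add: pr_V_def lin_ext_def)
        then show ?thesis by (simp add: tens_def lin_ext_lin[of "tens_op _ _"] del: tens_op_bas)
      qed (simp add: K_ext_bas lin_zero)
      moreover have "pr2 d l (bas s) = 0" unfolding s pr2_bas using False by auto
      ultimately show ?thesis by (simp add: s op1_def lin_zero[OF lin_tens_op])
    qed
  qed auto
  then show ?first by (metis comp_apply)
  have p: "perm (pr2 l d v) = pr2 d l (perm v)" for l d v
  proof -
    have "perm \<circ> pr2 l d = pr2 d l \<circ> perm" by (rule lin_eqI) (auto simp: pr_V_def)
    then show ?thesis by (metis comp_apply)
  qed
  have "perm (pr2 l d (op2 (K_ext d K x) u)) = perm (op2 (K_ext d K x) (pr2 l d u))"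
    unfolding p perm_op using fun_cong[OF 1, of "perm u"] by simp
  then show ?second by (metis perm_perm)
qed

lemma fS_op_pr2:
  assumes "meromorphic_K d K" "meromorphic_K l L"
  shows "fS d l x (op1 (K_ext d K y) (pr2 d l u)) = fS d l x (op1 (K_ext d K y) u)"
    and "fS d l x (op2 (K_ext l L y) (pr2 d l u)) = fS d l x (op2 (K_ext l L y) u)"
  unfolding pr2_op_K_ext(1)[OF assms(1), symmetric] pr2_op_K_ext(2)[OF assms(2), symmetric] fS_pr2 by simp_all

lemma RE_iff:
  assumes K: "meromorphic_K d K" and L: "meromorphic_K l L"
  shows "RE d l K L x y \<longleftrightarrow> (\<forall>u\<in>VV_space d l.
     (fin_R21 \<eta> l d (x - y) \<circ> op1 (K x) \<circ> fin_R \<eta> d l (x + y) \<circ> op2 (L y)) u =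
     (op2 (L y) \<circ> fin_R21 \<eta> l d (x + y) \<circ> op1 (K x) \<circ> fin_R \<eta> d l (x - y)) u)"
    (is "_ \<longleftrightarrow> (\<forall>u\<in>_. ?F u = ?G u)")
proof -
  let ?l = "\<lambda>u. fS d l (x - y) (op1 (K_ext d K x) (fS d l (x + y) (op2 (K_ext l L y) u)))"
  let ?r = "\<lambda>u. op2 (K_ext l L y) (fS d l (x + y) (op1 (K_ext d K x) (fS d l (x - y) u)))"
  have on: "?F u = ?l u" "?G u = ?r u" if "u \<in> VV_space d l" for u
    using that op1_K_ext[OF K, where l = l] op2_K_ext[OF L, where d = d] fS_VV
    by (simp_all add: fin_R21_fS fin_R_eq)
  have pr: "?l (pr2 d l u) = ?l u" "?r (pr2 d l u) = ?r u" for u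
    by (simp_all add: fS_op_pr2[OF K L] fS_pr2)
  show ?thesis
  proof
    assume "RE d l K L x y"
    then show "\<forall>u\<in>VV_space d l. ?F u = ?G u" using on by (simp add: RE_def)
  next
    assume h: "\<forall>u\<in>VV_space d l. ?F u = ?G u"
    have "?l u = ?r u" for u
      using h on[OF pr2_VV[of d l u]] pr2_VV[of d l u] pr[of u] by metis
    then show "RE d l K L x y" by (simp add: RE_def)
  qed
qed

lemma reflection_imp_RE:
  assumes "reflection_equation \<eta> d l K L" "meromorphic_K d K" "meromorphic_K l L"
    and "K_regular_at d K x" "K_regular_at l L y"
    and "good d l (x - y)" "good d l (x + y)"
  shows "RE d l K L x y"
  using assms good_imp_regular good_commute
  unfolding RE_iff[OF assms(2,3)] reflection_equation_def by meson

lemma entries_fS: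
  assumes "R_regular_at \<eta> d l (g t0)" "isCont g t0"
  shows "entries (\<lambda>f. isCont f t0) ({..d} \<times> {..l}) ({..d} \<times> {..l}) (\<lambda>t. fS d l (g t))"
  by (rule entries_isCont_compose[OF linear_map_fS])
    (use assms in \<open>auto simp: R_regular_at_def fin_R_eq\<close>)

lemma entries_K_ext:
  assumes "meromorphic_K d K" "K_regular_at d K (g t0)" "isCont g t0"
  shows "entries (\<lambda>f. isCont f t0) {..d} {..d} (\<lambda>t. K_ext d K (g t))"
  by (rule entries_isCont_compose[OF K_ext_linear_map[OF assms(1)]])
    (use assms in \<open>auto simp: regular_K_ext\<close>)

text \<open>
  It suffices to have the reflection equation near \<open>(x, y)\<close> on a line in general direction: along
  it \<open>x\<close>, \<open>y\<close>, \<open>x - y\<close> and \<open>x + y\<close> all vary, so that all constituents are regular nearby.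
\<close>

lemma reflection_from_RE:
  assumes K: "meromorphic_K d K" and L: "meromorphic_K l L"
    and RE: "\<And>x y. \<forall>\<^sub>F t in at 0. RE d l K L (x + 2 * t) (y + 1 * t)"
  shows "reflection_equation \<eta> d l K L"
  unfolding reflection_equation_def
proof (intro allI impI)
  fix x y
  assume reg: "K_regular_at d K x" "K_regular_at l L y"
    "R_regular_at \<eta> d l (x - y)" "R_regular_at \<eta> d l (x + y)"
  let ?B = "{..d} \<times> {..l}"
  let ?Q = "\<lambda>f :: complex \<Rightarrow> complex. isCont f 0"
  let ?m = "\<lambda>t. fS d l ((x + 2 * t) - (y + 1 * t))" and ?p = "\<lambda>t. fS d l ((x + 2 * t) + (y + 1 * t))"
  let ?K = "\<lambda>t. op1 (K_ext d K (x + 2 * t))" and ?L = "\<lambda>t. op2 (K_ext l L (y + 1 * t))"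
  have m: "entries ?Q ?B ?B ?m" and p: "entries ?Q ?B ?B ?p"
    by (rule entries_fS; use reg in \<open>auto intro!: continuous_intros\<close>)+
  have k: "entries ?Q ?B ?B ?K"
    by (rule entries_op1[OF closed_ring_isCont], rule entries_K_ext[OF K]) (use reg in \<open>auto intro!: continuous_intros\<close>)
  have l: "entries ?Q ?B ?B ?L"
    by (rule entries_op2[OF closed_ring_isCont], rule entries_K_ext[OF L]) (use reg in \<open>auto intro!: continuous_intros\<close>)
  note c = entries_comp[OF closed_ring_isCont[of 0], where B = ?B]
  have fin: "finite ?B" by simp
  have T: "entries ?Q ?B ?B (\<lambda>t. ?m t \<circ> (?K t \<circ> (?p t \<circ> ?L t)))"
    by (rule c[OF c[OF c[OF l p fin] k fin] m fin])
  have U: "entries ?Q ?B ?B (\<lambda>t. ?L t \<circ> (?p t \<circ> (?K t \<circ> ?m t)))"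
    by (rule c[OF c[OF c[OF m k fin] p fin] l fin])
  have ev: "\<forall>\<^sub>F t in at 0. \<forall>u\<in>coord_space ?B. (?m t \<circ> (?K t \<circ> (?p t \<circ> ?L t))) u = (?L t \<circ> (?p t \<circ> (?K t \<circ> ?m t))) u"
    using RE[of x y] by eventually_elim (simp add: RE_def)
  have "fS d l (x - y) (op1 (K_ext d K x) (fS d l (x + y) (op2 (K_ext l L y) u))) =
     op2 (K_ext l L y) (fS d l (x + y) (op1 (K_ext d K x) (fS d l (x - y) u)))" if "u \<in> coord_space ?B" for u
    using entries_eq_limit[OF T U ev that] by simp
  then have "\<forall>u\<in>VV_space d l. (fin_R21 \<eta> l d (x - y) \<circ> op1 (K x) \<circ> fin_R \<eta> d l (x + y) \<circ> op2 (L y)) u =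
     (op2 (L y) \<circ> fin_R21 \<eta> l d (x + y) \<circ> op1 (K x) \<circ> fin_R \<eta> d l (x - y)) u"
    using op1_K_ext[OF K, where l = l, unfolded VV_space_def] op2_K_ext[OF L, where d = d, unfolded VV_space_def]
      fS_VV[unfolded VV_space_def]
    by (simp add: fin_R21_fS fin_R_eq VV_space_def)
  then show "\<forall>u\<in>VV_space d l. (fin_R21 \<eta> l d (x - y) \<circ> op1 (K x) \<circ> fin_R \<eta> d l (x + y) \<circ> op2 (L y)) u =
     (op2 (L y) \<circ> fin_R21 \<eta> l d (x + y) \<circ> op1 (K x) \<circ> fin_R \<eta> d l (x - y)) u" .
qed

lemma perm_fS_all: "perm (fS l d x u) = fS d l x (perm u)"
  using fin_R21_fS[of l d x] by (auto simp: fin_R21_def fin_R_eq fun_eq_iff dest: spec[of _ "perm u"])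

lemma fS_inverse:
  assumes "good d l x" "good d l (- x)"
  shows "fS d l (- x) (fS d l x u) = pr2 d l u"
proof -
  have "fS d l (- x) (fS d l x (pr2 d l u)) = pr2 d l u"
    using fRop_inverse[of d l "exp x" "pr2 d l u"] assms pr2_VV
    by (simp add: fS_eq good_goodz exp_minus inverse_eq_divide)
  then show ?thesis by (simp add: fS_pr2)
qed

text \<open>Unitarity and the flip symmetry turn the reflection equation for \<open>(d, l)\<close> into that for \<open>(l, d)\<close>.\<close>

lemma reflection_flip:
  assumes K: "meromorphic_K d K" and L: "meromorphic_K l L"
    and "reflection_equation \<eta> d l K L"
  shows "reflection_equation \<eta> l d L K"
proof (rule reflection_from_RE[OF L K])
  fix x y
  have "\<forall>\<^sub>F t in at 0. K_regular_at d K (y + 1 * t)" "\<forall>\<^sub>F t in at 0. K_regular_at l L (x + 2 * t)"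
    by (intro generic_affine generic_K_regular K L; simp)+
  moreover have "\<forall>\<^sub>F t in at 0. good d l ((y - x) + (- 1) * t)" "\<forall>\<^sub>F t in at 0. good d l ((y + x) + 3 * t)"
    "\<forall>\<^sub>F t in at 0. good d l ((x - y) + 1 * t)"
    by (intro generic_affine generic_good; simp)+
  ultimately show "\<forall>\<^sub>F t in at 0. RE l d L K (x + 2 * t) (y + 1 * t)"
  proof eventually_elim
    case (elim t)
    define x' y' where "x' = x + 2 * t" and "y' = y + 1 * t"
    have e: "(y - x) + (- 1) * t = y' - x'" "(y + x) + 3 * t = y' + x'" "(x - y) + 1 * t = x' - y'"
      by (simp_all add: x'_def y'_def)
    have g: "good d l (y' - x')" "good d l (y' + x')" "good d l (x' - y')" using elim unfolding e by auto
    have RE: "RE d l K L y' x'"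
      by (rule reflection_imp_RE[OF assms(3) K L]) (use elim g in \<open>auto simp: x'_def y'_def\<close>)
    let ?S = "fS d l (x' - y')" and ?S' = "fS d l (y' - x')" and ?R = "fS d l (y' + x')"
    let ?K = "op1 (K_ext d K y')" and ?L = "op2 (K_ext l L x')"
    have inv: "?S (?S' u) = pr2 d l u" "?S' (?S u) = pr2 d l u" for u
      using fS_inverse[of d l "x' - y'"] fS_inverse[of d l "y' - x'"] g by simp_all
    \<comment> \<open>Conjugating the reflection equation by \<open>?S\<close>, the inverse of \<open>?S'\<close>, reverses its order.\<close>
    have main: "?S (?L (?R (?K v))) = ?K (?R (?L (?S v)))" for v
    proof -
      have "?S (?L (?R (?K v))) = ?S (?L (?R (?K (?S' (?S v)))))"
        unfolding inv by (simp add: fS_op_pr2[OF K L])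
      also have "?L (?R (?K (?S' (?S v)))) = ?S' (?K (?R (?L (?S v))))"
        using RE unfolding RE_def by simp
      finally show ?thesis
        unfolding inv using op1_K_ext(2)[OF K fS_VV] by (simp add: pr2_id)
    qed
    have "RE l d L K x' y'"
      unfolding RE_def
    proof
      fix u
      have "perm (fS l d (x' - y') (op1 (K_ext l L x') (fS l d (x' + y') (op2 (K_ext d K y') u)))) =
         perm (op2 (K_ext d K y') (fS l d (x' + y') (op1 (K_ext l L x') (fS l d (x' - y') u))))"
        using main[of "perm u"] by (simp add: perm_fS_all perm_op add.commute)
      then show "fS l d (x' - y') (op1 (K_ext l L x') (fS l d (x' + y') (op2 (K_ext d K y') u))) =
         op2 (K_ext d K y') (fS l d (x' + y') (op1 (K_ext l L x') (fS l d (x' - y') u)))"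
        by (metis perm_perm)
    qed
    then show ?case by (simp add: x'_def y'_def)
  qed
qed


section \<open>Fusion of K-operators\<close>

text \<open>A left inverse of \<open>iota\<close>.\<close>

definition iota_inv :: "nat \<Rightarrow> (nat \<times> nat) vec \<Rightarrow> nat vec" where
  "iota_inv d = lin_ext (\<lambda>(a, b). if a = 0 \<and> b \<le> d then (1 / s ^ b) \<cdot> bas b
     else if a = Suc 0 \<and> b = d then (1 / tc d (Suc d)) \<cdot> bas (Suc d) else 0)"

lemma lin_iota_inv [simp, intro]: "lin (iota_inv d)"
  by (simp add: iota_inv_def)

lemma tc_top_nz [simp]: "tc d (Suc d) \<noteq> 0"
proof -
  have "p ^ Suc d * p ^ Suc d \<noteq> 1"
    using p_pow_neq_1[of "Suc d + Suc d"] by (simp only: power_add) simp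
  then have "p ^ Suc d \<noteq> 1 / p ^ Suc d" by (simp add: eq_divide_eq)
  then show ?thesis by (simp add: tc_def del: power_Suc)
qed

lemma iota_inv_iota: "iota_inv d (iota \<eta> d v) = pr_V (Suc d) v"
proof -
  have "iota_inv d \<circ> iota \<eta> d = pr_V (Suc d)"
  proof (rule lin_eqI)
    fix i
    show "(iota_inv d \<circ> iota \<eta> d) (bas i) = pr_V (Suc d) (bas i)"
      by (cases "i \<le> d"; cases "i = Suc d"; cases i) (auto simp: iota_bas lin_simps pr_V_bas iota_inv_def)
  qed (auto simp: pr_V_def)
  then show ?thesis by (metis comp_apply)
qed

lemma iota_pr: "iota \<eta> d (pr_V (Suc d) v) = iota \<eta> d v"
proof -
  have "iota \<eta> d \<circ> pr_V (Suc d) = iota \<eta> d"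
    by (rule lin_eqI) (auto simp: pr_V_bas iota_bas lin_zero pr_V_def[of "Suc d"])
  then show ?thesis by (metis comp_apply)
qed

lemma pr_V_id: "u \<in> coord_space {..d} \<Longrightarrow> pr_V d u = u"
  using lin_eq_on[of "pr_V d" id "{..d}" u] by (auto simp: pr_V_def)

text \<open>The operator on \<open>V\<^sup>1\<^sup>/\<^sup>2 \<otimes> V\<^sup>k\<close> that is to be restricted to the image of \<open>iota\<close>.\<close>

definition Xop :: "nat \<Rightarrow> (complex \<Rightarrow> nat vec \<Rightarrow> nat vec) \<Rightarrow> (complex \<Rightarrow> nat vec \<Rightarrow> nat vec) \<Rightarrow>
    complex \<Rightarrow> (nat \<times> nat) vec \<Rightarrow> (nat \<times> nat) vec" where
  "Xop d Kh K x = op1 (K_ext 1 Kh (x - half d * \<eta>)) \<circ>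
     (fS 1 d (2 * x - (half d - 1 / 2) * \<eta>) \<circ> op2 (K_ext d K (x + \<eta> / 2)))"

definition fuse :: "nat \<Rightarrow> (complex \<Rightarrow> nat vec \<Rightarrow> nat vec) \<Rightarrow> (complex \<Rightarrow> nat vec \<Rightarrow> nat vec) \<Rightarrow>
    complex \<Rightarrow> nat vec \<Rightarrow> nat vec" where
  "fuse d Kh K x = iota_inv d \<circ> (Xop d Kh K x \<circ> iota \<eta> d)"

lemma lin_Xop [simp, intro]: "lin (Xop d Kh K x)"
  unfolding Xop_def by (intro lin_comp) auto

lemma iota_VV: "iota \<eta> d v \<in> VV_space 1 d"
  unfolding VV_space_def
  by (rule lin_in_coord_space[of _ UNIV])
    (auto simp: iota_bas intro!: coord_space_add coord_space_smul)

lemma entries_iota: "closed_ring Q \<Longrightarrow> entries Q {..Suc d} ({..1} \<times> {..d}) (\<lambda>_. iota \<eta> d)"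
  using iota_VV by (intro entries_const) (auto simp: VV_space_def)

lemma entries_iota_inv: "closed_ring Q \<Longrightarrow> entries Q ({..1} \<times> {..d}) {..Suc d} (\<lambda>_. iota_inv d)"
  by (intro entries_const) (auto simp: iota_inv_def intro!: coord_space_smul)

lemma fuse_meromorphic:
  assumes Kh: "meromorphic_K 1 Kh" and K: "meromorphic_K d K"
  shows "meromorphic_K (Suc d) (fuse d Kh K)"
proof -
  let ?Q = "\<lambda>f :: complex \<Rightarrow> complex. f meromorphic_on UNIV"
  let ?B = "{..1::nat} \<times> {..d}"
  note r = closed_ring_meromorphic
  have 1: "entries ?Q ?B ?B (\<lambda>x. op1 (K_ext 1 Kh (x - half d * \<eta>)))"
    by (rule entries_op1[OF r], rule entries_meromorphic_compose[OF K_ext_linear_map[OF Kh]])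
      (auto intro!: K_ext_meromorphic[OF Kh, unfolded One_nat_def] analytic_intros)
  have 2: "entries ?Q ?B ?B (\<lambda>x. op2 (K_ext d K (x + \<eta> / 2)))"
    by (rule entries_op2[OF r], rule entries_meromorphic_compose[OF K_ext_linear_map[OF K]])
      (auto intro!: K_ext_meromorphic[OF K] analytic_intros)
  have 3: "entries ?Q ?B ?B (\<lambda>x. fS 1 d (2 * x - (half d - 1 / 2) * \<eta>))"
    by (rule entries_meromorphic_compose[OF linear_map_fS])
      (auto intro!: fS_meromorphic analytic_intros)
  have fin: "finite ?B" by simp
  have X: "entries ?Q ?B ?B (Xop d Kh K)"
    using entries_comp[OF r entries_comp[OF r 2 3 fin] 1 fin] unfolding Xop_def[abs_def] .
  have "entries ?Q {..Suc d} {..Suc d} (fuse d Kh K)"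
    using entries_comp[OF r entries_comp[OF r entries_iota[OF r] X fin] entries_iota_inv[OF r] fin]
    unfolding fuse_def[abs_def] .
  then show ?thesis
    by (simp add: meromorphic_K_def meromorphic_operator_def entries_def)
qed

text \<open>
  The arguments \<open>xb\<close> and \<open>xa\<close> of the two \<open>K\<close>-operators differ by \<open>(k + 1/2) \<eta>\<close>, where the \<open>R\<close>-operator
  \<open>?Z\<close> is degenerate with image the image of \<open>iota\<close>. The reflection equation at \<open>(xb, xa)\<close> moves
  \<open>?Z\<close> to the left of the operators that make up \<open>Xop\<close>, so that \<open>Xop\<close> maps the image of \<open>?Z\<close> to itself.
\<close>

lemma Xop_preserves:
  assumes Kh: "meromorphic_K 1 Kh" and K: "meromorphic_K d K"
    and RE: "reflection_equation \<eta> d 1 K Kh"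
    and reg: "K_regular_at 1 Kh (x - half d * \<eta>)" "K_regular_at d K (x + \<eta> / 2)"
      "good 1 d (2 * x - (half d - 1 / 2) * \<eta>)"
  shows "iota \<eta> d (fuse d Kh K x v) = Xop d Kh K x (iota \<eta> d v)"
proof -
  define xa xb where "xa = x - half d * \<eta>" and "xb = x + \<eta> / 2"
  have e: "xb - xa = (half d + 1 / 2) * \<eta>" "xb + xa = 2 * x - (half d - 1 / 2) * \<eta>"
    by (simp_all add: xa_def xb_def algebra_simps)
  have z: "exp (xb - xa) = z0 d"
  proof -
    have "xb - xa = of_nat (Suc d) * (\<eta> / 2)" unfolding e by (simp add: half_def algebra_simps)
    then show ?thesis by (simp only: exp_of_nat_mult z0_def s_def)
  qed
  have g: "good 1 d (xb - xa)" "good 1 d (xb + xa)"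
    using goodz_z0[of d] reg(3) unfolding good_goodz z by (simp_all add: e good_goodz)
  have R0: "fS 1 d (xb - xa) = fRop 1 d (z0 d)" using fS_eq[OF g(1)] unfolding z .
  have RE': "RE d 1 K Kh xb xa"
    by (rule reflection_imp_RE[OF RE K Kh]) (use reg g good_commute[of d 1] in \<open>auto simp: xa_def xb_def\<close>)
  let ?R = "fS 1 d (xb + xa)" and ?Z = "fS 1 d (xb - xa)"
  have X: "Xop d Kh K x = op1 (K_ext 1 Kh xa) \<circ> (?R \<circ> op2 (K_ext d K xb))"
    unfolding Xop_def e(2) xa_def[symmetric] xb_def[symmetric] ..
  have comm: "Xop d Kh K x (?Z u) = ?Z (op2 (K_ext d K xb) (?R (op1 (K_ext 1 Kh xa) u)))" for u
  proof -
    have "perm (fS d 1 (xb - xa) (op1 (K_ext d K xb) (fS d 1 (xb + xa) (op2 (K_ext 1 Kh xa) (perm u))))) =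
       perm (op2 (K_ext 1 Kh xa) (fS d 1 (xb + xa) (op1 (K_ext d K xb) (fS d 1 (xb - xa) (perm u)))))"
      using RE' unfolding RE_def by simp
    then show ?thesis unfolding X by (simp add: perm_fS_all perm_op)
  qed
  obtain u where u: "iota \<eta> d v = ?Z u" using iota_in_z0_range unfolding R0 by blast
  obtain w where w: "?Z (op2 (K_ext d K xb) (?R (op1 (K_ext 1 Kh xa) u))) = iota \<eta> d w"
    using fRop_z0_range unfolding R0 by blast
  have "Xop d Kh K x (iota \<eta> d v) = iota \<eta> d w" unfolding u comm w ..
  then show ?thesis by (simp add: fuse_def iota_inv_iota iota_pr)
qed

lemma fusion_args: "xa = x - half d * \<eta> \<Longrightarrow> exp xa = exp x / s ^ d"
  "xb = x + \<eta> / 2 \<Longrightarrow> exp xb = exp x * s"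
proof -
  have "half d * \<eta> = of_nat d * (\<eta> / 2)" by (simp add: half_def)
  then show "xa = x - half d * \<eta> \<Longrightarrow> exp xa = exp x / s ^ d"
    by (simp only: exp_diff exp_of_nat_mult s_def)
  show "xb = x + \<eta> / 2 \<Longrightarrow> exp xb = exp x * s" by (simp add: exp_add s_def)
qed

lemma entries_Xop:
  assumes Kh: "meromorphic_K 1 Kh" and K: "meromorphic_K d K"
    and reg: "K_regular_at 1 Kh (x - half d * \<eta>)" "K_regular_at d K (x + \<eta> / 2)"
      "R_regular_at \<eta> 1 d (2 * x - (half d - 1 / 2) * \<eta>)"
  shows "entries (\<lambda>f. isCont f x) ({..1} \<times> {..d}) ({..1} \<times> {..d}) (Xop d Kh K)"
proof -
  let ?Q = "\<lambda>f :: complex \<Rightarrow> complex. isCont f x"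
  let ?B = "{..1::nat} \<times> {..d}"
  note r = closed_ring_isCont[of x]
  have 1: "entries ?Q ?B ?B (\<lambda>x. op1 (K_ext 1 Kh (x - half d * \<eta>)))"
    by (rule entries_op1[OF r], rule entries_K_ext[OF Kh]) (use reg in \<open>auto intro!: continuous_intros\<close>)
  have 2: "entries ?Q ?B ?B (\<lambda>x. op2 (K_ext d K (x + \<eta> / 2)))"
    by (rule entries_op2[OF r], rule entries_K_ext[OF K]) (use reg in \<open>auto intro!: continuous_intros\<close>)
  have 3: "entries ?Q ?B ?B (\<lambda>x. fS 1 d (2 * x - (half d - 1 / 2) * \<eta>))"
    by (rule entries_fS) (use reg in \<open>auto intro!: continuous_intros\<close>)
  have fin: "finite ?B" by simp
  show ?thesis
    using entries_comp[OF r entries_comp[OF r 2 3 fin] 1 fin] unfolding Xop_def[abs_def] .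
qed

lemma generic_shifts:
  assumes "meromorphic_K 1 Kh" "meromorphic_K d K"
  shows "generic (\<lambda>x. K_regular_at 1 Kh (x - half d * \<eta>) \<and> K_regular_at d K (x + \<eta> / 2) \<and>
    good 1 d (2 * x - (half d - 1 / 2) * \<eta>))"
  unfolding generic_def
proof
  fix x0
  have "\<forall>\<^sub>F x in at x0. K_regular_at 1 Kh (- (half d * \<eta>) + 1 * x)"
    "\<forall>\<^sub>F x in at x0. K_regular_at d K (\<eta> / 2 + 1 * x)"
    "\<forall>\<^sub>F x in at x0. good 1 d (- ((half d - 1 / 2) * \<eta>) + 2 * x)"
    by (intro generic_affine generic_K_regular generic_good assms; simp)+
  then show "\<forall>\<^sub>F x in at x0. K_regular_at 1 Kh (x - half d * \<eta>) \<and> K_regular_at d K (x + \<eta> / 2) \<and>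
    good 1 d (2 * x - (half d - 1 / 2) * \<eta>)"
    by eventually_elim (simp add: add.commute)
qed

lemma fusion_sides:
  assumes "meromorphic_K 1 Kh" "meromorphic_K d K" "u \<in> V_space (Suc d)"
  shows "(perm \<circ> op1 (Kh (x - half d * \<eta>)) \<circ> fin_R \<eta> 1 d (2 * x - (half d - 1 / 2) * \<eta>) \<circ>
    op2 (K (x + \<eta> / 2)) \<circ> iota \<eta> d) u = perm (Xop d Kh K x (iota \<eta> d u))"
  using op1_K_ext(1)[OF assms(1) fS_VV] op2_K_ext(1)[OF assms(2) iota_VV]
  by (simp add: Xop_def fin_R_eq)

lemma fusion_relation_fuse:
  assumes Kh: "meromorphic_K 1 Kh" and K: "meromorphic_K d K"
    and RE: "reflection_equation \<eta> d 1 K Kh"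
  shows "fusion_relation \<eta> d Kh K (fuse d Kh K)"
  unfolding fusion_relation_def
proof (intro allI impI ballI)
  fix x u
  assume reg: "K_regular_at (d + 1) (fuse d Kh K) x" "K_regular_at 1 Kh (x - half d * \<eta>)"
    "R_regular_at \<eta> 1 d (2 * x - (half d - 1 / 2) * \<eta>)" "K_regular_at d K (x + \<eta> / 2)"
    and u: "u \<in> V_space (d + 1)"
  let ?Q = "\<lambda>f :: complex \<Rightarrow> complex. isCont f x"
  let ?B = "{..1::nat} \<times> {..d}"
  have F: "meromorphic_K (Suc d) (fuse d Kh K)" by (rule fuse_meromorphic[OF Kh K])
  note r = closed_ring_isCont[of x]
  have T: "entries ?Q {..Suc d} ?B (\<lambda>x. iota \<eta> d \<circ> K_ext (Suc d) (fuse d Kh K) x)"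
    by (rule entries_comp[OF r entries_K_ext[OF F] entries_iota[OF r]]) (use reg in auto)
  have U: "entries ?Q {..Suc d} ?B (\<lambda>x. Xop d Kh K x \<circ> iota \<eta> d)"
    by (rule entries_comp[OF r entries_iota[OF r] entries_Xop[OF Kh K]]) (use reg in auto)
  have "\<forall>\<^sub>F y in at x. \<forall>u\<in>coord_space {..Suc d}.
      (iota \<eta> d \<circ> K_ext (Suc d) (fuse d Kh K) y) u = (Xop d Kh K y \<circ> iota \<eta> d) u"
    using generic_shifts[OF Kh K, unfolded generic_def, rule_format, of x]
    by eventually_elim (simp add: K_ext_eq[OF F] Xop_preserves[OF Kh K RE])
  from entries_eq_limit[OF T U this, of u] u
  have "iota \<eta> d (fuse d Kh K x u) = Xop d Kh K x (iota \<eta> d u)"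
    by (simp add: V_space_def K_ext_eq[OF F])
  then show "(jmap \<eta> d \<circ> fuse d Kh K x) u = (perm \<circ> op1 (Kh (x - half d * \<eta>)) \<circ>
      fin_R \<eta> 1 d (2 * x - (half d - 1 / 2) * \<eta>) \<circ> op2 (K (x + \<eta> / 2)) \<circ> iota \<eta> d) u"
    using fusion_sides[OF Kh K] u by (simp add: jmap_def)
qed

text \<open>
  At generic arguments all constituents of the fusion relation are regular. As \<open>iota\<close> is injective,
  this determines \<open>K'\<close> there.
\<close>

lemma fusion_relation_generic:
  assumes Kh: "meromorphic_K 1 Kh" and K: "meromorphic_K d K" and K': "meromorphic_K (Suc d) K'"
    and rel: "fusion_relation \<eta> d Kh K K'"
  shows "generic (\<lambda>x. \<forall>v. iota \<eta> d (K_ext (Suc d) K' x v) = Xop d Kh K x (iota \<eta> d v))"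
  unfolding generic_def
proof
  fix x0
  have "\<forall>\<^sub>F x in at x0. K_regular_at (Suc d) K' x"
    using generic_K_regular[OF K'] by (simp add: generic_def)
  then show "\<forall>\<^sub>F x in at x0. \<forall>v. iota \<eta> d (K_ext (Suc d) K' x v) = Xop d Kh K x (iota \<eta> d v)"
    using generic_shifts[OF Kh K, unfolded generic_def, rule_format, of x0]
  proof eventually_elim
    case (elim x)
    show ?case
    proof
      fix v
      let ?u = "pr_V (Suc d) v"
      have u: "?u \<in> coord_space {..Suc d}"
        by (rule lin_in_coord_space[of _ UNIV]) (auto simp: pr_V_bas pr_V_def[of "Suc d"])
      have "(jmap \<eta> d \<circ> K' x) ?u = perm (Xop d Kh K x (iota \<eta> d ?u))"
        using rel elim u good_imp_regular unfolding fusion_relation_def fusion_sides[OF Kh K, symmetric, of ?u x, unfolded V_space_def, OF u]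
        by (simp add: V_space_def)
      then have "perm (iota \<eta> d (K' x ?u)) = perm (Xop d Kh K x (iota \<eta> d ?u))"
        by (simp add: jmap_def)
      then have "iota \<eta> d (K' x ?u) = Xop d Kh K x (iota \<eta> d ?u)"
        by (metis perm_perm)
      moreover have "K_ext (Suc d) K' x \<circ> pr_V (Suc d) = K_ext (Suc d) K' x"
        by (rule lin_eqI) (auto simp: pr_V_bas K_ext_bas lin_zero pr_V_def[of "Suc d"])
      then have "K_ext (Suc d) K' x v = K' x ?u"
        using K_ext_eq[OF K' u] by (metis comp_apply)
      ultimately show "iota \<eta> d (K_ext (Suc d) K' x v) = Xop d Kh K x (iota \<eta> d v)"
        by (simp add: iota_pr)
    qed
  qed
qed


section \<open>Fusion of reflection equations\<close>

text \<open>The Yang-Baxter equation with the second and third factors exchanged.\<close>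

lemma yang_baxter_flipped:
  assumes "good 1 l x" "good 1 d (x + w)" "good d l w"
  shows "lift13 (fS 1 l x) (lift12 (fS 1 d (x + w)) (lift23 (fS d l w) u)) =
         lift23 (fS d l w) (lift12 (fS 1 d (x + w)) (lift13 (fS 1 l x) u))"
proof -
  have g: "good l d w" using assms(3) good_commute by simp
  have YB: "lift12 (fS 1 l x) (lift13 (fS 1 d (x + w)) (lift23 (fS l d w) v)) =
         lift23 (fS l d w) (lift13 (fS 1 d (x + w)) (lift12 (fS 1 l x) v))" for v
    using yang_baxter[of l "exp x" d "exp w"] assms g
    by (simp add: fS_eq good_goodz exp_add)
  have p: "perm \<circ> fS l d w \<circ> perm = fS d l w"
    by (auto simp: perm_fS_all)
  show ?thesis
    using arg_cong[OF YB[of "swap23 u"], of swap23] unfolding swap23_lift p by simp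
qed

text \<open>
  Fusion of \<open>R\<close> in terms of \<open>fS\<close>, and on the ambient space, where both sides see the projection to
  the finite-dimensional modules only.
\<close>

lemma fusion_R_total:
  assumes "good (Suc d) l x" "good 1 l (x - half d * \<eta>)" "good d l (x + \<eta> / 2)"
  shows "iota_left d (fS (Suc d) l x u) =
     lift13 (fS 1 l (x - half d * \<eta>)) (lift23 (fS d l (x + \<eta> / 2)) (iota_left d u))"
proof -
  define xa xb where "xa = x - half d * \<eta>" and "xb = x + \<eta> / 2"
  have on: "iota_left d (fS (Suc d) l x v) = lift13 (fS 1 l xa) (lift23 (fS d l xb) (iota_left d v))"
    if "v \<in> VV_space (Suc d) l" for v
    using fusion_R[of "exp xa" "exp x" d "exp xb" l v] fusion_args(1)[of xa x d] fusion_args(2)[of xb x] assms that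
    by (simp add: fS_eq good_goodz xa_def xb_def)
  have jpr: "lift23 (fS d l xb) (iota_left d (pr2 (Suc d) l v)) = lift23 (fS d l xb) (iota_left d v)" for v
  proof -
    have "lift23 (fS d l xb) \<circ> (iota_left d \<circ> pr2 (Suc d) l) = lift23 (fS d l xb) \<circ> iota_left d"
    proof (rule lin_eqI)
      fix s :: "nat \<times> nat"
      obtain i c where s: "s = (i, c)" by (cases s)
      have zero: "fS d l xb (bas (b, c)) = 0" if "c > l" for b
        using that fS_pr2[of d l xb "bas (b, c)"] by (simp add: pr2_bas lin_zero del: tens_op_bas)
      show "(lift23 (fS d l xb) \<circ> (iota_left d \<circ> pr2 (Suc d) l)) (bas s) = (lift23 (fS d l xb) \<circ> iota_left d) (bas s)"
        using zero by (auto simp: s pr2_bas iota_left_bas lin_simps lift_bas simp del: tens_op_bas)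
    qed auto
    then show ?thesis by (metis comp_apply)
  qed
  show ?thesis
    using on[OF pr2_VV[of "Suc d" l u]] unfolding fS_pr2 jpr by (simp only: xa_def xb_def)
qed

text \<open>An operator that corresponds to \<open>X\<close> under \<open>iota\<close> becomes \<open>X\<close> on the two constituents.\<close>

lemma iota_left_op:
  assumes "\<And>v. iota \<eta> d (T v) = X (iota \<eta> d v)" and "lin X"
  shows "iota_left d (op1 T u) = lift12 X (iota_left d u)" (is ?first) and "iota_left d (op2 S u) = leg3 S (iota_left d u)" (is ?second)
proof -
  have "iota_left d \<circ> op1 T = act fst (\<lambda>(a, b) (i, c). (a, b, c)) (iota \<eta> d \<circ> T)"
    unfolding iota_left_def op1_act by (rule act_comp) auto
  moreover have "lift12 X \<circ> iota_left d = act fst (\<lambda>(a, b) (i, c). (a, b, c)) (X \<circ> iota \<eta> d)"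
    unfolding iota_left_def lift12_def by (rule act_comp) (use assms in auto)
  moreover have "iota \<eta> d \<circ> T = X \<circ> iota \<eta> d" using assms by auto
  ultimately have "iota_left d \<circ> op1 T = lift12 X \<circ> iota_left d" by simp
  then show ?first by (metis comp_apply)
  have "iota_left d \<circ> op2 S = leg3 S \<circ> iota_left d"
    unfolding iota_left_def leg3_def op2_act by (rule act_commute[symmetric]) auto
  then show ?second by (metis comp_apply)
qed

lemma iota_left_inj:
  assumes "iota_left d u = iota_left d v" "u \<in> VV_space (Suc d) l" "v \<in> VV_space (Suc d) l"
  shows "u = v"
proof -
  define J :: "(nat \<times> nat \<times> nat) vec \<Rightarrow> (nat \<times> nat) vec"
    where "J = act (\<lambda>(a, b, c). (a, b)) (\<lambda>i (a, b, c). (i, c)) (iota_inv d)"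
  have "J \<circ> iota_left d = act fst (\<lambda>i (a, c). (i, c)) (iota_inv d \<circ> iota \<eta> d)"
    unfolding J_def iota_left_def by (rule act_comp) auto
  then have "J (iota_left d (bas (i, c))) = bas (i, c)" if "i \<le> Suc d" for i c
    using that by (simp add: fun_eq_iff act_bas iota_inv_iota pr_V_bas)
  then have J: "J (iota_left d w) = w" if "w \<in> VV_space (Suc d) l" for w
    using lin_eq_on[of "J \<circ> iota_left d" id "{..Suc d} \<times> {..l}" w] that
    by (auto simp: VV_space_def J_def intro!: lin_comp)
  show ?thesis using J[OF assms(2)] J[OF assms(3)] assms(1) by metis
qed

lemma RE_lift13:
  assumes "RE 1 l K L x y"
  shows "lift13 (fS 1 l (x - y)) (leg1 (K_ext 1 K x) (lift13 (fS 1 l (x + y)) (leg3 (K_ext l L y) u))) =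
     leg3 (K_ext l L y) (lift13 (fS 1 l (x + y)) (leg1 (K_ext 1 K x) (lift13 (fS 1 l (x - y)) u)))"
proof -
  have "fS 1 l (x - y) \<circ> (op1 (K_ext 1 K x) \<circ> (fS 1 l (x + y) \<circ> op2 (K_ext l L y))) =
    op2 (K_ext l L y) \<circ> (fS 1 l (x + y) \<circ> (op1 (K_ext 1 K x) \<circ> fS 1 l (x - y)))"
    using assms by (auto simp: RE_def)
  from arg_cong[OF this, of lift13] show ?thesis
    by (simp add: lift_comp lift_op fun_eq_iff)
qed

lemma RE_lift23:
  assumes "RE d l K L x y"
  shows "lift23 (fS d l (x - y)) (leg2 (K_ext d K x) (lift23 (fS d l (x + y)) (leg3 (K_ext l L y) u))) =
     leg3 (K_ext l L y) (lift23 (fS d l (x + y)) (leg2 (K_ext d K x) (lift23 (fS d l (x - y)) u)))"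
proof -
  have "fS d l (x - y) \<circ> (op1 (K_ext d K x) \<circ> (fS d l (x + y) \<circ> op2 (K_ext l L y))) =
    op2 (K_ext l L y) \<circ> (fS d l (x + y) \<circ> (op1 (K_ext d K x) \<circ> fS d l (x - y)))"
    using assms by (auto simp: RE_def)
  from arg_cong[OF this, of lift23] show ?thesis
    by (simp add: lift_comp lift_op fun_eq_iff)
qed

text \<open>
  After embedding by \<open>iota_left\<close> the operator \<open>K'\<close> becomes \<open>?Ka ?AB ?Kb\<close>, and an \<open>R\<close>-operator becomes a
  product \<open>?A ?B\<close> of two. Each of the two Yang-Baxter equations exchanges a factor \<open>?A\<close> with a factor
  \<open>?B\<close> across \<open>?AB\<close>, so that first the reflection equation for \<open>?Kb\<close> and \<open>?L\<close> and then that for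
  \<open>?Ka\<close> and \<open>?L\<close> applies.
\<close>

lemma RE_fused:
  assumes K': "meromorphic_K (Suc d) K'" and L: "meromorphic_K l L"
    and rel: "\<And>v. iota \<eta> d (K_ext (Suc d) K' x v) = Xop d Kh K x (iota \<eta> d v)"
    and xa: "xa = x - half d * \<eta>" and xb: "xb = x + \<eta> / 2"
    and RE1: "RE 1 l Kh L xa y" and REd: "RE d l K L xb y"
    and good: "good (Suc d) l (x - y)" "good (Suc d) l (x + y)" "good 1 l (xa - y)" "good 1 l (xa + y)"
      "good d l (xb - y)" "good d l (xb + y)" "good 1 d (xa + xb)"
  shows "RE (Suc d) l K' L x y"
  unfolding RE_def
proof
  fix u
  let ?Am = "lift13 (fS 1 l (xa - y))" and ?Ap = "lift13 (fS 1 l (xa + y))"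
  let ?Bm = "lift23 (fS d l (xb - y))" and ?Bp = "lift23 (fS d l (xb + y))"
  let ?AB = "lift12 (fS 1 d (xa + xb))"
  let ?Ka = "leg1 (K_ext 1 Kh xa)" and ?Kb = "leg2 (K_ext d K xb)" and ?L = "leg3 (K_ext l L y)"
  let ?J = "iota_left d"
  have args: "x - y - half d * \<eta> = xa - y" "x + y - half d * \<eta> = xa + y"
    "x - y + \<eta> / 2 = xb - y" "x + y + \<eta> / 2 = xb + y" "2 * x - (half d - 1 / 2) * \<eta> = xa + xb"
    by (simp_all add: xa xb algebra_simps)
  have Fm: "?J (fS (Suc d) l (x - y) v) = ?Am (?Bm (?J v))" for v
    using fusion_R_total[of d l "x - y" v] good unfolding args by simp
  have Fp: "?J (fS (Suc d) l (x + y) v) = ?Ap (?Bp (?J v))" for v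
    using fusion_R_total[of d l "x + y" v] good unfolding args by simp
  have JK: "?J (op1 (K_ext (Suc d) K' x) v) = ?Ka (?AB (?Kb (?J v)))" for v
  proof -
    have "?J (op1 (K_ext (Suc d) K' x) v) = lift12 (Xop d Kh K x) (?J v)"
      by (rule iota_left_op(1)[OF rel lin_Xop])
    also have "lift12 (Xop d Kh K x) = ?Ka \<circ> (?AB \<circ> ?Kb)"
      unfolding Xop_def args xa[symmetric] xb[symmetric] by (simp add: lift_comp lift_op)
    finally show ?thesis by simp
  qed
  have JL: "?J (op2 (K_ext l L y) v) = ?L (?J v)" for v
    by (rule iota_left_op(2)[OF rel lin_Xop])
  have YB1: "?Bm (?AB (?Ap v)) = ?Ap (?AB (?Bm v))" for v
    using yang_baxter_flipped[of l "xa + y" d "xb - y" v] good by simp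
  have YB2: "?Am (?AB (?Bp v)) = ?Bp (?AB (?Am v))" for v
    using yang_baxter_flipped[of l "xa - y" d "xb + y" v] good by simp
  note com = leg_lift_commute
  have "?Am (?Bm (?Ka (?AB (?Kb (?Ap (?Bp (?L v))))))) = ?L (?Ap (?Bp (?Ka (?AB (?Kb (?Am (?Bm v)))))))" for v
  proof -
    have "?Am (?Bm (?Ka (?AB (?Kb (?Ap (?Bp (?L v))))))) = ?Am (?Ka (?Bm (?AB (?Ap (?Kb (?Bp (?L v)))))))"
      by (simp only: com)
    also have "\<dots> = ?Am (?Ka (?Ap (?AB (?Bm (?Kb (?Bp (?L v)))))))"
      unfolding YB1 ..
    also have "\<dots> = ?Am (?Ka (?Ap (?L (?AB (?Bp (?Kb (?Bm v)))))))"
      unfolding RE_lift23[OF REd] com ..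
    also have "\<dots> = ?L (?Ap (?Ka (?Bp (?AB (?Am (?Kb (?Bm v)))))))"
      unfolding RE_lift13[OF RE1] YB2 ..
    also have "\<dots> = ?L (?Ap (?Bp (?Ka (?AB (?Kb (?Am (?Bm v)))))))"
      by (simp only: com)
    finally show ?thesis .
  qed
  then have J: "?J (fS (Suc d) l (x - y) (op1 (K_ext (Suc d) K' x) (fS (Suc d) l (x + y) (op2 (K_ext l L y) u)))) =
      ?J (op2 (K_ext l L y) (fS (Suc d) l (x + y) (op1 (K_ext (Suc d) K' x) (fS (Suc d) l (x - y) u))))"
    unfolding Fm Fp JK JL .
  show "fS (Suc d) l (x - y) (op1 (K_ext (Suc d) K' x) (fS (Suc d) l (x + y) (op2 (K_ext l L y) u))) =
      op2 (K_ext l L y) (fS (Suc d) l (x + y) (op1 (K_ext (Suc d) K' x) (fS (Suc d) l (x - y) u)))"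
    by (rule iota_left_inj[OF J fS_VV]) (rule op2_K_ext(2)[OF L fS_VV])
qed

text \<open>
  Near every pair of arguments all shifted arguments are regular along the line in direction \<open>(2, 1)\<close>, since
  each of them varies along it.
\<close>

lemma reflection_fused:
  assumes Kh: "meromorphic_K 1 Kh" and K: "meromorphic_K d K" and K': "meromorphic_K (Suc d) K'"
    and L: "meromorphic_K l L" and rel: "fusion_relation \<eta> d Kh K K'"
    and R1: "reflection_equation \<eta> 1 l Kh L" and Rd: "reflection_equation \<eta> d l K L"
  shows "reflection_equation \<eta> (Suc d) l K' L"
proof (rule reflection_from_RE[OF K' L])
  fix x y
  define h where "h = half d * \<eta>"
  have "\<forall>\<^sub>F t in at 0. \<forall>v. iota \<eta> d (K_ext (Suc d) K' (x + 2 * t) v) = Xop d Kh K (x + 2 * t) (iota \<eta> d v)"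
    by (rule generic_affine[OF fusion_relation_generic[OF Kh K K' rel]]) simp
  moreover have "\<forall>\<^sub>F t in at 0. K_regular_at 1 Kh ((x - h) + 2 * t)" "\<forall>\<^sub>F t in at 0. K_regular_at d K ((x + \<eta> / 2) + 2 * t)"
    "\<forall>\<^sub>F t in at 0. K_regular_at l L (y + 1 * t)"
    by (intro generic_affine generic_K_regular Kh K L; simp)+
  moreover have "\<forall>\<^sub>F t in at 0. good (Suc d) l ((x - y) + 1 * t)" "\<forall>\<^sub>F t in at 0. good (Suc d) l ((x + y) + 3 * t)"
    "\<forall>\<^sub>F t in at 0. good 1 l ((x - h - y) + 1 * t)" "\<forall>\<^sub>F t in at 0. good 1 l ((x - h + y) + 3 * t)"
    "\<forall>\<^sub>F t in at 0. good d l ((x + \<eta> / 2 - y) + 1 * t)" "\<forall>\<^sub>F t in at 0. good d l ((x + \<eta> / 2 + y) + 3 * t)"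
    "\<forall>\<^sub>F t in at 0. good 1 d ((x - h + (x + \<eta> / 2)) + 4 * t)"
    by (intro generic_affine generic_good; simp)+
  ultimately show "\<forall>\<^sub>F t in at 0. RE (Suc d) l K' L (x + 2 * t) (y + 1 * t)"
  proof eventually_elim
    case (elim t)
    define x' y' where "x' = x + 2 * t" and "y' = y + 1 * t"
    have e: "(x - h) + 2 * t = x' - h" "(x + \<eta> / 2) + 2 * t = x' + \<eta> / 2"
      "(x - y) + 1 * t = x' - y'" "(x + y) + 3 * t = x' + y'"
      "(x - h - y) + 1 * t = x' - h - y'" "(x - h + y) + 3 * t = x' - h + y'"
      "(x + \<eta> / 2 - y) + 1 * t = x' + \<eta> / 2 - y'" "(x + \<eta> / 2 + y) + 3 * t = x' + \<eta> / 2 + y'"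
      "(x - h + (x + \<eta> / 2)) + 4 * t = (x' - h) + (x' + \<eta> / 2)"
      by (simp_all add: x'_def y'_def)
    note el = elim[unfolded e, folded x'_def y'_def]
    have "RE (Suc d) l K' L x' y'"
    proof (rule RE_fused[where xa = "x' - h" and xb = "x' + \<eta> / 2", OF K' L])
      show "iota \<eta> d (K_ext (Suc d) K' x' v) = Xop d Kh K x' (iota \<eta> d v)" for v using el by simp
      show "RE 1 l Kh L (x' - h) y'" by (rule reflection_imp_RE[OF R1 Kh L]) (use el in auto)
      show "RE d l K L (x' + \<eta> / 2) y'" by (rule reflection_imp_RE[OF Rd K L]) (use el in auto)
    qed (use el in \<open>auto simp: h_def\<close>)
    then show ?case by (simp only: x'_def y'_def)
  qed
qed


section \<open>The fused family\<close>

text \<open>Index 0 is a dummy value; index 1 is spin \<open>1/2\<close>.\<close>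

fun fam :: "(complex \<Rightarrow> nat vec \<Rightarrow> nat vec) \<Rightarrow> nat \<Rightarrow> complex \<Rightarrow> nat vec \<Rightarrow> nat vec" where
  "fam Kh 0 = Kh"
| "fam Kh (Suc 0) = Kh"
| "fam Kh (Suc (Suc n)) = fuse (Suc n) Kh (fam Kh (Suc n))"

context
  fixes Kh
  assumes Kh: "meromorphic_K 1 Kh" and RE: "reflection_equation \<eta> 1 1 Kh Kh"
begin

lemma fam_meromorphic: "meromorphic_K (Suc n) (fam Kh (Suc n))"
  using Kh by (induction n) (auto intro!: fuse_meromorphic)

lemma fam_fusion:
  "reflection_equation \<eta> (Suc n) 1 (fam Kh (Suc n)) Kh"
  "fusion_relation \<eta> (Suc n) Kh (fam Kh (Suc n)) (fam Kh (Suc (Suc n)))" (is ?second)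
proof -
  have rel: "fusion_relation \<eta> (Suc n) Kh (fam Kh (Suc n)) (fam Kh (Suc (Suc n)))"
    if "reflection_equation \<eta> (Suc n) 1 (fam Kh (Suc n)) Kh" for n
    unfolding fam.simps by (rule fusion_relation_fuse[OF Kh fam_meromorphic that])
  show RE1: "reflection_equation \<eta> (Suc n) 1 (fam Kh (Suc n)) Kh" for n
  proof (induction n)
    case 0
    then show ?case using RE by simp
  next
    case (Suc n)
    show ?case
      by (rule reflection_fused[OF Kh fam_meromorphic fam_meromorphic Kh rel[OF Suc] RE Suc])
  qed
  show ?second
    by (rule rel[OF RE1])
qed

lemma fam_reflection:
  "reflection_equation \<eta> (Suc n) (Suc m) (fam Kh (Suc n)) (fam Kh (Suc m))"
proof -
  have R1: "reflection_equation \<eta> 1 (Suc m) Kh (fam Kh (Suc m))"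
    by (rule reflection_flip[OF fam_meromorphic Kh fam_fusion(1)])
  show ?thesis
  proof (induction n)
    case 0
    then show ?case using R1 by simp
  next
    case (Suc n)
    show ?case
      by (rule reflection_fused[OF Kh fam_meromorphic fam_meromorphic fam_meromorphic fam_fusion(2) R1 Suc])
  qed
qed

lemma fused_family_fam: "fused_family \<eta> Kh (fam Kh)"
  unfolding fused_family_def
proof (intro conjI allI impI)
  show "meromorphic_K d (fam Kh d)" if "2 \<le> d" for d
    using fam_meromorphic[of "d - 1"] that by simp
  show "fusion_relation \<eta> d Kh (fam Kh d) (fam Kh (d + 1))" if "1 \<le> d" for d
    using fam_fusion(2)[of "d - 1"] that by simp
qed simp

text \<open>By induction on the spin, the fusion relations fix the family at generic arguments.\<close>

lemma fused_family_generic_unique: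
  assumes "fused_family \<eta> Kh K'"
  shows "meromorphic_K (Suc n) (K' (Suc n)) \<and> generic (\<lambda>x. \<forall>v. K_ext (Suc n) (fam Kh (Suc n)) x v = K_ext (Suc n) (K' (Suc n)) x v)"
proof (induction n)
  case 0
  then show ?case using assms Kh by (simp add: fused_family_def generic_def)
next
  case (Suc n)
  have K': "meromorphic_K (Suc (Suc n)) (K' (Suc (Suc n)))"
    and rel': "fusion_relation \<eta> (Suc n) Kh (K' (Suc n)) (K' (Suc (Suc n)))"
    using assms by (auto simp: fused_family_def)
  have K'n: "meromorphic_K (Suc n) (K' (Suc n))" using Suc by simp
  have "generic (\<lambda>x. \<forall>v. K_ext (Suc (Suc n)) (fam Kh (Suc (Suc n))) x v = K_ext (Suc (Suc n)) (K' (Suc (Suc n))) x v)"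
    unfolding generic_def
  proof
    fix x0
    have "\<forall>\<^sub>F x in at x0. \<forall>v. K_ext (Suc n) (fam Kh (Suc n)) (\<eta> / 2 + 1 * x) v = K_ext (Suc n) (K' (Suc n)) (\<eta> / 2 + 1 * x) v"
      by (rule generic_affine) (use Suc in auto)
    then show "\<forall>\<^sub>F x in at x0. \<forall>v. K_ext (Suc (Suc n)) (fam Kh (Suc (Suc n))) x v = K_ext (Suc (Suc n)) (K' (Suc (Suc n))) x v"
      using fusion_relation_generic[OF Kh fam_meromorphic[of n] fam_meromorphic[of "Suc n"] fam_fusion(2), unfolded generic_def, rule_format, of x0]
        fusion_relation_generic[OF Kh K'n K' rel', unfolded generic_def, rule_format, of x0]
    proof eventually_elim
      case (elim x)
      have "K_ext (Suc n) (fam Kh (Suc n)) (x + \<eta> / 2) = K_ext (Suc n) (K' (Suc n)) (x + \<eta> / 2)"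
        using elim(1) by (auto simp: add.commute)
      then have X: "Xop (Suc n) Kh (fam Kh (Suc n)) x = Xop (Suc n) Kh (K' (Suc n)) x"
        by (simp add: Xop_def)
      show ?case
      proof
        fix v
        have "iota_inv (Suc n) (iota \<eta> (Suc n) (K_ext (Suc (Suc n)) (fam Kh (Suc (Suc n))) x v)) =
            iota_inv (Suc n) (iota \<eta> (Suc n) (K_ext (Suc (Suc n)) (K' (Suc (Suc n))) x v))"
          using elim(2,3) X by simp
        then show "K_ext (Suc (Suc n)) (fam Kh (Suc (Suc n))) x v = K_ext (Suc (Suc n)) (K' (Suc (Suc n))) x v"
          unfolding iota_inv_iota pr_V_id[OF K_ext_V[OF fam_meromorphic]] pr_V_id[OF K_ext_V[OF K']] .
      qed
    qed
  qed
  then show ?case using K' by simp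
qed

text \<open>By continuity, agreement at generic arguments extends to all regular ones.\<close>

lemma fused_family_unique:
  assumes "fused_family \<eta> Kh K'"
  shows "same_K (Suc n) (fam Kh (Suc n)) (K' (Suc n))"
  unfolding same_K_def
proof (intro allI impI ballI)
  fix x u
  assume reg: "K_regular_at (Suc n) (fam Kh (Suc n)) x" "K_regular_at (Suc n) (K' (Suc n)) x"
    and u: "u \<in> V_space (Suc n)"
  have K': "meromorphic_K (Suc n) (K' (Suc n))"
    and g: "generic (\<lambda>x. \<forall>v. K_ext (Suc n) (fam Kh (Suc n)) x v = K_ext (Suc n) (K' (Suc n)) x v)"
    using fused_family_generic_unique[OF assms] by auto
  have ev: "\<forall>\<^sub>F y in at x. \<forall>u\<in>coord_space {..Suc n}. K_ext (Suc n) (fam Kh (Suc n)) y u = K_ext (Suc n) (K' (Suc n)) y u"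
    using g[unfolded generic_def, rule_format, of x] by eventually_elim simp
  have u': "u \<in> coord_space {..Suc n}" using u by (simp add: V_space_def)
  have "K_ext (Suc n) (fam Kh (Suc n)) x u = K_ext (Suc n) (K' (Suc n)) x u"
    by (rule entries_eq_limit[OF entries_K_ext[OF fam_meromorphic] entries_K_ext[OF K'] ev u']) (use reg in auto)
  then show "fam Kh (Suc n) x u = K' (Suc n) x u"
    by (simp only: K_ext_eq[OF fam_meromorphic u'] K_ext_eq[OF K' u'])
qed

end

end

theorem proposition4p3:
  fixes \<eta> :: complex and Kh :: "complex \<Rightarrow> nat vec \<Rightarrow> nat vec"
  assumes "\<forall>n::nat. n > 0 \<longrightarrow> exp \<eta> ^ n \<noteq> 1"
    and "meromorphic_K 1 Kh"
    and "reflection_equation \<eta> 1 1 Kh Kh"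
  shows "\<exists>K. fused_family \<eta> Kh K \<and>
           (\<forall>K'. fused_family \<eta> Kh K' \<longrightarrow> (\<forall>d\<ge>2. same_K d (K d) (K' d))) \<and>
           (\<forall>d\<ge>1. \<forall>l\<ge>1. reflection_equation \<eta> d l (K d) (K l))"
proof -
  interpret nonroot \<eta> by standard (rule assms(1))
  have "fused_family \<eta> Kh (fam Kh)" by (rule fused_family_fam[OF assms(2,3)])
  moreover have "same_K d (fam Kh d) (K' d)" if "fused_family \<eta> Kh K'" "d \<ge> 2" for K' d
    using fused_family_unique[OF assms(2,3) that(1), of "d - 1"] that(2) by simp
  moreover have "reflection_equation \<eta> d l (fam Kh d) (fam Kh l)" if "d \<ge> 1" "l \<ge> 1" for d l
    using fam_reflection[OF assms(2,3), of "d - 1" "l - 1"] that by simp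
  ultimately show ?thesis by blast
qed

end
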